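(* Let $\widetilde{T}\in\mathbb{N}$ with $\widetilde T\ge 2$, let $k=\lceil 24\log(\widetilde{T}^2)\rceil$ and let the time horizon be $T=4k\widetilde T$. Consider the qubit pure-state multi-armed quantum bandit with action set $\mathcal{S}_2^*$ and an unknown environment $|\psi\rangle\!\langle\psi|\in\mathcal{S}_2^*$. Run the algorithm LinUCB-VVN (described in the context) with $d=3$, $\lambda_0=2$ and $k$ subsamples on the Bloch-vector representation of the problem, i.e. the action $A_t\in\mathbb{S}^2$ chosen by LinUCB-VVN is played as the projector $\Pi_{A_t}=\frac{1}{2}(\mathbb{I}+A_t\cdot\sigma)$ and the observed reward $X_t\in\{0,1\}$ is fed to the algorithm as $2X_t-1$. Then the resulting policy $\pi$ satisfies $$\mathbb{E}_{\psi,\pi}\big[R_T(\mathcal{S}_2^*,\psi,\pi)\big]\le C_1\log(T)+C_2\log^2(T)$$ for universal constants $C_1,C_2\ge 0$. Moreover, at each time step $t\in[T]$ the algorithm outputs an estimator $\hat\Pi_t\in\mathcal{S}_2^*$ (the projector whose Bloch vector is one of the actions played in the batch containing round $t$) such that $$\mathbb{E}_{\psi,\pi}\big[1-\langle\psi|\hat\Pi_t|\psi\rangle\big]\le \frac{C_3\log(T)}{t}$$ for a universal constant $C_3\ge 0$.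
   Context: $\mathcal{S}_2^*$ denotes the set of rank-one projectors (pure states) on $\mathbb{C}^2$, and $\sigma=(\sigma_x,\sigma_y,\sigma_z)$ are the Pauli matrices; every $\Pi\in\mathcal{S}_2^*$ is $\frac12(\mathbb{I}+a\cdot\sigma)$ for a unique $a\in\mathbb{S}^2$ (its Bloch vector). Pure-state multi-armed quantum bandit: in each round $t=1,\dots,T$ the learner receives a fresh copy of the unknown $|\psi\rangle$, chooses (based on all past actions and rewards) a projector $\Pi_{A_t}\in\mathcal{S}_2^*$, measures the two-outcome POVM $\{\Pi_{A_t},\mathbb{I}-\Pi_{A_t}\}$ and receives reward $X_t=1$ with probability $\langle\psi|\Pi_{A_t}|\psi\rangle$ and $X_t=0$ otherwise. The regret is $R_T(\mathcal{S}_2^*,\psi,\pi)=\sum_{t=1}^T\big(1-\langle\psi|\Pi_{A_t}|\psi\rangle\big)$, and $\mathbb{E}_{\psi,\pi}$ is expectation over the induced process. Logarithms are natural. Algorithm LinUCB-VVN (parameters: dimension $d\ge2$, $\lambda_0>0$, $k\in\mathbb{N}$, number of batches $\widetilde T$). Let $\beta_w=9(3\sqrt d+\lambda_0)^2$ and for a real positive semidefinite $d\times d$ matrix $X$ let $\omega(X)=\sqrt{\lambda_{\max}(X)}/(12\sqrt{d-1}\,\beta_w)$. Set $V_0=\lambda_0\mathbb{I}_d$ and pick an arbitrary $\hat\theta_0\in\mathbb{S}^{d-1}$. For batch $s=1,\dots,\widetilde T$: let $v_{s-1,1},\dots,v_{s-1,d}$ be orthonormal eigenvectors of $V_{s-1}$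 ordered by non-decreasing eigenvalue, $\lambda_{s-1,1}=\lambda_{\min}(V_{s-1})$, $c_{s-1}=\hat\theta_{s-1}/\|\hat\theta_{s-1}\|_2$; for $i\in[d-1]$ set $A^{\pm}_{s,i}=\tilde A^\pm_{s,i}/\|\tilde A^\pm_{s,i}\|_2$ with $\tilde A^\pm_{s,i}=c_{s-1}\pm\lambda_{s-1,1}^{-1/2}v_{s-1,i}$. Each of the $2(d-1)$ actions is played $k$ times, giving rewards $X^\pm_{s,i,j}$, $j\in[k]$ (so a batch consists of $2(d-1)k$ rounds). Let $w_1=1$ and $w_s=\omega(V_{s-1})$ for $s\ge2$; set $V_s=V_{s-1}+w_s\sum_{i=1}^{d-1}\big(A^+_{s,i}(A^+_{s,i})^{\mathsf T}+A^-_{s,i}(A^-_{s,i})^{\mathsf T}\big)$, and for $j\in[k]$, $\hat\theta_{s,j}=V_s^{-1}\sum_{r=1}^s w_r\sum_{i=1}^{d-1}\big(X^+_{r,i,j}A^+_{r,i}+X^-_{r,i,j}A^-_{r,i}\big)$. With $\|x\|_V=\sqrt{x^{\mathsf T}Vx}$, let $y_j=\mathrm{median}\{\|\hat\theta_{s,j}-\hat\theta_{s,l}\|_{V_s}:l\in[k]\setminus\{j\}\}$ and $\hat\theta_s=\hat\theta_{s,j^*}$ with $j^*\in\arg\min_j y_j$. *)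

theory Defs
  imports "HOL-Probability.Probability"
begin

text \<open>Indices of type 2: 1 is the first basis vector, 2 the second.\<close>

definition pauli_x :: "complex^2^2" where
  "pauli_x = (\<chi> i j. if i = j then 0 else 1)"

definition pauli_y :: "complex^2^2" where
  "pauli_y = (\<chi> i j. if i = j then 0 else if i = 1 then - \<i> else \<i>)"

definition pauli_z :: "complex^2^2" where
  "pauli_z = (\<chi> i j. if i \<noteq> j then 0 else if i = 1 then 1 else -1)"

definition bloch_proj :: "real^3 \<Rightarrow> complex^2^2" where
  "bloch_proj a = (1/2::real) *\<^sub>R (mat 1 + (a$1) *\<^sub>R pauli_x + (a$2) *\<^sub>R pauli_y + (a$3) *\<^sub>R pauli_z)"

definition expval :: "complex^2 \<Rightarrow> complex^2^2 \<Rightarrow> real" where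
  "expval psi P = Re (\<Sum>i\<in>UNIV. cnj (psi$i) * (P *v psi)$i)"

definition qubit_reward :: "complex^2 \<Rightarrow> real^3 \<Rightarrow> real" where
  "qubit_reward psi a = expval psi (bloch_proj a)"

definition eigvals :: "real^'n^'n \<Rightarrow> real set" where
  "eigvals X = {l. \<exists>v. v \<noteq> 0 \<and> X *v v = l *\<^sub>R v}"

definition lam_max :: "real^'n^'n \<Rightarrow> real" where
  "lam_max X = Max (eigvals X)"

definition lam_min :: "real^'n^'n \<Rightarrow> real" where
  "lam_min X = Min (eigvals X)"

definition outer :: "real^'n \<Rightarrow> real^'n \<Rightarrow> real^'n^'n" where
  "outer a b = (\<chi> i j. a$i * b$j)"

definition vnorm :: "real^'n^'n \<Rightarrow> real^'n \<Rightarrow> real" where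
  "vnorm V x = sqrt (x \<bullet> (V *v x))"

text \<open>An admissible choice of orthonormal eigenvectors v_1..v_d of a symmetric matrix,
  ordered by non-decreasing eigenvalue (the choice is arbitrary in the algorithm).\<close>
definition eig_selector :: "(real^'n^'n \<Rightarrow> nat \<Rightarrow> real^'n) \<Rightarrow> bool" where
  "eig_selector E \<longleftrightarrow> (\<forall>X. transpose X = X \<longrightarrow>
     (\<forall>i\<in>{1..CARD('n)}. \<forall>j\<in>{1..CARD('n)}. E X i \<bullet> E X j = (if i = j then 1 else 0)) \<and>
     (\<forall>i\<in>{1..CARD('n)}. \<exists>l. X *v E X i = l *\<^sub>R E X i) \<and>
     (\<forall>i\<in>{1..CARD('n)}. \<forall>j\<in>{1..CARD('n)}. i \<le> j \<longrightarrow>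
        E X i \<bullet> (X *v E X i) \<le> E X j \<bullet> (X *v E X j)))"

definition median_list :: "real list \<Rightarrow> real" where
  "median_list xs = (let ys = sort xs; m = length xs in
     if odd m then ys ! (m div 2) else (ys ! (m div 2 - 1) + ys ! (m div 2)) / 2)"

definition beta_w :: "nat \<Rightarrow> real \<Rightarrow> real" where
  "beta_w d lam0 = 9 * (3 * sqrt (real d) + lam0)^2"

definition omega_w :: "nat \<Rightarrow> real \<Rightarrow> real^'n^'n \<Rightarrow> real" where
  "omega_w d lam0 X = sqrt (lam_max X) / (12 * sqrt (real d - 1) * beta_w d lam0)"

definition vvn_y :: "nat \<Rightarrow> real^'n^'n \<Rightarrow> (nat \<Rightarrow> real^'n) \<Rightarrow> nat \<Rightarrow> real" where
  "vvn_y k V th j = median_list (map (\<lambda>l. vnorm V (th j - th l)) (filter (\<lambda>l. l \<noteq> j) [1..<k+1]))"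

definition vvn_selector :: "nat \<Rightarrow> (real^'n^'n \<Rightarrow> (nat \<Rightarrow> real^'n) \<Rightarrow> nat) \<Rightarrow> bool" where
  "vvn_selector k J \<longleftrightarrow> (\<forall>V th. J V th \<in> {1..k} \<and> (\<forall>j\<in>{1..k}. vvn_y k V th (J V th) \<le> vvn_y k V th j))"

text \<open>State after s completed batches: (s, V_s, hat theta_s, S_s) where
  S_s j = sum_{r<=s} w_r sum_i (X^+_{r,i,j} A^+_{r,i} + X^-_{r,i,j} A^-_{r,i}).\<close>
type_synonym 'n alg_state = "nat \<times> ((real^'n)^'n) \<times> (real^'n) \<times> (nat \<Rightarrow> real^'n)"

definition alg_init :: "real \<Rightarrow> real^'n \<Rightarrow> 'n alg_state" where
  "alg_init lam0 th0 = (0, lam0 *\<^sub>R mat 1, th0, (\<lambda>j. 0))"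

definition alg_actions :: "(real^'n^'n \<Rightarrow> nat \<Rightarrow> real^'n) \<Rightarrow> 'n alg_state \<Rightarrow> nat \<Rightarrow> bool \<Rightarrow> real^'n" where
  "alg_actions E st i b = (case st of (s, V, th, S) \<Rightarrow>
     let c = th /\<^sub>R norm th; lam1 = lam_min V; v = E V i;
         At = (if b then c + (1 / sqrt lam1) *\<^sub>R v else c - (1 / sqrt lam1) *\<^sub>R v)
     in At /\<^sub>R norm At)"

text \<open>Update after one batch with raw rewards X (True = reward 1); the algorithm is fed 2X-1.\<close>
definition alg_step :: "real \<Rightarrow> nat \<Rightarrow> (real^'n^'n \<Rightarrow> nat \<Rightarrow> real^'n) \<Rightarrow>
    (real^'n^'n \<Rightarrow> (nat \<Rightarrow> real^'n) \<Rightarrow> nat) \<Rightarrow> 'n alg_state \<Rightarrow> (nat \<times> bool \<times> nat \<Rightarrow> bool) \<Rightarrow> 'n alg_state" where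
  "alg_step lam0 k E J st X = (case st of (s, V, th, S) \<Rightarrow>
     let d = CARD('n); A = alg_actions E st;
         w = (if s = 0 then 1 else omega_w d lam0 V);
         V' = V + w *\<^sub>R (\<Sum>i\<in>{1..d-1}. outer (A i True) (A i True) + outer (A i False) (A i False));
         Y = (\<lambda>idx. if X idx then 1 else (-1::real));
         S' = (\<lambda>j. S j + w *\<^sub>R (\<Sum>i\<in>{1..d-1}. Y (i, True, j) *\<^sub>R A i True + Y (i, False, j) *\<^sub>R A i False));
         thj = (\<lambda>j. matrix_inv V' *v S' j)
     in (Suc s, V', thj (J V' thj), S'))"

definition batch_rewards :: "(real^'n \<Rightarrow> real) \<Rightarrow> nat \<Rightarrow> (real^'n^'n \<Rightarrow> nat \<Rightarrow> real^'n) \<Rightarrow>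
    'n alg_state \<Rightarrow> (nat \<times> bool \<times> nat \<Rightarrow> bool) pmf" where
  "batch_rewards p k E st =
     Pi_pmf ({1..CARD('n)-1} \<times> UNIV \<times> {1..k}) False
       (\<lambda>(i, b, j). bernoulli_pmf (p (alg_actions E st i b)))"

fun alg_run :: "(real^'n \<Rightarrow> real) \<Rightarrow> real \<Rightarrow> nat \<Rightarrow> (real^'n^'n \<Rightarrow> nat \<Rightarrow> real^'n) \<Rightarrow>
    (real^'n^'n \<Rightarrow> (nat \<Rightarrow> real^'n) \<Rightarrow> nat) \<Rightarrow> real^'n \<Rightarrow> nat \<Rightarrow> 'n alg_state list pmf" where
  "alg_run p lam0 k E J th0 0 = return_pmf [alg_init lam0 th0]"
| "alg_run p lam0 k E J th0 (Suc n) =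
     bind_pmf (alg_run p lam0 k E J th0 n)
       (\<lambda>l. map_pmf (\<lambda>X. l @ [alg_step lam0 k E J (last l) X]) (batch_rewards p k E (last l)))"

text \<open>Action played at round t (t >= 1): batch (t-1) div (2(d-1)k) (0-based), inside which
  A^+_1 is played k times, then A^-_1 k times, then A^+_2, A^-_2, ...\<close>
definition round_action :: "(real^'n^'n \<Rightarrow> nat \<Rightarrow> real^'n) \<Rightarrow> nat \<Rightarrow> 'n alg_state list \<Rightarrow> nat \<Rightarrow> real^'n" where
  "round_action E k l t = (let bs = 2 * (CARD('n) - 1) * k; q = (t - 1) mod bs in
     alg_actions E (l ! ((t - 1) div bs)) (q div (2 * k) + 1) (q mod (2 * k) < k))"

end

theory Submission
  imports Defs
begin

text \<open>
  Write \<open>T\<close> for the trace of the design matrix \<open>V\<close>, and \<open>M\<^sub>j = \<Sum> w \<epsilon> A\<close> for the noise of the \<open>j\<close>-th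
  estimator. By Titu's inequality each pair of actions raises the quadratic form of \<open>V\<close> along \<open>v\<^sub>i\<close> by at
  least \<open>2w/(\<lambda>\<^sub>m\<^sub>i\<^sub>n + 1)\<close>, whatever the estimator is, so that \<open>\<lambda>\<^sub>m\<^sub>i\<^sub>n\<close> is at least of order \<open>\<surd>T\<close>, while \<open>\<surd>T\<close> is of
  the order of the number of batches.

  The actions depend on the rewards of all \<open>k\<close> subsamples, so the \<open>k\<close> estimators are not independent.
  But given the past the rewards of different subsamples are independent and \<open>V\<close> is known; hence
  the product over \<open>j\<close> of affine functions of the energies of \<open>M\<^sub>j\<close>, compensated by their quadratic
  variation, is a supermartingale. It shows that with probability \<open>1 - O(N\<^sup>-\<^sup>4)\<close>, where \<open>N\<close> is the number
  of batches, more than half of the energies are below 3.3 times the compensator. The energies are weighted differently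
  along the Bloch vector and orthogonally to it, where variance is small because the actions
  are close to the Bloch vector. As long as the error in the norm of \<open>V\<close> is at most 3.3, the variance
  bounds reproduce the same error bound after the next batch, by the majority property of the median.
  For small \<open>T\<close> this needs no assumption on the estimator, since the weights are then so
  small that the trivial bound on the variance suffices.

  The compensator is only bounded in terms of the random quantity \<open>T\<close>. Therefore there is one
  supermartingale for every integer level \<open>L\<close>, stopped when \<open>T\<close> exceeds \<open>L\<close>, and a union bound over the
  levels.
\<close>

section \<open>Spectral decomposition\<close>

text \<open>The family is injective and independent, so by counting dimensions it spans the space
  and is an orthonormal basis.\<close>

lemma orthonormal_family_expand:
  fixes e :: "nat \<Rightarrow> real^'n"
  assumes "\<And>i j. i \<in> {1..CARD('n)} \<Longrightarrow> j \<in> {1..CARD('n)} \<Longrightarrow> e i \<bullet> e j = (if i = j then 1 else 0)"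
  shows "(\<Sum>i=1..CARD('n). (e i \<bullet> x) *\<^sub>R e i) = x"
proof -
  let ?I = "{1..CARD('n)}" and ?B = "e ` {1..CARD('n)}"
  have inj: "inj_on e ?I"
  proof (rule inj_onI)
    fix i j assume "i \<in> ?I" "j \<in> ?I" "e i = e j"
    then show "i = j" using assms[of i i] assms[of i j] by (auto split: if_splits)
  qed
  have po: "pairwise orthogonal ?B"
    using assms by (auto simp: pairwise_def orthogonal_def split: if_splits)
  have n1: "norm v = 1" if "v \<in> ?B" for v
    using assms that by (auto simp: norm_eq_sqrt_inner)
  then have "0 \<notin> ?B" by force
  then have ind: "independent ?B"
    using po pairwise_orthogonal_independent by blast
  have "card ?B = DIM(real^'n)" using card_image[OF inj] by simp
  then have "span ?B = UNIV"
    using ind card_eq_dim[of ?B UNIV] by (simp add: dim_UNIV finite_imageI top.extremum_unique)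
  then have "(\<Sum>v\<in>?B. (v \<bullet> x) *\<^sub>R v) = x"
    using orthonormal_basis_expand[OF po n1, of x] by (simp add: inner_commute)
  then show ?thesis by (subst (asm) sum.reindex[OF inj]) (simp add: o_def)
qed

text \<open>The Rayleigh quotient at a unit eigenvector, hence its eigenvalue;
  \<open>eig_selector\<close> states the ordering in this form.\<close>

definition eigv :: "(real^'n^'n \<Rightarrow> nat \<Rightarrow> real^'n) \<Rightarrow> real^'n^'n \<Rightarrow> nat \<Rightarrow> real" where
  "eigv E X i = E X i \<bullet> (X *v E X i)"

context
  fixes E :: "real^'n^'n \<Rightarrow> nat \<Rightarrow> real^'n" and X :: "real^'n^'n"
  assumes sel: "eig_selector E" and sym: "transpose X = X"
begin

lemma selector_orthonormal:
  "i \<in> {1..CARD('n)} \<Longrightarrow> j \<in> {1..CARD('n)} \<Longrightarrow> E X i \<bullet> E X j = (if i = j then 1 else 0)"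
  using sel sym unfolding eig_selector_def by blast

lemma selector_norm: "i \<in> {1..CARD('n)} \<Longrightarrow> norm (E X i) = 1"
  using selector_orthonormal[of i i] by (simp add: norm_eq_sqrt_inner)

lemma selector_expand: "(\<Sum>i=1..CARD('n). (E X i \<bullet> x) *\<^sub>R E X i) = x"
  by (rule orthonormal_family_expand) (rule selector_orthonormal)

lemma selector_eigen: 
  assumes "i \<in> {1..CARD('n)}" shows "X *v E X i = eigv E X i *\<^sub>R E X i"
proof -
  obtain l where l: "X *v E X i = l *\<^sub>R E X i"
    using sel sym assms unfolding eig_selector_def by blast
  then have "eigv E X i = l" unfolding eigv_def using selector_orthonormal[OF assms assms] by simp
  with l show ?thesis by simp
qed

lemma eigv_mono: "i \<in> {1..CARD('n)} \<Longrightarrow> j \<in> {1..CARD('n)} \<Longrightarrow> i \<le> j \<Longrightarrow> eigv E X i \<le> eigv E X j"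
  using sel sym unfolding eig_selector_def eigv_def by blast

lemma selector_apply: "X *v x = (\<Sum>i=1..CARD('n). (eigv E X i * (E X i \<bullet> x)) *\<^sub>R E X i)"
proof -
  have "X *v x = X *v (\<Sum>i=1..CARD('n). (E X i \<bullet> x) *\<^sub>R E X i)" by (simp only: selector_expand)
  also have "\<dots> = (\<Sum>i=1..CARD('n). (E X i \<bullet> x) *\<^sub>R (X *v E X i))"
    by (simp add: linear_sum[OF matrix_vector_mul_linear] matrix_vector_mult_scaleR)
  also have "\<dots> = (\<Sum>i=1..CARD('n). (eigv E X i * (E X i \<bullet> x)) *\<^sub>R E X i)"
    by (rule sum.cong) (simp_all add: selector_eigen mult.commute)
  finally show ?thesis .
qed

lemma selector_quadratic: "x \<bullet> (X *v x) = (\<Sum>i=1..CARD('n). eigv E X i * (E X i \<bullet> x)\<^sup>2)"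
  by (subst selector_apply) (simp add: inner_sum_right power2_eq_square inner_commute mult.assoc)

lemma selector_norm_sq: "(norm x)\<^sup>2 = (\<Sum>i=1..CARD('n). (E X i \<bullet> x)\<^sup>2)"
proof -
  have "(norm x)\<^sup>2 = x \<bullet> (\<Sum>i=1..CARD('n). (E X i \<bullet> x) *\<^sub>R E X i)"
    by (simp only: selector_expand power2_norm_eq_inner)
  also have "\<dots> = (\<Sum>i=1..CARD('n). (E X i \<bullet> x)\<^sup>2)"
    by (simp add: inner_sum_right power2_eq_square inner_commute)
  finally show ?thesis .
qed

text \<open>Some coefficient of an eigenvector in the selected basis is nonzero, and comparing it on
  both sides of the eigenvalue equation identifies the eigenvalue. The spectrum is thus finite, so
  \<open>Min\<close> and \<open>Max\<close> in \<open>lam_min\<close> and \<open>lam_max\<close>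
  have their usual meaning.\<close>

lemma eigvals_selector: "eigvals X = eigv E X ` {1..CARD('n)}"
proof (intro equalityI subsetI)
  fix l assume "l \<in> eigvals X"
  then obtain v where v: "v \<noteq> 0" "X *v v = l *\<^sub>R v" unfolding eigvals_def by auto
  have "\<exists>i\<in>{1..CARD('n)}. E X i \<bullet> v \<noteq> 0"
  proof (rule ccontr)
    assume "\<not> ?thesis"
    then have "(norm v)\<^sup>2 = 0" by (subst selector_norm_sq) simp
    with v show False by simp
  qed
  then obtain i where i: "i \<in> {1..CARD('n)}" "E X i \<bullet> v \<noteq> 0" by blast
  have "E X i \<bullet> (X *v v) = (\<Sum>j=1..CARD('n). (eigv E X j * (E X j \<bullet> v)) * (E X i \<bullet> E X j))"
    by (subst selector_apply) (simp add: inner_sum_right)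
  also have "\<dots> = (\<Sum>j=1..CARD('n). if j = i then eigv E X i * (E X i \<bullet> v) else 0)"
    using i by (intro sum.cong) (auto simp: selector_orthonormal)
  also have "\<dots> = eigv E X i * (E X i \<bullet> v)" using i by simp
  finally have "l = eigv E X i" using v i by simp
  then show "l \<in> eigv E X ` {1..CARD('n)}" using i by blast
next
  fix l assume "l \<in> eigv E X ` {1..CARD('n)}"
  then obtain i where i: "i \<in> {1..CARD('n)}" "l = eigv E X i" by blast
  then have "E X i \<noteq> 0" using selector_norm[of i] by force
  then show "l \<in> eigvals X" unfolding eigvals_def using i selector_eigen by blast
qed

lemma lam_min_selector: "lam_min X = eigv E X 1"
  unfolding lam_min_def eigvals_selector
  by (rule Min_eqI) (auto intro: eigv_mono simp: Suc_le_eq)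

lemma lam_max_selector: "lam_max X = eigv E X CARD('n)"
  unfolding lam_max_def eigvals_selector
  by (rule Max_eqI) (auto intro: eigv_mono simp: Suc_le_eq)

lemma trace_selector: "trace X = (\<Sum>i=1..CARD('n). eigv E X i)"
proof -
  have "trace X = (\<Sum>a\<in>UNIV. axis a 1 \<bullet> (X *v axis a 1))"
    unfolding trace_def by (simp add: inner_axis' matrix_vector_mul_component inner_axis)
  also have "\<dots> = (\<Sum>a\<in>UNIV. \<Sum>i=1..CARD('n). eigv E X i * (E X i $ a)\<^sup>2)"
    by (subst selector_quadratic) (simp add: inner_axis)
  also have "\<dots> = (\<Sum>i=1..CARD('n). eigv E X i * (\<Sum>a\<in>UNIV. (E X i $ a)\<^sup>2))"
    by (subst sum.swap) (simp add: sum_distrib_left)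
  also have "\<dots> = (\<Sum>i=1..CARD('n). eigv E X i)"
  proof (rule sum.cong)
    fix i assume "i \<in> {1..CARD('n)}"
    then have "E X i \<bullet> E X i = 1" using selector_orthonormal by simp
    then have "(\<Sum>a\<in>UNIV. (E X i $ a)\<^sup>2) = 1" by (simp add: inner_vec_def power2_eq_square)
    then show "eigv E X i * (\<Sum>a\<in>UNIV. (E X i $ a)\<^sup>2) = eigv E X i" by simp
  qed simp
  finally show ?thesis .
qed

lemma lam_min_quadratic: "lam_min X * (norm x)\<^sup>2 \<le> x \<bullet> (X *v x)"
  unfolding selector_quadratic selector_norm_sq sum_distrib_left lam_min_selector
  by (intro sum_mono mult_right_mono eigv_mono) (auto simp: Suc_le_eq)

lemma lam_min_greatest:
  assumes "\<And>x. b * (norm x)\<^sup>2 \<le> x \<bullet> (X *v x)" shows "b \<le> lam_min X"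
  using assms[of "E X 1"] selector_norm[of 1]
  by (simp add: lam_min_selector eigv_def Suc_le_eq)

text \<open>By Bessel's inequality every eigenvalue is counted with weight at most 1. With the Bloch
  vector as one of the pair, this bounds the form in an orthogonal direction by the part of the
  trace not spent along the Bloch vector.\<close>

lemma orthonormal_pair_trace:
  assumes psd: "\<And>x. 0 \<le> x \<bullet> (X *v x)" and p: "norm p = 1" and q: "norm q = 1" and pq: "p \<bullet> q = 0"
  shows "p \<bullet> (X *v p) + q \<bullet> (X *v q) \<le> trace X"
proof -
  have bessel: "(e \<bullet> p)\<^sup>2 + (e \<bullet> q)\<^sup>2 \<le> 1" if "norm e = 1" for e
  proof -
    have "0 \<le> (norm (e - (e \<bullet> p) *\<^sub>R p - (e \<bullet> q) *\<^sub>R q))\<^sup>2" by simp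
    also have "\<dots> = e \<bullet> e - 2 * (e \<bullet> p)\<^sup>2 - 2 * (e \<bullet> q)\<^sup>2 + (e \<bullet> p)\<^sup>2 * (p \<bullet> p)
       + (e \<bullet> q)\<^sup>2 * (q \<bullet> q) + 2 * (e \<bullet> p) * (e \<bullet> q) * (p \<bullet> q)"
      by (simp only: power2_norm_eq_inner)
         (simp add: inner_diff_left inner_diff_right inner_commute power2_eq_square algebra_simps)
    also have "\<dots> = 1 - (e \<bullet> p)\<^sup>2 - (e \<bullet> q)\<^sup>2"
      using that p q pq by (simp add: norm_eq_sqrt_inner)
    finally show ?thesis by simp
  qed
  have "p \<bullet> (X *v p) + q \<bullet> (X *v q) = (\<Sum>i=1..CARD('n). eigv E X i * ((E X i \<bullet> p)\<^sup>2 + (E X i \<bullet> q)\<^sup>2))"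
    by (simp add: selector_quadratic sum.distrib ring_distribs)
  also have "\<dots> \<le> (\<Sum>i=1..CARD('n). eigv E X i * 1)"
    using psd by (intro sum_mono mult_left_mono bessel selector_norm) (auto simp: eigv_def)
  finally show ?thesis by (simp add: trace_selector)
qed

text \<open>\<open>f\<close> is the square root of \<open>X\<close>; through it
  \<open>vnorm X\<close> inherits the norm laws of the Euclidean norm.\<close>

lemma vnorm_linear_image:
  assumes psd: "\<And>x. 0 \<le> x \<bullet> (X *v x)"
  obtains f :: "real^'n \<Rightarrow> real^'n" where "linear f" "\<And>x. vnorm X x = norm (f x)"
proof
  define f where "f x = (\<Sum>i=1..CARD('n). (sqrt (eigv E X i) * (E X i \<bullet> x)) *\<^sub>R E X i)" for x
  show "linear f"
    unfolding f_def by (intro linearI) 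
      (simp_all add: inner_add_right ring_distribs scaleR_add_left sum.distrib scaleR_sum_right mult.left_commute)
  fix x
  have "f x \<bullet> f x = (\<Sum>i=1..CARD('n). \<Sum>j=1..CARD('n). (sqrt (eigv E X i) * (E X i \<bullet> x)) * (sqrt (eigv E X j) * (E X j \<bullet> x)) * (E X i \<bullet> E X j))"
    unfolding f_def inner_sum_left inner_sum_right sum_distrib_left 
    by (intro sum.cong refl) (simp add: inner_commute)
  also have "\<dots> = (\<Sum>i=1..CARD('n). \<Sum>j=1..CARD('n). if j = i then (sqrt (eigv E X i) * (E X i \<bullet> x))\<^sup>2 else 0)"
    by (intro sum.cong) (auto simp: selector_orthonormal power2_eq_square)
  also have "\<dots> = (\<Sum>i=1..CARD('n). eigv E X i * (E X i \<bullet> x)\<^sup>2)"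
    using psd by (intro sum.cong) (auto simp: power_mult_distrib eigv_def)
  finally show "vnorm X x = norm (f x)"
    by (simp add: vnorm_def selector_quadratic norm_eq_sqrt_inner)
qed

end

section \<open>Medians\<close>

lemma length_filter_sort: "length (filter P (sort xs)) = length (filter P xs)"
  by (metis mset_filter mset_sort size_mset)

lemma sorted_nth_le_iff:
  fixes ys :: "real list"
  assumes "sorted ys" "i < length ys"
  shows "ys ! i \<le> v \<longleftrightarrow> i < length (filter (\<lambda>x. x \<le> v) ys)"
proof -
  have len: "length (filter (\<lambda>x. x \<le> v) ys) = card {i'. i' < length ys \<and> ys ! i' \<le> v}"
    by (rule length_filter_conv_card)
  show ?thesis
  proof
    assume "ys ! i \<le> v"
    then have "{..i} \<subseteq> {i'. i' < length ys \<and> ys ! i' \<le> v}"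
      using assms by (auto intro: order_trans[OF sorted_nth_mono])
    then have "card {..i} \<le> card {i'. i' < length ys \<and> ys ! i' \<le> v}" by (intro card_mono) auto
    then show "i < length (filter (\<lambda>x. x \<le> v) ys)" using len by simp
  next
    assume *: "i < length (filter (\<lambda>x. x \<le> v) ys)"
    show "ys ! i \<le> v"
    proof (rule ccontr)
      assume "\<not> ys ! i \<le> v"
      then have "{i'. i' < length ys \<and> ys ! i' \<le> v} \<subseteq> {..<i}"
        using assms sorted_nth_mono[OF assms(1), of i] by (force simp: not_le)
      then have "card {i'. i' < length ys \<and> ys ! i' \<le> v} \<le> card {..<i}" by (intro card_mono) auto
      then show False using * len by simp
    qed
  qed
qed

text \<open>A strict majority of small entries brings the upper middle entry below \<open>v\<close>;
  for even length the median averages it with an entry that is no larger.\<close>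

lemma median_list_le:
  assumes "length xs div 2 < length (filter (\<lambda>x. x \<le> v) xs)"
  shows "median_list xs \<le> v"
proof -
  let ?ys = "sort xs" and ?m = "length xs"
  have n: "?m div 2 < ?m" using assms order.strict_trans2[OF assms length_filter_le] by simp
  have 1: "?ys ! (?m div 2) \<le> v" 
    using assms n by (subst sorted_nth_le_iff) (auto simp: length_filter_sort)
  have "?ys ! (?m div 2 - 1) \<le> ?ys ! (?m div 2)"
    using n by (intro sorted_nth_mono) auto
  then show ?thesis using 1 by (auto simp: median_list_def Let_def)
qed

text \<open>For even length the average of the two middle entries controls only the lower one, so
  the count is one less than in \<open>median_list_le\<close>.\<close>

lemma median_list_le_imp:
  assumes "median_list xs \<le> v"
  shows "length xs div 2 \<le> length (filter (\<lambda>x. x \<le> v) xs)"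
proof (cases "length xs div 2 = 0")
  case False
  let ?ys = "sort xs" and ?m = "length xs"
  have n: "?m div 2 < ?m" using False by auto
  have le: "?ys ! (?m div 2 - 1) \<le> ?ys ! (?m div 2)"
    using n by (intro sorted_nth_mono) auto
  have "?ys ! (?m div 2 - 1) \<le> v"
    using assms le by (auto simp: median_list_def Let_def split: if_splits)
  then have "?m div 2 - 1 < length (filter (\<lambda>x. x \<le> v) xs)"
    using n by (subst (asm) sorted_nth_le_iff) (auto simp: length_filter_sort)
  then show ?thesis by simp
qed simp

lemma length_filter_neq_upt:
  fixes f :: "nat \<Rightarrow> 'a"
  shows "length (filter P (map f (filter (\<lambda>l. l \<noteq> j) [1..<k+1]))) = card {l\<in>{1..k} - {j}. P (f l)}"
proof -
  have "length (filter P (map f (filter (\<lambda>l. l \<noteq> j) [1..<k+1]))) 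
      = length (filter (\<lambda>l. l \<noteq> j \<and> P (f l)) [1..<k+1])"
    by (simp add: filter_map o_def conj_commute)
  also have "\<dots> = card (set (filter (\<lambda>l. l \<noteq> j \<and> P (f l)) [1..<k+1]))"
    by (rule distinct_card[symmetric]) simp
  also have "set (filter (\<lambda>l. l \<noteq> j \<and> P (f l)) [1..<k+1]) = {l\<in>{1..k} - {j}. P (f l)}"
    by auto
  finally show ?thesis .
qed

lemma length_neq_upt:
  assumes "j \<in> {1..k}"
  shows "length (filter (\<lambda>l. l \<noteq> j) [1..<k+1]) = k - 1"
proof -
  have "length (filter (\<lambda>l. l \<noteq> j) [1..<k+1]) = card {l\<in>{1..k} - {j}. True}"
    using length_filter_neq_upt[of "\<lambda>_. True" "\<lambda>l. l" j k] by (simp del: upt_Suc)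
  also have "{l\<in>{1..k} - {j}. True} = {1..k} - {j}" by blast
  finally show ?thesis using assms by (simp only: card_Diff_singleton card_atLeastAtMost diff_add_inverse2)
qed

text \<open>Members of \<open>G\<close> are within \<open>2 * r\<close> of each other and form a
  majority, so they have a median distance of at most \<open>2 * r\<close>, and the minimizer does
  too. Hence about half of the indices lie within \<open>2 * r\<close> of the selected one, and one
  of them is in \<open>G\<close>; the triangle inequality gives \<open>3 * r\<close>.\<close>

lemma vvn_selector_close:
  fixes th :: "nat \<Rightarrow> real^'n"
  assumes J: "vvn_selector k J"
    and tri: "\<And>x y. vnorm V (x + y) \<le> vnorm V x + vnorm V y" and sym: "\<And>x. vnorm V (- x) = vnorm V x"
    and G: "G \<subseteq> {1..k}" "k + 3 \<le> 2 * card G"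
    and close: "\<And>j. j \<in> G \<Longrightarrow> vnorm V (th j - c) \<le> r"
  shows "vnorm V (th (J V th) - c) \<le> 3 * r"
proof -
  define s where "s = J V th"
  have s: "s \<in> {1..k}" and smin: "\<And>j. j \<in> {1..k} \<Longrightarrow> vvn_y k V th s \<le> vvn_y k V th j"
    using J unfolding vvn_selector_def s_def by blast+
  have fG: "finite G" using G finite_subset by blast
  have "G \<noteq> {}" using G by force
  then obtain g where g: "g \<in> G" by blast
  have gk: "g \<in> {1..k}" using g G by blast
  have "vvn_y k V th g \<le> 2 * r"
    unfolding vvn_y_def
  proof (rule median_list_le, unfold length_filter_neq_upt length_map length_neq_upt[OF gk])
    have "G - {g} \<subseteq> {l \<in> {1..k} - {g}. vnorm V (th g - th l) \<le> 2 * r}"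
    proof safe
      fix l assume l: "l \<in> G" 
      show "l \<in> {1..k}" using l G by blast
      have "vnorm V (th g - th l) = vnorm V ((th g - c) + - (th l - c))" by simp
      also have "\<dots> \<le> r + r"
        using close[OF g] close[OF l] tri[of "th g - c" "- (th l - c)"] sym[of "th l - c"] by linarith
      finally show "vnorm V (th g - th l) \<le> 2 * r" by simp
    qed
    then have "card (G - {g}) \<le> card {l \<in> {1..k} - {g}. vnorm V (th g - th l) \<le> 2 * r}"
      by (intro card_mono) auto
    then show "(k - 1) div 2 < card {l \<in> {1..k} - {g}. vnorm V (th g - th l) \<le> 2 * r}"
      using G(2) g fG by simp
  qed
  then have "vvn_y k V th s \<le> 2 * r" using smin[OF gk] by linarith
  then have "(k - 1) div 2 \<le> card {l \<in> {1..k} - {s}. vnorm V (th s - th l) \<le> 2 * r}"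
    unfolding vvn_y_def 
    by (drule_tac median_list_le_imp) (simp only: length_filter_neq_upt length_map length_neq_upt[OF s])
  moreover define N where "N = {l \<in> {1..k} - {s}. vnorm V (th s - th l) \<le> 2 * r}"
  ultimately have N: "(k - 1) div 2 \<le> card N" by simp
  \<comment> \<open>\<open>N\<close> omits the selected index and is only known to have
    \<open>(k - 1) div 2\<close> elements; the slack 3 in the size of \<open>G\<close> still makes
    the two sizes exceed \<open>k\<close>.\<close>
  have "N \<inter> G \<noteq> {}"
  proof
    assume e: "N \<inter> G = {}"
    have "card N + card G = card (N \<union> G)"
      using e fG by (subst card_Un_disjoint) (auto simp: N_def)
    also have "\<dots> \<le> card {1..k}" using G by (intro card_mono) (auto simp: N_def)
    finally show False using N G(2) by simp
  qed
  then obtain l where l: "l \<in> N" "l \<in> G" by blast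
  have "vnorm V (th s - c) = vnorm V ((th s - th l) + (th l - c))" by simp
  also have "\<dots> \<le> 2 * r + r"
    using l close[of l] tri[of "th s - th l" "th l - c"] unfolding N_def by simp
  finally show ?thesis by (simp add: s_def)
qed

section \<open>Expectations over finite products\<close>

lemma finite_set_Pi_pmf:
  fixes p :: "'a \<Rightarrow> ('b::finite) pmf"
  assumes "finite A" shows "finite (set_pmf (Pi_pmf A d p))"
  by (rule finite_subset[OF set_Pi_pmf_subset'[OF assms]]) (simp add: finite_PiE_dflt assms)

lemma expectation_bind_finite:
  fixes h :: "'b \<Rightarrow> real"
  assumes "finite (set_pmf p)" "\<And>x. x \<in> set_pmf p \<Longrightarrow> finite (set_pmf (f x))"
  shows "measure_pmf.expectation (bind_pmf p f) h = measure_pmf.expectation p (\<lambda>x. measure_pmf.expectation (f x) h)"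
proof -
  have "measure_pmf.expectation p (\<lambda>x. measure_pmf.expectation (f x) h) 
      = (\<Sum>a\<in>set_pmf p. pmf p a *\<^sub>R measure_pmf.expectation (f a) h)"
    using assms(1) by (rule integral_measure_pmf) simp
  then show ?thesis using pmf_expectation_bind[of "set_pmf p" f p h] assms by simp
qed

text \<open>Independence of functions of disjoint blocks of coordinates; the product measure is
  split off one block at a time.\<close>

lemma expectation_Pi_pmf_blocks:
  fixes f :: "'j \<Rightarrow> ('a \<Rightarrow> 'b::finite) \<Rightarrow> real"
  assumes "finite J" "\<And>j. j \<in> J \<Longrightarrow> finite (B j)" "disjoint_family_on B J"
    and "\<And>j x y. j \<in> J \<Longrightarrow> (\<And>i. i \<in> B j \<Longrightarrow> x i = y i) \<Longrightarrow> f j x = f j y"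
  shows "measure_pmf.expectation (Pi_pmf (\<Union>j\<in>J. B j) d p) (\<lambda>x. \<Prod>j\<in>J. f j x)
       = (\<Prod>j\<in>J. measure_pmf.expectation (Pi_pmf (B j) d p) (f j))"
  using assms
proof (induction J rule: finite_induct)
  case (insert j J)
  note fin = finite_set_Pi_pmf[of _ d p]
  let ?U = "\<Union>j\<in>J. B j"
  have fB: "finite (B j)" "finite ?U" using insert.hyps(1) insert.prems(1) by auto
  have dj: "B j \<inter> ?U = {}" 
    using insert.prems(2) insert.hyps by (fastforce simp: disjoint_family_on_def)
  let ?g = "\<lambda>x y i. if i \<in> B j then x i else y i"
  have e1: "f j (?g x y) = f j x" for x y by (rule insert.prems(3)) auto
  have e2: "f j' (?g x y) = f j' y" if "j' \<in> J" for x y j'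
    using that dj by (intro insert.prems(3)) auto
  have "measure_pmf.expectation (Pi_pmf (\<Union>j\<in>insert j J. B j) d p) (\<lambda>x. \<Prod>j\<in>insert j J. f j x)
     = measure_pmf.expectation (pair_pmf (Pi_pmf (B j) d p) (Pi_pmf ?U d p)) (\<lambda>(x, y). \<Prod>j\<in>insert j J. f j (?g x y))"
    unfolding UN_insert Pi_pmf_union[OF fB dj] integral_map_pmf by (simp only: case_prod_unfold)
  also have "\<dots> = measure_pmf.expectation (pair_pmf (Pi_pmf (B j) d p) (Pi_pmf ?U d p)) (\<lambda>(x, y). f j x * (\<Prod>j\<in>J. f j y))"
    using insert.hyps by (intro Bochner_Integration.integral_cong) (auto simp: e1 e2 intro!: prod.cong)
  also have "\<dots> = measure_pmf.expectation (Pi_pmf (B j) d p) (f j) * measure_pmf.expectation (Pi_pmf ?U d p) (\<lambda>y. \<Prod>j\<in>J. f j y)"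
    unfolding pair_pmf_def using fin[OF fB(1)] fin[OF fB(2)] 
    by (simp only: expectation_bind_finite set_return_pmf finite.intros set_bind_pmf finite_UN_I) simp
  also have "measure_pmf.expectation (Pi_pmf ?U d p) (\<lambda>y. \<Prod>j\<in>J. f j y) 
      = (\<Prod>j\<in>J. measure_pmf.expectation (Pi_pmf (B j) d p) (f j))"
  proof (rule insert.IH)
    show "disjoint_family_on B J" using insert.prems(2) by (auto simp: disjoint_family_on_def)
    show "f j x = f j y" if "j \<in> J" "\<And>i. i \<in> B j \<Longrightarrow> x i = y i" for j x y
      using that by (intro insert.prems(3)) auto
  qed (use insert.prems(1) in auto)
  finally show ?case using insert.hyps by simp
qed simp

text \<open>Each centred sign has mean 0 and variance \<open>1 - (2 * q x - 1)\<^sup>2\<close>, so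
  the cross terms vanish. The induction absorbs one term at a time into \<open>m\<close>, which is
  therefore arbitrary.\<close>

lemma expectation_sq_norm_bernoulli_noise:
  fixes m :: "'v::euclidean_space" and b :: "'i \<Rightarrow> 'v"
  assumes "finite I" "\<And>x. x \<in> I \<Longrightarrow> q x \<in> {0..1}"
  shows "measure_pmf.expectation (Pi_pmf I False (\<lambda>x. bernoulli_pmf (q x)))
       (\<lambda>X. (norm (m + (\<Sum>x\<in>I. ((if X x then 1 else -1) - (2 * q x - 1)) *\<^sub>R b x)))\<^sup>2)
     = (norm m)\<^sup>2 + (\<Sum>x\<in>I. (1 - (2 * q x - 1)\<^sup>2) * (norm (b x))\<^sup>2)"
  using assms
proof (induction I arbitrary: m rule: finite_induct)
  case (insert x I)
  have fin: "finite (set_pmf (Pi_pmf I False (\<lambda>x. bernoulli_pmf (q x))))"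
    by (rule finite_set_Pi_pmf[OF insert.hyps(1)])
  let ?e = "\<lambda>y. (if y then 1 else -1) - (2 * q x - 1) :: real"
  let ?S = "\<lambda>f. \<Sum>z\<in>I. ((if f z then 1 else -1) - (2 * q z - 1)) *\<^sub>R b z"
  have eq: "(\<Sum>z\<in>insert x I. ((if (f(x := y)) z then 1 else -1) - (2 * q z - 1)) *\<^sub>R b z) = ?e y *\<^sub>R b x + ?S f" for f y
    using insert.hyps by (auto intro!: sum.cong)
  have expand: "(norm (m + e *\<^sub>R b x))\<^sup>2 = (norm m)\<^sup>2 + 2 * e * (m \<bullet> b x) + e\<^sup>2 * (norm (b x))\<^sup>2" for e
    unfolding power2_norm_eq_inner by (simp add: inner_add_left inner_add_right inner_commute power2_eq_square)
  have q: "q x \<in> {0..1}" using insert.prems by simp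
  have "measure_pmf.expectation (Pi_pmf (insert x I) False (\<lambda>x. bernoulli_pmf (q x)))
       (\<lambda>X. (norm (m + (\<Sum>z\<in>insert x I. ((if X z then 1 else -1) - (2 * q z - 1)) *\<^sub>R b z)))\<^sup>2)
    = measure_pmf.expectation (bernoulli_pmf (q x)) (\<lambda>y. 
       measure_pmf.expectation (Pi_pmf I False (\<lambda>x. bernoulli_pmf (q x))) (\<lambda>f. (norm ((m + ?e y *\<^sub>R b x) + ?S f))\<^sup>2))"
    unfolding Pi_pmf_insert'[OF insert.hyps] map_pmf_def[symmetric]
    by (subst expectation_bind_finite) (simp_all only: finite finite_imageI fin set_map_pmf integral_map_pmf eq add.assoc)
  also have "\<dots> = measure_pmf.expectation (bernoulli_pmf (q x)) (\<lambda>y. (norm (m + ?e y *\<^sub>R b x))\<^sup>2 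
       + (\<Sum>x\<in>I. (1 - (2 * q x - 1)\<^sup>2) * (norm (b x))\<^sup>2))"
    using insert.prems by (subst insert.IH) auto
  also have "\<dots> = (norm m)\<^sup>2 + (1 - (2 * q x - 1)\<^sup>2) * (norm (b x))\<^sup>2 + (\<Sum>x\<in>I. (1 - (2 * q x - 1)\<^sup>2) * (norm (b x))\<^sup>2)"
    using q by (simp only: atLeastAtMost_iff integral_bernoulli_pmf expand if_True if_False)
       (simp add: algebra_simps power2_eq_square)
  finally show ?case using insert.hyps by simp
qed simp

section \<open>A pair of tilted actions\<close>

text \<open>The left side is the squared distance from \<open>t\<close> to the line through
  \<open>a\<close>, on which \<open>r *\<^sub>R a\<close> lies.\<close>

lemma sin_sq_le_dist_sq:
  fixes a t :: "'a::real_inner"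
  assumes "norm a = 1" "norm t = 1"
  shows "1 - (a \<bullet> t)\<^sup>2 \<le> (norm (r *\<^sub>R a - t))\<^sup>2"
proof -
  have "(norm (r *\<^sub>R a - t))\<^sup>2 = r\<^sup>2 * (norm a)\<^sup>2 - 2 * r * (a \<bullet> t) + (norm t)\<^sup>2"
    unfolding power2_norm_eq_inner by (simp add: inner_diff_left inner_diff_right inner_commute power2_eq_square)
  also have "\<dots> = (r - a \<bullet> t)\<^sup>2 + (1 - (a \<bullet> t)\<^sup>2)"
    using assms by (simp add: power2_eq_square algebra_simps)
  finally show ?thesis by simp
qed

lemma inner_sq_le_1:
  fixes a t :: "'a::real_inner"
  assumes "norm a \<le> 1" "norm t = 1" shows "(a \<bullet> t)\<^sup>2 \<le> 1"
proof -
  have "\<bar>a \<bullet> t\<bar> \<le> 1" using Cauchy_Schwarz_ineq2[of a t] assms by simp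
  then show ?thesis by (simp add: abs_square_le_1)
qed

lemma projection_residual_le:
  fixes t x :: "'a::real_inner"
  shows "norm (t - ((x /\<^sub>R norm x) \<bullet> t) *\<^sub>R (x /\<^sub>R norm x)) \<le> norm (x - t)"
proof (cases "x = 0")
  case False
  define a where "a = x /\<^sub>R norm x"
  define r where "r = norm x"
  have a: "norm a = 1" "x = r *\<^sub>R a" using False by (auto simp: a_def r_def)
  have "(norm (t - (a \<bullet> t) *\<^sub>R a))\<^sup>2 = (norm t)\<^sup>2 - 2 * (a \<bullet> t)\<^sup>2 + (a \<bullet> t)\<^sup>2 * (norm a)\<^sup>2"
    unfolding power2_norm_eq_inner by (simp add: inner_diff_left inner_diff_right inner_commute power2_eq_square)
  moreover have "(norm (r *\<^sub>R a - t))\<^sup>2 = r\<^sup>2 * (norm a)\<^sup>2 - 2 * r * (a \<bullet> t) + (norm t)\<^sup>2"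
    unfolding power2_norm_eq_inner by (simp add: inner_diff_left inner_diff_right inner_commute power2_eq_square)
  moreover have "0 \<le> (r - a \<bullet> t)\<^sup>2" by simp
  ultimately have "(norm (t - (a \<bullet> t) *\<^sub>R a))\<^sup>2 \<le> (norm (r *\<^sub>R a - t))\<^sup>2"
    using a(1) by (simp add: power2_eq_square algebra_simps)
  then show ?thesis using a by (metis a_def norm_ge_zero power2_le_imp_le)
qed simp

text \<open>If the estimator \<open>x\<close> vanishes, then \<open>c = 0\<close> by the convention on division, and the two actions
  are \<open>\<plusminus>v\<close>.\<close>
context
  fixes c v t :: "'a::real_inner" and \<mu> :: real and x :: 'a
  assumes c: "c = x /\<^sub>R norm x" and v: "norm v = 1" and \<mu>: "0 < \<mu>" "\<mu> < 1"
begin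

lemma norm_normalized_cases: "norm c = 1 \<or> c = 0"
  using c by (cases "x = 0") auto

text \<open>A zero would force \<open>norm c = \<mu>\<close>, strictly between the only possible
  values 0 and 1.\<close>

lemma tilted_nonzero: "c + \<mu> *\<^sub>R v \<noteq> 0" "c - \<mu> *\<^sub>R v \<noteq> 0"
proof -
  have n: "norm (\<mu> *\<^sub>R v) = \<mu>" using v \<mu> by simp
  show "c + \<mu> *\<^sub>R v \<noteq> 0"
  proof
    assume "c + \<mu> *\<^sub>R v = 0"
    then have "norm c = norm (\<mu> *\<^sub>R v)" by (metis add_eq_0_iff norm_minus_cancel)
    then show False using n \<mu> norm_normalized_cases by auto
  qed
  show "c - \<mu> *\<^sub>R v \<noteq> 0" using n \<mu> norm_normalized_cases by auto
qed

text \<open>The difference of the two unnormalized actions is a multiple of \<open>v\<close>,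
  whatever \<open>c\<close> is. Titu's inequality bounds the sum of the two fractions below by the
  square of this difference over \<open>p + q\<close>, the sum of the squared lengths.\<close>

lemma tilted_pair_form_ge:
  fixes u :: 'a
  defines "a \<equiv> (c + \<mu> *\<^sub>R v) /\<^sub>R norm (c + \<mu> *\<^sub>R v)" and "b \<equiv> (c - \<mu> *\<^sub>R v) /\<^sub>R norm (c - \<mu> *\<^sub>R v)"
  shows "2 * \<mu>\<^sup>2 * (u \<bullet> v)\<^sup>2 / (1 + \<mu>\<^sup>2) \<le> (a \<bullet> u)\<^sup>2 + (b \<bullet> u)\<^sup>2"
proof -
  define p where "p = (norm (c + \<mu> *\<^sub>R v))\<^sup>2"
  define q where "q = (norm (c - \<mu> *\<^sub>R v))\<^sup>2"
  have pos: "p > 0" "q > 0" using tilted_nonzero by (auto simp: p_def q_def)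
  have "p + q = 2 * (norm c)\<^sup>2 + 2 * \<mu>\<^sup>2 * (norm v)\<^sup>2"
    unfolding p_def q_def power2_norm_eq_inner
    by (simp add: inner_diff_left inner_diff_right inner_add_left inner_add_right inner_commute power2_eq_square)
  also have "\<dots> \<le> 2 * (1 + \<mu>\<^sup>2)" using v norm_normalized_cases by auto
  finally have pq: "p + q \<le> 2 * (1 + \<mu>\<^sup>2)" .
  have mpos: "1 + \<mu>\<^sup>2 > 0" by (simp add: add_pos_nonneg)
  let ?P = "(c + \<mu> *\<^sub>R v) \<bullet> u" and ?Q = "(c - \<mu> *\<^sub>R v) \<bullet> u"
  have PQ: "?P - ?Q = 2 * \<mu> * (u \<bullet> v)" by (simp add: inner_add_left inner_diff_left inner_commute[of u])
  have ab: "(a \<bullet> u)\<^sup>2 = ?P\<^sup>2 / p" "(b \<bullet> u)\<^sup>2 = ?Q\<^sup>2 / q"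
    unfolding a_def b_def p_def q_def by (simp_all add: power_mult_distrib power_divide divide_simps)
  have titu: "(?P - ?Q)\<^sup>2 / (p + q) \<le> ?P\<^sup>2 / p + ?Q\<^sup>2 / q"
  proof -
    have "?P\<^sup>2 / p + ?Q\<^sup>2 / q - (?P - ?Q)\<^sup>2 / (p + q) = (?P * q + ?Q * p)\<^sup>2 / (p * q * (p + q))"
      using pos by (simp add: divide_simps) (simp add: algebra_simps power2_eq_square)
    also have "\<dots> \<ge> 0" using pos by simp
    finally show ?thesis by simp
  qed
  have "2 * \<mu>\<^sup>2 * (u \<bullet> v)\<^sup>2 / (1 + \<mu>\<^sup>2) = (?P - ?Q)\<^sup>2 / (2 * (1 + \<mu>\<^sup>2))"
    using mpos unfolding PQ by (simp add: power_mult_distrib divide_simps)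
  also have "\<dots> \<le> (?P - ?Q)\<^sup>2 / (p + q)" using pos pq by (intro divide_left_mono) auto
  finally show ?thesis using titu ab by simp
qed

text \<open>\<open>sin_sq_le_dist_sq\<close> at a well chosen point of the line of each action. The
  cross term \<open>y\<close> enters with opposite signs, so it disappears from the sum over the
  pair.\<close>

lemma tilted_pair_sin_sq:
  fixes r y h :: real
  assumes t: "norm t = 1"
  defines "a \<equiv> (c + \<mu> *\<^sub>R v) /\<^sub>R norm (c + \<mu> *\<^sub>R v)" and "b \<equiv> (c - \<mu> *\<^sub>R v) /\<^sub>R norm (c - \<mu> *\<^sub>R v)"
  defines "r \<equiv> (norm (t - (c \<bullet> t) *\<^sub>R c))\<^sup>2 + (c \<bullet> t)\<^sup>2 * \<mu>\<^sup>2"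
    and "y \<equiv> 2 * (c \<bullet> t) * \<mu> * ((t - (c \<bullet> t) *\<^sub>R c) \<bullet> v)"
  shows "1 - (a \<bullet> t)\<^sup>2 \<le> r - y" and "1 - (b \<bullet> t)\<^sup>2 \<le> r + y"
proof -
  let ?h = "t - (c \<bullet> t) *\<^sub>R c"
  have n: "norm a = 1" "norm b = 1" 
    and s: "norm (c + \<mu> *\<^sub>R v) *\<^sub>R a = c + \<mu> *\<^sub>R v" "norm (c - \<mu> *\<^sub>R v) *\<^sub>R b = c - \<mu> *\<^sub>R v"
    using tilted_nonzero by (auto simp: a_def b_def)
  \<comment> \<open>The multiplier turns \<open>a\<close> into \<open>c \<bullet> t\<close> times
    the unnormalized action, whose \<open>c\<close> part is the projection of \<open>t\<close>; only
    the tilt and the residual remain.\<close>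
  have e1: "((c \<bullet> t) * norm (c + \<mu> *\<^sub>R v)) *\<^sub>R a - t = ((c \<bullet> t) * \<mu>) *\<^sub>R v - ?h"
    using s(1) by (metis (no_types, lifting) add_diff_eq diff_diff_eq2 add.commute scaleR_add_right scaleR_scaleR)
  have e2: "((c \<bullet> t) * norm (c - \<mu> *\<^sub>R v)) *\<^sub>R b - t = - (((c \<bullet> t) * \<mu>) *\<^sub>R v + ?h)"
    using s(2) by (simp flip: scaleR_scaleR add: scaleR_diff_right)
  have v1: "v \<bullet> v = 1" using v by (simp add: norm_eq_sqrt_inner)
  have "1 - (a \<bullet> t)\<^sup>2 \<le> (norm (((c \<bullet> t) * \<mu>) *\<^sub>R v - ?h))\<^sup>2"
    using sin_sq_le_dist_sq[OF n(1) t, of "(c \<bullet> t) * norm (c + \<mu> *\<^sub>R v)"] unfolding e1 .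
  also have "\<dots> = ((c \<bullet> t) * \<mu>)\<^sup>2 * (v \<bullet> v) - 2 * (((c \<bullet> t) * \<mu>) * (?h \<bullet> v)) + ?h \<bullet> ?h"
    unfolding power2_norm_eq_inner by (simp add: inner_diff_left inner_diff_right inner_commute power2_eq_square algebra_simps)
  also have "\<dots> = r - y" unfolding r_def y_def v1 by (simp add: power2_norm_eq_inner power_mult_distrib)
  finally show "1 - (a \<bullet> t)\<^sup>2 \<le> r - y" .
  have "1 - (b \<bullet> t)\<^sup>2 \<le> (norm (((c \<bullet> t) * \<mu>) *\<^sub>R v + ?h))\<^sup>2"
    using sin_sq_le_dist_sq[OF n(2) t, of "(c \<bullet> t) * norm (c - \<mu> *\<^sub>R v)"] unfolding e2 norm_minus_cancel .
  also have "\<dots> = ((c \<bullet> t) * \<mu>)\<^sup>2 * (v \<bullet> v) + 2 * (((c \<bullet> t) * \<mu>) * (?h \<bullet> v)) + ?h \<bullet> ?h"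
    unfolding power2_norm_eq_inner by (simp add: inner_diff_left inner_diff_right inner_add_left inner_add_right inner_commute power2_eq_square algebra_simps)
  also have "\<dots> = r + y" unfolding r_def y_def v1 by (simp add: power2_norm_eq_inner power_mult_distrib)
  finally show "1 - (b \<bullet> t)\<^sup>2 \<le> r + y" .
qed

end

section \<open>One batch of the algorithm\<close>

abbreviation st_V :: "'n alg_state \<Rightarrow> real^'n^'n" where "st_V st \<equiv> fst (snd st)"
abbreviation st_est :: "'n alg_state \<Rightarrow> real^'n" where "st_est st \<equiv> fst (snd (snd st))"
abbreviation st_sums :: "'n alg_state \<Rightarrow> nat \<Rightarrow> real^'n" where "st_sums st \<equiv> snd (snd (snd st))"

definition weight :: "3 alg_state \<Rightarrow> real" where
  "weight st = (if fst st = 0 then 1 else omega_w 3 2 (st_V st))"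

text \<open>The four directions of a batch count once each, not \<open>k\<close> times, as in the
  update of the design matrix. The target type is general because matrices, vectors and numbers are
  all summed this way.\<close>

definition actions_sum :: "(real^3^3 \<Rightarrow> nat \<Rightarrow> real^3) \<Rightarrow> 3 alg_state \<Rightarrow> (real^3 \<Rightarrow> 'b::comm_monoid_add) \<Rightarrow> 'b" where
  "actions_sum E st f = (\<Sum>i\<in>{1..2}. f (alg_actions E st i True) + f (alg_actions E st i False))"

definition next_V :: "(real^3^3 \<Rightarrow> nat \<Rightarrow> real^3) \<Rightarrow> 3 alg_state \<Rightarrow> real^3^3" where
  "next_V E st = st_V st + weight st *\<^sub>R actions_sum E st (\<lambda>a. outer a a)"

lemma actions_sum_two:
  "actions_sum E st f = (f (alg_actions E st 1 True) + f (alg_actions E st 1 False)) 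
    + (f (alg_actions E st 2 True) + f (alg_actions E st 2 False))"
  by (simp add: actions_sum_def numeral_2_eq_2)

lemma actions_sum_mono:
  fixes f g :: "real^3 \<Rightarrow> real"
  assumes "\<And>i b. i \<in> {1..2} \<Longrightarrow> f (alg_actions E st i b) \<le> g (alg_actions E st i b)"
  shows "actions_sum E st f \<le> actions_sum E st g"
  unfolding actions_sum_def by (intro sum_mono add_mono assms)

text \<open>The next design matrix does not involve the rewards \<open>X\<close>: it is known before
  the batch is played, which makes compensators and stopping levels predictable.\<close>

lemma alg_step_sel:
  fixes st :: "3 alg_state"
  shows "fst (alg_step 2 k E J st X) = Suc (fst st)"
    and "st_V (alg_step 2 k E J st X) = next_V E st"
    and "st_sums (alg_step 2 k E J st X) j = st_sums st j + weight st *\<^sub>R (\<Sum>i\<in>{1..2}.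
      (if X (i, True, j) then 1 else -1) *\<^sub>R alg_actions E st i True + (if X (i, False, j) then 1 else -1) *\<^sub>R alg_actions E st i False)"
    and "st_est (alg_step 2 k E J st X) = (let V = next_V E st; th = (\<lambda>j. matrix_inv V *v st_sums (alg_step 2 k E J st X) j) in th (J V th))"
  by (cases st; simp add: alg_step_def Let_def next_V_def weight_def actions_sum_def)+

lemma outer_apply: "outer a b *v x = (b \<bullet> x) *\<^sub>R a"
  by (vector outer_def matrix_vector_mult_def inner_vec_def)
     (simp add: sum_distrib_left sum_distrib_right mult.assoc mult.left_commute mult.commute)

lemma transpose_add: "transpose (A + B) = transpose A + transpose B"
  by (simp add: transpose_def vec_eq_iff)

lemma transpose_outer: "transpose (outer a a) = outer a a"
  by (simp add: transpose_def outer_def vec_eq_iff mult.commute)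

lemma trace_outer: "trace (outer a b) = a \<bullet> b"
  by (simp add: trace_def outer_def inner_vec_def)

lemma trace_scaleR: "trace (c *\<^sub>R A) = c * trace (A::real^'n^'n)"
  by (simp add: trace_def sum_distrib_left)

lemma next_V_apply:
  "next_V E st *v u = st_V st *v u + weight st *\<^sub>R actions_sum E st (\<lambda>a. (a \<bullet> u) *\<^sub>R a)"
  by (simp add: next_V_def actions_sum_two matrix_vector_mult_add_rdistrib scaleR_matrix_vector_assoc[symmetric] outer_apply)

lemma next_V_form:
  "u \<bullet> (next_V E st *v u) = u \<bullet> (st_V st *v u) + weight st * actions_sum E st (\<lambda>a. (a \<bullet> u)\<^sup>2)"
  unfolding next_V_apply by (simp add: actions_sum_two inner_add_right power2_eq_square inner_commute)

lemma next_V_sym: "transpose (st_V st) = st_V st \<Longrightarrow> transpose (next_V E st) = next_V E st"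
  by (simp add: next_V_def actions_sum_two transpose_add transpose_outer transpose_scalar)

text \<open>The bound 2 is the regularization parameter; it keeps the tilt
  \<open>1 / sqrt lam\<close> below 1.\<close>

locale eig_state =
  fixes E :: "real^3^3 \<Rightarrow> nat \<Rightarrow> real^3" and st :: "3 alg_state"
  assumes sel: "eig_selector E" and sym: "transpose (st_V st) = st_V st" and lam2: "2 \<le> lam_min (st_V st)"
begin

abbreviation "lam \<equiv> lam_min (st_V st)"
abbreviation "c \<equiv> st_est st /\<^sub>R norm (st_est st)"
abbreviation "\<mu> \<equiv> 1 / sqrt lam"

lemma mu: "0 < \<mu>" "\<mu> < 1" "\<mu>\<^sup>2 = 1 / lam"
  using lam2 by (auto simp: power_divide)

lemma alg_actions_tilted:
  "alg_actions E st i True = (c + \<mu> *\<^sub>R E (st_V st) i) /\<^sub>R norm (c + \<mu> *\<^sub>R E (st_V st) i)"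
  "alg_actions E st i False = (c - \<mu> *\<^sub>R E (st_V st) i) /\<^sub>R norm (c - \<mu> *\<^sub>R E (st_V st) i)"
  by (cases st; simp add: alg_actions_def Let_def)+

lemma norm_selected: "i \<in> {1..2} \<Longrightarrow> norm (E (st_V st) i) = 1"
  by (rule selector_norm[OF sel sym]) simp

lemma norm_action: "i \<in> {1..2} \<Longrightarrow> norm (alg_actions E st i b) = 1"
  using tilted_nonzero[OF refl norm_selected mu(1,2), of i "st_est st"] 
  by (cases b) (auto simp: alg_actions_tilted)

lemma lam_max_le_trace: "lam_max (st_V st) \<le> trace (st_V st)" 
  and trace_le_lam_max: "trace (st_V st) \<le> 3 * lam_max (st_V st)"
  and lam_le_lam_max: "lam \<le> lam_max (st_V st)"
proof -
  have t: "trace (st_V st) = eigv E (st_V st) 1 + eigv E (st_V st) 2 + eigv E (st_V st) 3"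
    by (simp add: trace_selector[OF sel sym] numeral_3_eq_3 numeral_2_eq_2)
  have "eigv E (st_V st) 1 \<le> eigv E (st_V st) 2" "eigv E (st_V st) 2 \<le> eigv E (st_V st) 3"
    by (auto intro!: eigv_mono[OF sel sym])
  moreover have "lam = eigv E (st_V st) 1" "lam_max (st_V st) = eigv E (st_V st) 3"
    by (simp_all add: lam_min_selector[OF sel sym] lam_max_selector[OF sel sym])
  ultimately show "lam_max (st_V st) \<le> trace (st_V st)" "trace (st_V st) \<le> 3 * lam_max (st_V st)" "lam \<le> lam_max (st_V st)"
    using t lam2 by auto
qed

lemma trace_next_V: "trace (next_V E st) = trace (st_V st) + 4 * weight st"
proof -
  have "a \<bullet> a = 1" if "norm a = 1" for a :: "real^3" using that by (simp add: norm_eq_sqrt_inner)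
  then show ?thesis
    by (simp add: next_V_def trace_add trace_scaleR actions_sum_two trace_outer norm_action)
qed

lemma actions_form_ge:
  "2 / (lam + 1) * ((E (st_V st) 1 \<bullet> u)\<^sup>2 + (E (st_V st) 2 \<bullet> u)\<^sup>2) \<le> actions_sum E st (\<lambda>a. (a \<bullet> u)\<^sup>2)"
proof -
  have l: "2 * \<mu>\<^sup>2 * (u \<bullet> E (st_V st) i)\<^sup>2 / (1 + \<mu>\<^sup>2) = 2 / (lam + 1) * (E (st_V st) i \<bullet> u)\<^sup>2" for i
    using lam2 by (simp add: mu(3) inner_commute divide_simps)
  have "2 / (lam + 1) * (E (st_V st) i \<bullet> u)\<^sup>2 \<le> (alg_actions E st i True \<bullet> u)\<^sup>2 + (alg_actions E st i False \<bullet> u)\<^sup>2"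
    if "i \<in> {1..2}" for i
    using tilted_pair_form_ge[OF refl norm_selected[OF that] mu(1,2), where x = "st_est st" and u = u]
    unfolding l by (simp only: alg_actions_tilted)
  from this[of 1] this[of 2] show ?thesis by (simp add: actions_sum_two ring_distribs)
qed

text \<open>Only the two lowest eigenvectors are used for tilting, and along them the form rises by
  \<open>2 * weight st / (lam + 1)\<close>. The third direction already has the eigenvalue
  \<open>lam_max\<close>, whence the minimum.\<close>

lemma lam_min_next_V:
  assumes w: "0 \<le> weight st"
  shows "min (lam + 2 * weight st / (lam + 1)) (lam_max (st_V st)) \<le> lam_min (next_V E st)"
proof (rule lam_min_greatest[OF sel next_V_sym[OF sym]])
  fix u :: "real^3"
  let ?e = "\<lambda>i. E (st_V st) i \<bullet> u" and ?l = "eigv E (st_V st)" and ?g = "2 * weight st / (lam + 1)"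
  let ?b = "min (lam + ?g) (lam_max (st_V st))"
  have I: "{1..CARD(3)} = {1, 2, 3::nat}" by auto
  have n: "(norm u)\<^sup>2 = (?e 1)\<^sup>2 + (?e 2)\<^sup>2 + (?e 3)\<^sup>2"
    unfolding selector_norm_sq[OF sel sym] I by simp
  have f: "u \<bullet> (st_V st *v u) = ?l 1 * (?e 1)\<^sup>2 + ?l 2 * (?e 2)\<^sup>2 + ?l 3 * (?e 3)\<^sup>2"
    unfolding selector_quadratic[OF sel sym] I by simp
  have l1: "lam = ?l 1" and l3: "lam_max (st_V st) = ?l 3"
    by (simp_all add: lam_min_selector[OF sel sym] lam_max_selector[OF sel sym])
  have l2: "?l 1 \<le> ?l 2" by (rule eigv_mono[OF sel sym]) auto
  have "?b * (?e 1)\<^sup>2 \<le> (?l 1 + ?g) * (?e 1)\<^sup>2" "?b * (?e 2)\<^sup>2 \<le> (?l 2 + ?g) * (?e 2)\<^sup>2" "?b * (?e 3)\<^sup>2 \<le> ?l 3 * (?e 3)\<^sup>2"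
    using l1 l2 l3 by (intro mult_right_mono; simp)+
  then have "?b * (norm u)\<^sup>2 \<le> u \<bullet> (st_V st *v u) + ?g * ((?e 1)\<^sup>2 + (?e 2)\<^sup>2)"
    unfolding n f by (simp add: ring_distribs)
  also have "\<dots> = u \<bullet> (st_V st *v u) + weight st * (2 / (lam + 1) * ((?e 1)\<^sup>2 + (?e 2)\<^sup>2))" by simp
  also have "\<dots> \<le> u \<bullet> (next_V E st *v u)"
    unfolding next_V_form by (intro add_left_mono mult_left_mono actions_form_ge w)
  finally show "?b * (norm u)\<^sup>2 \<le> u \<bullet> (next_V E st *v u)" .
qed

lemma lam_min_next_V_mono: "0 \<le> weight st \<Longrightarrow> lam \<le> lam_min (next_V E st)"
  using lam_min_next_V lam_le_lam_max lam2 by (smt (verit, best) divide_nonneg_nonneg)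

text \<open>Pairing the actions with opposite signs cancels the cross term, so that the squared
  errors of the estimator and of the exploration add up.\<close>
lemma actions_sin_sq:
  assumes t: "norm t = 1" and e: "(norm (st_est st - t))\<^sup>2 \<le> e2"
  shows "actions_sum E st (\<lambda>a. 1 - (a \<bullet> t)\<^sup>2) \<le> 4 * (e2 + 1 / lam)"
    and "actions_sum E st (\<lambda>a. (1 - (a \<bullet> t)\<^sup>2)\<^sup>2) \<le> 4 * (e2 + 1 / lam)\<^sup>2 + 8 * e2 / lam"
    and "i \<in> {1..2} \<Longrightarrow> 1 - (alg_actions E st i b \<bullet> t)\<^sup>2 \<le> 2 * (e2 + 1 / lam)"
proof -
  define h where "h = t - (c \<bullet> t) *\<^sub>R c"
  define r where "r = (norm h)\<^sup>2 + (c \<bullet> t)\<^sup>2 * \<mu>\<^sup>2"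
  define y where "y i = 2 * (c \<bullet> t) * \<mu> * (h \<bullet> E (st_V st) i)" for i
  have "norm c \<le> 1" by (cases "norm (st_est st) = 0") auto
  then have ct: "(c \<bullet> t)\<^sup>2 \<le> 1" using t by (rule inner_sq_le_1)
  have he: "(norm h)\<^sup>2 \<le> e2"
    using power_mono[OF projection_residual_le[of t "st_est st", folded h_def] norm_ge_zero, of 2] e by linarith
  have e0: "0 \<le> e2" using he by (meson order_trans zero_le_power2)
  have r0: "0 \<le> r" unfolding r_def by simp
  define q where "q = e2 + 1 / lam"
  have re: "r \<le> q"
    unfolding q_def r_def mu(3)[symmetric] using he ct by (intro add_mono mult_left_le_one_le) auto
  have p: "1 - (alg_actions E st i True \<bullet> t)\<^sup>2 \<le> r - y i" and m: "1 - (alg_actions E st i False \<bullet> t)\<^sup>2 \<le> r + y i"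
    if "i \<in> {1..2}" for i
    using tilted_pair_sin_sq[OF refl norm_selected[OF that] mu(1,2) t, where x = "st_est st"]
    unfolding alg_actions_tilted r_def y_def h_def by blast+
  have nonneg: "0 \<le> 1 - (alg_actions E st i b \<bullet> t)\<^sup>2" if "i \<in> {1..2}" for i b
    using inner_sq_le_1[of _ t] norm_action[OF that] t by force
  have "actions_sum E st (\<lambda>a. 1 - (a \<bullet> t)\<^sup>2) \<le> 4 * r"
    using p[of 1] m[of 1] p[of 2] m[of 2] by (simp add: actions_sum_two)
  then show "actions_sum E st (\<lambda>a. 1 - (a \<bullet> t)\<^sup>2) \<le> 4 * (e2 + 1 / lam)" using re unfolding q_def[symmetric] by linarith
  \<comment> \<open>The two nonnegative values of a pair add up to at most \<open>2 * r\<close>,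
    which bounds each of them.\<close>
  show "1 - (alg_actions E st i b \<bullet> t)\<^sup>2 \<le> 2 * (e2 + 1 / lam)" if "i \<in> {1..2}"
    using p[OF that] m[OF that] nonneg[OF that, of True] nonneg[OF that, of False] re 
    unfolding q_def[symmetric] by (cases b) auto
  have sq: "(1 - (alg_actions E st i True \<bullet> t)\<^sup>2)\<^sup>2 + (1 - (alg_actions E st i False \<bullet> t)\<^sup>2)\<^sup>2 \<le> 2 * r\<^sup>2 + 2 * (y i)\<^sup>2"
    if "i \<in> {1..2}" for i
  proof -
    have "(1 - (alg_actions E st i True \<bullet> t)\<^sup>2)\<^sup>2 \<le> (r - y i)\<^sup>2" "(1 - (alg_actions E st i False \<bullet> t)\<^sup>2)\<^sup>2 \<le> (r + y i)\<^sup>2"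
      using p[OF that] m[OF that] nonneg[OF that] by (auto intro!: power_mono)
    then show ?thesis by (simp add: power2_eq_square algebra_simps)
  qed
  \<comment> \<open>By Bessel's inequality both cross terms together cost only one copy of the
    squared norm of \<open>h\<close>.\<close>
  have "(y 1)\<^sup>2 + (y 2)\<^sup>2 = 4 * (c \<bullet> t)\<^sup>2 * \<mu>\<^sup>2 * ((E (st_V st) 1 \<bullet> h)\<^sup>2 + (E (st_V st) 2 \<bullet> h)\<^sup>2)"
    unfolding y_def by (simp add: power_mult_distrib power_divide inner_commute algebra_simps add_divide_distrib)
  also have "\<dots> \<le> 4 * 1 * \<mu>\<^sup>2 * (norm h)\<^sup>2"
  proof (intro mult_mono)
    have "{1..CARD(3)} = {1, 2, 3::nat}" by auto
    then show "(E (st_V st) 1 \<bullet> h)\<^sup>2 + (E (st_V st) 2 \<bullet> h)\<^sup>2 \<le> (norm h)\<^sup>2"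
      unfolding selector_norm_sq[OF sel sym, of h] by simp
  qed (use ct in auto)
  also have "\<dots> \<le> 4 * 1 * \<mu>\<^sup>2 * e2" using he by (intro mult_left_mono) auto
  finally have "(y 1)\<^sup>2 + (y 2)\<^sup>2 \<le> 4 * e2 / lam" by (simp add: mu(3))
  moreover have "r\<^sup>2 \<le> q\<^sup>2" using re r0 by (intro power_mono) auto
  ultimately show "actions_sum E st (\<lambda>a. (1 - (a \<bullet> t)\<^sup>2)\<^sup>2) \<le> 4 * (e2 + 1 / lam)\<^sup>2 + 8 * e2 / lam"
    using sq[of 1] sq[of 2] unfolding q_def[symmetric] by (simp add: actions_sum_two)
qed

end

section \<open>Growth of the design matrix\<close>

text \<open>The exact value is \<open>108 * sqrt 2 * (31 + 12 * sqrt 3)\<close>, about 7909.\<close>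

lemma omega_denominator: "7900 \<le> 12 * sqrt (real 3 - 1) * beta_w 3 2" "12 * sqrt (real 3 - 1) * beta_w 3 2 \<le> 8000"
proof -
  have s3: "1.732 \<le> sqrt 3" "sqrt 3 \<le> 1.7321" by (rule real_le_rsqrt real_le_lsqrt; simp add: power2_eq_square)+
  have s2: "1.414 \<le> sqrt 2" "sqrt 2 \<le> (1.4143::real)" by (rule real_le_rsqrt real_le_lsqrt; simp add: power2_eq_square)+
  have b: "beta_w 3 2 = 9 * (31 + 12 * sqrt 3)"
    by (simp add: beta_w_def power2_eq_square algebra_simps)
  have d: "12 * sqrt (real 3 - 1) * beta_w 3 2 = 108 * (sqrt 2 * (31 + 12 * sqrt 3))"
    unfolding b by simp
  have "1.414 * (31 + 12 * 1.732) \<le> sqrt 2 * (31 + 12 * sqrt 3)" using s2 s3 by (intro mult_mono) auto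
  then show "7900 \<le> 12 * sqrt (real 3 - 1) * beta_w 3 2" unfolding d by simp
  have "sqrt 2 * (31 + 12 * sqrt 3) \<le> 1.4143 * (31 + 12 * 1.7321)" using s2 s3 by (intro mult_mono) auto
  then show "12 * sqrt (real 3 - 1) * beta_w 3 2 \<le> 8000" unfolding d by simp
qed

lemma omega_bounds:
  assumes "0 \<le> lam_max X"
  shows "sqrt (lam_max X) / 8000 \<le> omega_w 3 2 X" "omega_w 3 2 X \<le> sqrt (lam_max X) / 7900"
  unfolding omega_w_def using omega_denominator assms by (intro divide_left_mono; simp)+

text \<open>The invariant of the design matrix. The initial trace is \<open>3 * 2 = 6\<close>, and
  the first batch adds four unit vectors with weight 1, giving 10. Further, \<open>lam_min\<close>
  is at least of order \<open>sqrt T\<close>, the trace orthogonal to \<open>t\<close> is at most of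
  this order, and \<open>sqrt T\<close> is comparable to the number of batches.\<close>

definition design_ok :: "real^3 \<Rightarrow> 3 alg_state \<Rightarrow> bool" where
  "design_ok t st \<longleftrightarrow> (let V = st_V st; T = trace V in
     transpose V = V \<and> 2 \<le> lam_min V \<and> (if fst st = 0 then T = 6 else 10 \<le> T) \<and> sqrt (T - 1) - 1 \<le> lam_min V
     \<and> T - t \<bullet> (V *v t) \<le> 24.86 * sqrt T \<and> real (fst st) / 8000 \<le> sqrt T \<and> sqrt T \<le> 4 + real (fst st))"

text \<open>Nothing is claimed for traces below 576, where trivial variance bounds suffice.\<close>

definition estimate_ok :: "real^3 \<Rightarrow> 3 alg_state \<Rightarrow> bool" where
  "estimate_ok t st \<longleftrightarrow> (576 \<le> trace (st_V st) \<longrightarrow> vnorm (st_V st) (st_est st - t) \<le> 3.3)"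

text \<open>Upper bounds, up to a constant, for the quadratic variations of the noise orthogonal to
  and along the Bloch vector, as functions of the trace of the design matrix. The first batch,
  played with weight 1, contributes the jump.\<close>
definition var_perp :: "real \<Rightarrow> real" where
  "var_perp T = (if T < 10 then 0 else 4) + 0.00304 * min T 577 + 0.0451 * sqrt T"

definition var_par :: "real \<Rightarrow> real" where
  "var_par T = (if T < 10 then 0 else 4) + 0.001573 * T + 0.001467 * min T 577"

lemma var_perp_diff: "10 \<le> S \<Longrightarrow> 10 \<le> T \<Longrightarrow> 
    var_perp T - var_perp S = 0.00304 * (min T 577 - min S 577) + 0.0451 * (sqrt T - sqrt S)"
  unfolding right_diff_distrib by (simp add: var_perp_def)

lemma var_perp_mono: "0 \<le> S \<Longrightarrow> S \<le> T \<Longrightarrow> var_perp S \<le> var_perp T"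
  unfolding var_perp_def by (intro add_mono) auto

lemma var_par_mono: "S \<le> T \<Longrightarrow> var_par S \<le> var_par T"
  unfolding var_par_def by (intro add_mono) auto

locale design_state =
  fixes E :: "real^3^3 \<Rightarrow> nat \<Rightarrow> real^3" and st :: "3 alg_state" and t :: "real^3"
  assumes sel: "eig_selector E" and t: "norm t = 1" and ok: "design_ok t st"
begin

abbreviation "T \<equiv> trace (st_V st)"
abbreviation "T' \<equiv> trace (next_V E st)"

sublocale eig_state E st
  using sel ok by unfold_locales (auto simp: design_ok_def Let_def)

lemma T_ge: "6 \<le> T" "0 < fst st \<Longrightarrow> 10 \<le> T"
  using ok by (auto simp: design_ok_def Let_def split: if_splits)

lemma weight_zero: "fst st = 0 \<Longrightarrow> weight st = 1" "fst st = 0 \<Longrightarrow> T = 6" "fst st = 0 \<Longrightarrow> T' = 10"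
  using ok trace_next_V by (auto simp: design_ok_def Let_def weight_def)

text \<open>The largest of three eigenvalues is between \<open>T / 3\<close> and \<open>T\<close>,
  and 0.577 is just below \<open>1 / sqrt 3\<close>.\<close>

lemma weight_bounds:
  assumes "0 < fst st"
  shows "0.577 * sqrt T / 8000 \<le> weight st" "weight st \<le> sqrt T / 7900"
proof -
  have w: "sqrt (lam_max (st_V st)) / 8000 \<le> weight st" "weight st \<le> sqrt (lam_max (st_V st)) / 7900"
    using omega_bounds[of "st_V st"] lam_le_lam_max lam2 assms by (auto simp: weight_def)
  have "0.577 * sqrt T = sqrt (0.577\<^sup>2 * T)" by (simp add: real_sqrt_mult)
  also have "\<dots> \<le> sqrt (lam_max (st_V st))"
    using trace_le_lam_max T_ge(1) by (intro real_sqrt_le_mono) (simp add: power2_eq_square)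
  finally show "0.577 * sqrt T / 8000 \<le> weight st" using w by simp
  have "sqrt (lam_max (st_V st)) \<le> sqrt T" using lam_max_le_trace by simp
  then show "weight st \<le> sqrt T / 7900" using w(2) by linarith
qed

lemma weight_pos: "0 < weight st"
proof (cases "fst st = 0")
  case False
  then have "0 < 0.577 * sqrt T / 8000" using T_ge(1) by simp
  then show ?thesis using weight_bounds(1) False by linarith
qed (simp add: weight_zero)

text \<open>The weight is of order \<open>sqrt T\<close>, so \<open>sqrt T\<close> grows by a
  bounded amount per batch, hence linearly.\<close>

lemma sqrt_T': 
  assumes "0 < fst st"
  shows "sqrt T' \<le> sqrt T + 2 / 7900" "sqrt T + 1 / 8000 \<le> sqrt T'"
proof -
  have T: "T = (sqrt T)\<^sup>2" "2 \<le> sqrt T" using T_ge(1) by (auto intro: real_le_rsqrt)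
  have "T' \<le> (sqrt T)\<^sup>2 + 4 * (sqrt T / 7900)" using trace_next_V weight_bounds(2)[OF assms] T by simp
  also have "\<dots> \<le> (sqrt T + 2 / 7900)\<^sup>2" by (simp add: power2_eq_square algebra_simps)
  finally show "sqrt T' \<le> sqrt T + 2 / 7900" using T by (intro real_le_lsqrt) auto
  have "(sqrt T + 1 / 8000)\<^sup>2 \<le> (sqrt T)\<^sup>2 + 4 * (0.577 * sqrt T / 8000)" 
    using T(2) by (simp add: power2_eq_square algebra_simps)
  also have "\<dots> \<le> T'" using trace_next_V weight_bounds(1)[OF assms] T by simp
  finally show "sqrt T + 1 / 8000 \<le> sqrt T'" by (rule real_le_rsqrt)
qed

lemma T_le_T': "T \<le> T'"
  using trace_next_V weight_pos by simp

text \<open>1.0445 bounds the ratio of \<open>sqrt T\<close> to \<open>sqrt T - 1.021\<close>, which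
  is largest at \<open>sqrt T = 24\<close>.\<close>

lemma sqrt_T_le_lam: "576 \<le> T \<Longrightarrow> sqrt T \<le> 1.0445 * lam"
proof -
  assume a: "576 \<le> T"
  have y: "24 \<le> sqrt T" "(sqrt T)\<^sup>2 = T" using a by (auto intro: real_le_rsqrt)
  have "(sqrt T - 0.021)\<^sup>2 = T - 0.042 * sqrt T + 0.000441" using y(2) by (simp add: power2_eq_square algebra_simps)
  also have "\<dots> \<le> T - 1" using y(1) by simp
  finally have "sqrt T - 0.021 \<le> sqrt (T - 1)" by (rule real_le_rsqrt)
  moreover have "sqrt (T - 1) - 1 \<le> lam" using ok by (auto simp: design_ok_def Let_def)
  ultimately show ?thesis using y(1) by simp
qed

lemma norm_sq_error:
  assumes "estimate_ok t st" "576 \<le> T"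
  shows "(norm (st_est st - t))\<^sup>2 \<le> 10.89 / lam"
proof -
  let ?z = "st_est st - t"
  have "0 \<le> lam * (norm ?z)\<^sup>2" using lam2 by simp
  also have "\<dots> \<le> ?z \<bullet> (st_V st *v ?z)" by (rule lam_min_quadratic[OF sel sym])
  finally have "?z \<bullet> (st_V st *v ?z) = (vnorm (st_V st) ?z)\<^sup>2" and "lam * (norm ?z)\<^sup>2 \<le> ?z \<bullet> (st_V st *v ?z)"
    using lam_min_quadratic[OF sel sym] by (auto simp: vnorm_def)
  moreover have "(vnorm (st_V st) ?z)\<^sup>2 \<le> 3.3\<^sup>2"
  proof (rule power_mono)
    show "vnorm (st_V st) ?z \<le> 3.3" using assms by (auto simp: estimate_ok_def)
    show "0 \<le> vnorm (st_V st) ?z" using \<open>0 \<le> lam * (norm ?z)\<^sup>2\<close> \<open>lam * (norm ?z)\<^sup>2 \<le> _\<close> by (simp add: vnorm_def)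
  qed
  ultimately have "lam * (norm ?z)\<^sup>2 \<le> 10.89" by (simp add: power2_eq_square)
  then show ?thesis using lam2 by (simp add: field_simps)
qed

lemma actions_sin_sq_trivial:
  "actions_sum E st (\<lambda>a. 1 - (a \<bullet> t)\<^sup>2) \<le> 4" "actions_sum E st (\<lambda>a. (1 - (a \<bullet> t)\<^sup>2)\<^sup>2) \<le> 4"
  "0 \<le> actions_sum E st (\<lambda>a. 1 - (a \<bullet> t)\<^sup>2)" "0 \<le> actions_sum E st (\<lambda>a. (1 - (a \<bullet> t)\<^sup>2)\<^sup>2)"
proof -
  have u: "0 \<le> 1 - (alg_actions E st i b \<bullet> t)\<^sup>2" "1 - (alg_actions E st i b \<bullet> t)\<^sup>2 \<le> 1" if "i \<in> {1..2}" for i b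
    using inner_sq_le_1[of _ t] norm_action[OF that] t by force+
  have v: "(1 - (alg_actions E st i b \<bullet> t)\<^sup>2)\<^sup>2 \<le> 1" if "i \<in> {1..2}" for i b
    using u[OF that] by (simp add: power_le_one)
  have "actions_sum E st (\<lambda>a. 1 - (a \<bullet> t)\<^sup>2) \<le> actions_sum E st (\<lambda>_. 1)" 
    by (rule actions_sum_mono) (rule u)
  then show "actions_sum E st (\<lambda>a. 1 - (a \<bullet> t)\<^sup>2) \<le> 4" by (simp add: actions_sum_two)
  have "actions_sum E st (\<lambda>a. (1 - (a \<bullet> t)\<^sup>2)\<^sup>2) \<le> actions_sum E st (\<lambda>_. 1)" 
    by (rule actions_sum_mono) (rule v)
  then show "actions_sum E st (\<lambda>a. (1 - (a \<bullet> t)\<^sup>2)\<^sup>2) \<le> 4" by (simp add: actions_sum_two)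
  show "0 \<le> actions_sum E st (\<lambda>a. 1 - (a \<bullet> t)\<^sup>2)"
    unfolding actions_sum_def by (intro sum_nonneg add_nonneg_nonneg u)
  show "0 \<le> actions_sum E st (\<lambda>a. (1 - (a \<bullet> t)\<^sup>2)\<^sup>2)"
    by (simp add: actions_sum_two)
qed

section \<open>Preservation of the invariant by one batch when the current estimate is
  accurate\<close>

context
  assumes est: "estimate_ok t st"
begin

text \<open>\<open>actions_sin_sq\<close> with the squared error \<open>10.89 / lam\<close>, where
  \<open>10.89 = 3.3\<^sup>2\<close>. The constants are \<open>4 * 11.89 * 1.0445\<close> and
  \<open>(4 * 11.89\<^sup>2 + 8 * 10.89) * 1.0445\<^sup>2\<close>, rounded up.\<close>

lemma actions_sin_sq_late:
  assumes "576 \<le> T"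
  shows "actions_sum E st (\<lambda>a. 1 - (a \<bullet> t)\<^sup>2) \<le> 49.6768 / sqrt T"
    and "actions_sum E st (\<lambda>a. (1 - (a \<bullet> t)\<^sup>2)\<^sup>2) \<le> 711.99 / (sqrt T)\<^sup>2"
proof -
  note s = actions_sin_sq(1,2)[OF t norm_sq_error[OF est assms]]
  have y: "24 \<le> sqrt T" using assms by (auto intro: real_le_rsqrt)
  have "0 < sqrt T" using y by linarith
  define p q where "p = 1 / sqrt T" and "q = 1 / lam"
  have l: "q \<le> 1.0445 * p"
    using frac_le[OF _ sqrt_T_le_lam[OF assms], of "1.0445" "1.0445"] lam2 \<open>0 < sqrt T\<close> 
    by (simp add: field_simps p_def q_def)
  have l2: "q\<^sup>2 \<le> (1.0445 * p)\<^sup>2" by (rule power_mono[OF l]) (use lam2 in \<open>simp add: q_def\<close>)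
  have p: "0 \<le> p" "0 \<le> p\<^sup>2" using \<open>0 < sqrt T\<close> by (simp_all add: p_def)
  have "4 * (10.89 / lam + 1 / lam) = 47.56 * q" by (simp add: q_def)
  also have "\<dots> \<le> 49.6768 * p" using l p(1) by simp
  finally show "actions_sum E st (\<lambda>a. 1 - (a \<bullet> t)\<^sup>2) \<le> 49.6768 / sqrt T" using s(1) by (simp add: p_def)
  have "4 * (10.89 / lam + 1 / lam)\<^sup>2 + 8 * (10.89 / lam) / lam = 652.6084 * q\<^sup>2" 
    by (simp add: power2_eq_square field_simps q_def)
  also have "\<dots> \<le> 711.99 * p\<^sup>2" 
  proof -
    have "q\<^sup>2 \<le> 1.09098025 * p\<^sup>2" using l2 by (simp add: power_mult_distrib power_divide)
    moreover have "652.6084 * a \<le> 711.99 * b" if "a \<le> 1.09098025 * b" "0 \<le> b" for a b :: real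
      using that by simp
    ultimately show ?thesis using p(2) by blast
  qed
  finally show "actions_sum E st (\<lambda>a. (1 - (a \<bullet> t)\<^sup>2)\<^sup>2) \<le> 711.99 / (sqrt T)\<^sup>2" 
    using s(2) by (simp add: power_divide p_def)
qed

text \<open>Turns terms of order \<open>weight st / sqrt T\<close> into increments of
  \<open>sqrt T\<close>, which telescope over the batches. The excess over 2 in the constant absorbs
  \<open>2 / 7900\<close> for \<open>sqrt T\<close> at least 24.\<close>

lemma sqrt_increment_ge:
  assumes "576 \<le> T" "0 < fst st"
  shows "4 * weight st / (2.0000126 * sqrt T) \<le> sqrt T' - sqrt T"
proof -
  have y: "24 \<le> sqrt T" using assms by (auto intro: real_le_rsqrt)
  have pos: "0 < sqrt T' + sqrt T" using y T_le_T' by (smt (verit) real_sqrt_ge_zero real_sqrt_le_iff T_ge)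
  have "(sqrt T' - sqrt T) * (sqrt T' + sqrt T) = 4 * weight st"
    using trace_next_V T_le_T' T_ge(1) by (simp add: algebra_simps flip: power2_eq_square)
  then have "sqrt T' - sqrt T = 4 * weight st / (sqrt T' + sqrt T)" using pos by (simp add: field_simps)
  moreover have "sqrt T' + sqrt T \<le> 2.0000126 * sqrt T" using sqrt_T'(1)[OF assms(2)] y by simp
  then have "4 * weight st / (2.0000126 * sqrt T) \<le> 4 * weight st / (sqrt T' + sqrt T)"
    by (rule divide_left_mono) (use pos weight_pos T_ge(1) in \<open>auto intro!: mult_pos_pos\<close>)
  ultimately show ?thesis by simp
qed

text \<open>One factor of the square is the variance of the reward, the other the squared component
  of the action orthogonal to \<open>t\<close>. In the late phase the sum is of order
  \<open>1 / T\<close>, so the total grows only like \<open>sqrt T\<close>.\<close>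

lemma variance_perp_step:
  "(weight st)\<^sup>2 * actions_sum E st (\<lambda>a. (1 - (a \<bullet> t)\<^sup>2)\<^sup>2) \<le> var_perp T' - var_perp T"
proof (cases "fst st = 0")
  case True
  define a b :: real where "a = sqrt 6" and "b = sqrt 10"
  have "a \<le> b" by (simp add: a_def b_def)
  then have "4 \<le> var_perp 10 - var_perp 6" 
    unfolding var_perp_def a_def[symmetric] b_def[symmetric] by simp
  then show ?thesis using weight_zero[OF True] actions_sin_sq_trivial(2) by simp
next
  case s: False
  then have s: "0 < fst st" by simp
  have w: "0 < weight st" "weight st \<le> sqrt T / 7900" using weight_pos weight_bounds(2)[OF s] by auto
  have dT: "T' - T = 4 * weight st" using trace_next_V by simp
  have sq: "sqrt T \<le> sqrt T'" using T_le_T' by simp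
  show ?thesis
  proof (cases "T < 576")
    case True
    have y: "sqrt T \<le> 24" using True by (intro real_le_lsqrt) auto
    have "(weight st)\<^sup>2 * actions_sum E st (\<lambda>a. (1 - (a \<bullet> t)\<^sup>2)\<^sup>2) \<le> (weight st)\<^sup>2 * 4"
      by (intro mult_left_mono actions_sin_sq_trivial) auto
    also have "\<dots> = weight st * (T' - T)" by (simp add: dT power2_eq_square)
    also have "\<dots> \<le> 0.00304 * (T' - T)" using y w T_le_T' by (intro mult_right_mono) auto
    also have "\<dots> \<le> var_perp T' - var_perp T"
    proof -
      \<comment> \<open>The trace grows by at most \<open>4 * 24 / 7900 < 1\<close>, so the
        truncation at 577 is not yet reached.\<close>
      have "min T' 577 - min T 577 = T' - T" using True w(2) y dT by simp
      then show ?thesis using var_perp_diff[of T T'] sq T_ge(2)[OF s] T_le_T' by simp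
    qed
    finally show ?thesis .
  next
    case False
    then have T: "576 \<le> T" by simp
    have y: "24 \<le> sqrt T" using T by (auto intro: real_le_rsqrt)
    have "(weight st)\<^sup>2 * actions_sum E st (\<lambda>a. (1 - (a \<bullet> t)\<^sup>2)\<^sup>2) \<le> (weight st * (sqrt T / 7900)) * (711.99 / (sqrt T)\<^sup>2)"
      unfolding power2_eq_square[of "weight st"]
      using w y T_ge(1) by (intro mult_mono actions_sin_sq_late(2)[OF T] mult_left_mono) (auto simp: actions_sin_sq_trivial)
    \<comment> \<open>0.0451 exceeds \<open>711.99 * 2.0000126 / (4 * 7900)\<close>.\<close>
    also have "\<dots> \<le> 0.0451 * (4 * weight st / (2.0000126 * sqrt T))"
      using w y T_ge(1) by (simp add: power2_eq_square divide_simps)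
    also have "\<dots> \<le> 0.0451 * (sqrt T' - sqrt T)"
      by (rule mult_left_mono[OF sqrt_increment_ge[OF T s]]) simp
    also have "\<dots> \<le> var_perp T' - var_perp T"
      using T_ge(2)[OF s] T_le_T' var_perp_diff[of T T'] by (auto simp: min_def)
    finally show ?thesis .
  qed
qed

lemma variance_par_step:
  "(weight st)\<^sup>2 * actions_sum E st (\<lambda>a. 1 - (a \<bullet> t)\<^sup>2) \<le> var_par T' - var_par T"
proof (cases "fst st = 0")
  case True
  then show ?thesis using weight_zero[OF True] actions_sin_sq_trivial(1) by (simp add: var_par_def)
next
  case s: False
  then have s: "0 < fst st" by simp
  have w: "0 < weight st" "weight st \<le> sqrt T / 7900" using weight_pos weight_bounds(2)[OF s] by auto
  have dT: "T' - T = 4 * weight st" using trace_next_V by simp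
  show ?thesis
  proof (cases "T < 576")
    case True
    have y: "sqrt T \<le> 24" using True by (intro real_le_lsqrt) auto
    have "(weight st)\<^sup>2 * actions_sum E st (\<lambda>a. 1 - (a \<bullet> t)\<^sup>2) \<le> (weight st)\<^sup>2 * 4"
      by (intro mult_left_mono actions_sin_sq_trivial) auto
    also have "\<dots> = weight st * (T' - T)" by (simp add: dT power2_eq_square)
    also have "\<dots> \<le> 0.00304 * (T' - T)" using y w T_le_T' by (intro mult_right_mono) auto
    \<comment> \<open>Below 577 the slopes 0.001573 and 0.001467 add up to 0.00304, which exceeds
      \<open>24 / 7900\<close>.\<close>
    also have "\<dots> \<le> var_par T' - var_par T"
      using T_ge(2)[OF s] T_le_T' True w y dT unfolding var_par_def by (auto simp: min_def)
    finally show ?thesis .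
  next
    case False
    then have T: "576 \<le> T" by simp
    have y: "24 \<le> sqrt T" using T by (auto intro: real_le_rsqrt)
    have "(weight st)\<^sup>2 * actions_sum E st (\<lambda>a. 1 - (a \<bullet> t)\<^sup>2) \<le> (weight st * (sqrt T / 7900)) * (49.6768 / sqrt T)"
      unfolding power2_eq_square[of "weight st"]
      using w y T_ge(1) by (intro mult_mono actions_sin_sq_late(1)[OF T] mult_left_mono) (auto simp: actions_sin_sq_trivial)
    \<comment> \<open>0.001573 exceeds \<open>49.6768 / (4 * 7900)\<close>.\<close>
    also have "\<dots> \<le> 0.001573 * (T' - T)"
      using w y T_ge(1) unfolding dT by (simp add: divide_simps)
    also have "\<dots> \<le> var_par T' - var_par T"
      using T_ge(2)[OF s] T_le_T' unfolding var_par_def by (auto simp: min_def)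
    finally show ?thesis .
  qed
qed

text \<open>For small traces \<open>T'\<close> itself is below the bound, because
  \<open>sqrt T'\<close> is at most 24.86. Later the increment is compared with that of
  \<open>sqrt T\<close>; 24.86 is slightly above half of 49.6768.\<close>

lemma trace_perp_step: "T' - t \<bullet> (next_V E st *v t) \<le> 24.86 * sqrt T'"
proof (cases "T < 576")
  case True
  have le: "T' \<le> 577"
  proof (cases "fst st = 0")
    case False
    have "sqrt T \<le> 24" using True by (intro real_le_lsqrt) auto
    then show ?thesis using weight_bounds(2) False trace_next_V True by simp
  qed (simp add: weight_zero)
  then have "sqrt T' \<le> 24.86" by (intro real_le_lsqrt) (auto simp: power2_eq_square)
  moreover have "0 \<le> sqrt T'" using T_ge T_le_T' by simp
  ultimately have "sqrt T' * sqrt T' \<le> 24.86 * sqrt T'" by (intro mult_right_mono) auto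
  then have "T' \<le> 24.86 * sqrt T'" using T_ge T_le_T' by simp
  moreover have "0 \<le> t \<bullet> (next_V E st *v t)"
    using lam_min_quadratic[OF sel next_V_sym[OF sym, where E = E], where x = t] 
      lam_min_next_V_mono[OF less_imp_le[OF weight_pos]] lam2 t by simp
  ultimately show ?thesis by simp
next
  case False
  then have T: "576 \<le> T" by simp
  then have s: "0 < fst st" using weight_zero by (cases "fst st = 0") auto
  have y: "24 \<le> sqrt T" using T by (auto intro: real_le_rsqrt)
  have "T' - t \<bullet> (next_V E st *v t) = (T - t \<bullet> (st_V st *v t)) + weight st * actions_sum E st (\<lambda>a. 1 - (a \<bullet> t)\<^sup>2)"
    unfolding next_V_form trace_next_V by (simp add: actions_sum_two algebra_simps)
  also have "\<dots> \<le> 24.86 * sqrt T + weight st * (49.6768 / sqrt T)"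
    using ok weight_pos by (intro add_mono mult_left_mono actions_sin_sq_late(1)[OF T]) (auto simp: design_ok_def Let_def)
  also have "weight st * (49.6768 / sqrt T) \<le> 24.86 * (4 * weight st / (2.0000126 * sqrt T))"
    using weight_pos y T_ge(1) by (simp add: divide_simps)
  also have "\<dots> \<le> 24.86 * (sqrt T' - sqrt T)"
    by (rule mult_left_mono[OF sqrt_increment_ge[OF T s]]) simp
  finally show ?thesis by (simp add: diff_divide_distrib right_diff_distrib)
qed

text \<open>The square of \<open>lam + 1 + 2 * w / (lam + 1)\<close> exceeds that of
  \<open>lam + 1\<close> by at least \<open>4 * w\<close>, the growth of the trace. This is why the
  bound has the form \<open>sqrt (T - 1) - 1\<close>; it holds after the first batch because
  \<open>sqrt 9 - 1 = 2\<close>.\<close>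

lemma lam_min_step: "sqrt (T' - 1) - 1 \<le> lam_min (next_V E st)"
proof (cases "fst st = 0")
  case True
  have "sqrt 9 = (3::real)" by simp
  then show ?thesis using weight_zero[OF True] lam_min_next_V_mono weight_pos lam2 by simp
next
  case False
  then have s: "0 < fst st" by simp
  have w: "0 < weight st" "weight st \<le> sqrt T / 7900" using weight_pos weight_bounds(2)[OF s] by auto
  have T10: "10 \<le> T" using T_ge(2)[OF s] .
  have "sqrt (T' - 1) \<le> lam + 2 * weight st / (lam + 1) + 1"
  proof (rule real_le_lsqrt)
    have "sqrt (T - 1) \<le> lam + 1" using ok by (simp add: design_ok_def Let_def)
    then have "T - 1 \<le> (lam + 1)\<^sup>2" using real_sqrt_le_iff sqrt_le_D by blast
    moreover have "(lam + 2 * weight st / (lam + 1) + 1)\<^sup>2 = (lam + 1)\<^sup>2 + 4 * weight st + (2 * weight st / (lam + 1))\<^sup>2"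
      using lam2 by (simp add: power2_eq_square divide_simps) (simp add: algebra_simps)
    ultimately show "T' - 1 \<le> (lam + 2 * weight st / (lam + 1) + 1)\<^sup>2" 
      using trace_next_V zero_le_power2[of "2 * weight st / (lam + 1)"] by linarith
  qed (use w lam2 in auto)
  \<comment> \<open>The other term of the minimum in \<open>lam_min_next_V\<close>:
    \<open>lam_max\<close> is at least \<open>T / 3\<close>, which is large enough once
    \<open>T\<close> is at least 10.\<close>
  moreover have "sqrt (T' - 1) \<le> lam_max (st_V st) + 1"
  proof (rule real_le_lsqrt)
    have "sqrt T \<le> T" using T10 by (intro real_le_lsqrt) (auto simp: power2_eq_square)
    then have "T' \<le> T + 4 * (T / 7900)" using trace_next_V w by simp
    also have "\<dots> - 1 \<le> (T / 3 + 1)\<^sup>2"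
    proof -
      have "10 * T \<le> T\<^sup>2" using mult_right_mono[OF T10, of T] T10 unfolding power2_eq_square by linarith
      moreover have "(T / 3 + 1)\<^sup>2 = T\<^sup>2 / 9 + 2 * T / 3 + 1" by (simp add: power2_eq_square algebra_simps)
      ultimately show ?thesis using T10 by linarith
    qed
    also have "\<dots> \<le> (lam_max (st_V st) + 1)\<^sup>2" using trace_le_lam_max T10 by (intro power_mono) auto
    finally show "T' - 1 \<le> (lam_max (st_V st) + 1)\<^sup>2" by simp
  qed (use lam_le_lam_max lam2 in auto)
  ultimately show ?thesis using lam_min_next_V w by simp
qed

lemma design_ok_step: "design_ok t (alg_step 2 k E J st X)"
proof -
  have "sqrt T \<le> 4 + real (fst st)" "real (fst st) / 8000 \<le> sqrt T" using ok by (auto simp: design_ok_def Let_def)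
  then have "sqrt T' \<le> 4 + real (Suc (fst st)) \<and> real (Suc (fst st)) / 8000 \<le> sqrt T'"
  proof (cases "fst st = 0")
    case True
    have a: "sqrt 10 \<le> (5::real)" "1 \<le> sqrt (10::real)" by (auto intro: real_le_lsqrt)
    then have "1 \<le> sqrt 10 * (8000::real)" by linarith
    with a(1) show ?thesis unfolding weight_zero(3)[OF True] True by simp
  next
    case False
    then show ?thesis using sqrt_T' \<open>sqrt T \<le> 4 + real (fst st)\<close> \<open>real (fst st) / 8000 \<le> sqrt T\<close> by (simp add: add_divide_distrib)
  qed
  moreover have "10 \<le> T'" using T_ge(2) T_le_T' weight_zero(3) by (cases "fst st = 0") force+
  ultimately show ?thesis
    using next_V_sym[OF sym] lam_min_next_V_mono weight_pos lam2 lam_min_step trace_perp_step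
    unfolding design_ok_def Let_def alg_step_sel by simp
qed

end

end

section \<open>Error of a weighted least squares estimator\<close>

text \<open>Since the design matrix starts at twice the identity,
  \<open>V *v t - 2 *\<^sub>R t\<close> is the weighted sum of
  \<open>(a \<bullet> t) *\<^sub>R a\<close> over all actions, the predictable part of the
  sums.\<close>

definition noise :: "real^3 \<Rightarrow> 3 alg_state \<Rightarrow> nat \<Rightarrow> real^3" where
  "noise t st j = st_sums st j - (st_V st *v t - 2 *\<^sub>R t)"

definition energy :: "real \<Rightarrow> real \<Rightarrow> real^3 \<Rightarrow> real^3 \<Rightarrow> real" where
  "energy \<alpha> \<beta> t x = \<alpha> * ((norm x)\<^sup>2 - (x \<bullet> t)\<^sup>2) + \<beta> * (x \<bullet> t)\<^sup>2"

context design_state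
begin

lemma form_nonneg: "0 \<le> x \<bullet> (st_V st *v x)"
  using lam_min_quadratic[OF sel sym, of x] lam2 by (meson mult_nonneg_nonneg order_trans zero_le_numeral zero_le_power2)

lemma form_le_trace: "t \<bullet> (st_V st *v t) \<le> T"
proof -
  have "(\<Sum>i=1..CARD(3). eigv E (st_V st) i * (E (st_V st) i \<bullet> t)\<^sup>2) \<le> (\<Sum>i=1..CARD(3). eigv E (st_V st) i)"
    using form_nonneg t selector_norm[OF sel sym] inner_sq_le_1[of _ t]
    by (intro sum_mono mult_left_le) (auto simp: eigv_def)
  then show ?thesis by (simp only: selector_quadratic[OF sel sym] trace_selector[OF sel sym])
qed

lemma vnorm_triangle: "vnorm (st_V st) (x + y) \<le> vnorm (st_V st) x + vnorm (st_V st) y"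
  and vnorm_scaleR: "vnorm (st_V st) (r *\<^sub>R x) = \<bar>r\<bar> * vnorm (st_V st) x"
  and vnorm_minus: "vnorm (st_V st) (- x) = vnorm (st_V st) x"
  and vnorm_nonneg: "0 \<le> vnorm (st_V st) x"
  and vnorm_sq: "(vnorm (st_V st) x)\<^sup>2 = x \<bullet> (st_V st *v x)"
proof -
  obtain f :: "real^3 \<Rightarrow> real^3" where f: "linear f" "\<And>x. vnorm (st_V st) x = norm (f x)"
    using vnorm_linear_image[OF sel sym form_nonneg] by blast
  show "vnorm (st_V st) (x + y) \<le> vnorm (st_V st) x + vnorm (st_V st) y"
    unfolding f(2) linear_add[OF f(1)] by (rule norm_triangle_ineq)
  show "vnorm (st_V st) (r *\<^sub>R x) = \<bar>r\<bar> * vnorm (st_V st) x"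
    unfolding f(2) linear_scale[OF f(1)] by simp
  show "vnorm (st_V st) (- x) = vnorm (st_V st) x"
    unfolding f(2) linear_neg[OF f(1)] by simp
  show "0 \<le> vnorm (st_V st) x" unfolding f(2) by simp
  show "(vnorm (st_V st) x)\<^sup>2 = x \<bullet> (st_V st *v x)"
    using form_nonneg by (simp add: vnorm_def)
qed

lemma norm_le_vnorm: "sqrt lam * norm x \<le> vnorm (st_V st) x"
  unfolding vnorm_def using lam_min_quadratic[OF sel sym, of x] 
  by (intro real_le_rsqrt) (use lam2 in \<open>simp add: power_mult_distrib\<close>)

lemma solve_design: "st_V st *v (matrix_inv (st_V st) *v x) = x"
proof -
  have "y = 0" if "st_V st *v y = 0" for y
    using lam_min_quadratic[OF sel sym, of y] lam2 that by (auto simp: mult_le_0_iff)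
  then have "invertible (st_V st)"
    using invertible_left_inverse matrix_left_invertible_ker by blast
  then have "st_V st ** matrix_inv (st_V st) = mat 1"
    unfolding invertible_def matrix_inv_def by (metis (mono_tags, lifting) someI_ex)
  then show ?thesis by (simp add: matrix_vector_mul_assoc)
qed

text \<open>The squared \<open>V\<close>-norm of \<open>z\<close> is \<open>z \<bullet> x\<close>;
  after Cauchy-Schwarz one factor \<open>vnorm\<close> cancels.\<close>

lemma vnorm_solution:
  assumes "st_V st *v z = x"
  shows "vnorm (st_V st) z \<le> norm x / sqrt lam"
proof (cases "vnorm (st_V st) z = 0")
  case False
  then have pos: "0 < vnorm (st_V st) z" using vnorm_nonneg[of z] by simp
  have "(vnorm (st_V st) z)\<^sup>2 \<le> norm z * norm x"
    unfolding vnorm_sq assms by (rule norm_cauchy_schwarz)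
  also have "\<dots> \<le> (vnorm (st_V st) z / sqrt lam) * norm x"
    using norm_le_vnorm[of z] lam2 by (intro mult_right_mono) (auto simp: field_simps)
  finally have "vnorm (st_V st) z * vnorm (st_V st) z \<le> vnorm (st_V st) z * (norm x / sqrt lam)"
    by (simp add: power2_eq_square)
  then show ?thesis using pos by (simp only: mult_le_cancel_left_pos)
qed (use lam2 in simp)

lemma vnorm_perp: 
  assumes "p \<bullet> t = 0" shows "vnorm (st_V st) p \<le> norm p * sqrt (T - t \<bullet> (st_V st *v t))"
proof (cases "p = 0")
  case False
  define q where "q = p /\<^sub>R norm p"
  have q: "norm q = 1" "p = norm p *\<^sub>R q" "q \<bullet> t = 0" using False assms by (auto simp: q_def)
  have "vnorm (st_V st) p = norm p * vnorm (st_V st) q"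
    by (subst q(2)) (simp add: vnorm_scaleR)
  also have "vnorm (st_V st) q \<le> sqrt (T - t \<bullet> (st_V st *v t))"
    unfolding vnorm_def
    using orthonormal_pair_trace[OF sel sym form_nonneg q(1) t q(3)] by (intro real_sqrt_le_mono) simp
  finally show ?thesis by (simp add: mult_left_mono)
qed (simp add: vnorm_def)

text \<open>An anisotropic form of \<open>vnorm_solution\<close>. Write
  \<open>z = q *\<^sub>R t + p\<close>. The orthogonal part is bounded through \<open>lam\<close>,
  and its \<open>V\<close>-norm through the trace orthogonal to \<open>t\<close>; the triangle
  inequality then bounds \<open>q\<close> in terms of the form along \<open>t\<close>. Inserting
  both into \<open>z \<bullet> x\<close> lets one factor \<open>vnorm\<close> cancel.\<close>

lemma vnorm_solution_split:
  assumes z: "st_V st *v z = x" and \<tau>: "0 < t \<bullet> (st_V st *v t)"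
  defines "h \<equiv> (1 + sqrt ((T - t \<bullet> (st_V st *v t)) / lam))\<^sup>2 / (t \<bullet> (st_V st *v t))"
  shows "(vnorm (st_V st) z)\<^sup>2 \<le> energy (2 / lam) (2 * h) t x"
proof -
  let ?\<tau> = "t \<bullet> (st_V st *v t)" and ?N = "vnorm (st_V st) z"
  define q p y S where "q = z \<bullet> t" and "p = z - q *\<^sub>R t" and "y = x - (x \<bullet> t) *\<^sub>R t" and "S = T - ?\<tau>"
  have tt: "t \<bullet> t = 1" using t by (simp add: norm_eq_sqrt_inner)
  have pt: "p \<bullet> t = 0" by (simp add: p_def q_def inner_diff_left tt)
  have zp: "(norm z)\<^sup>2 = q\<^sup>2 + (norm p)\<^sup>2" 
  proof -
    have "z = q *\<^sub>R t + p" by (simp add: p_def)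
    then have "(norm z)\<^sup>2 = (q *\<^sub>R t + p) \<bullet> (q *\<^sub>R t + p)" by (simp add: power2_norm_eq_inner)
    also have "\<dots> = q\<^sup>2 * (t \<bullet> t) + 2 * q * (p \<bullet> t) + p \<bullet> p"
      by (simp add: inner_add_left inner_add_right inner_commute power2_eq_square)
    finally show ?thesis by (simp add: tt pt power2_norm_eq_inner)
  qed
  have ny: "(norm y)\<^sup>2 = (norm x)\<^sup>2 - (x \<bullet> t)\<^sup>2"
    unfolding y_def power2_norm_eq_inner
    by (simp add: inner_diff_left inner_diff_right tt inner_commute power2_eq_square)
  have l: "0 < sqrt lam" using lam2 by simp
  have "norm p \<le> norm z" by (rule power2_le_imp_le) (simp_all add: zp)
  also have "norm z \<le> ?N / sqrt lam" using norm_le_vnorm[of z] l by (simp add: pos_le_divide_eq mult.commute)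
  finally have np: "norm p \<le> ?N / sqrt lam" .
  have "\<bar>q\<bar> * sqrt ?\<tau> = vnorm (st_V st) (q *\<^sub>R t)" by (simp add: vnorm_scaleR) (simp add: vnorm_def)
  also have "q *\<^sub>R t = z + - p" by (simp add: p_def)
  also have "vnorm (st_V st) \<dots> \<le> ?N + vnorm (st_V st) p" using vnorm_triangle[of z "- p"] vnorm_minus by simp
  also have "vnorm (st_V st) p \<le> ?N / sqrt lam * sqrt S"
    using order_trans[OF vnorm_perp[OF pt, folded S_def] mult_right_mono[OF np]] form_le_trace by (simp add: S_def)
  also have "?N + ?N / sqrt lam * sqrt S = ?N * (1 + sqrt (S / lam))" by (simp add: real_sqrt_divide algebra_simps)
  finally have q: "\<bar>q\<bar> \<le> ?N * ((1 + sqrt (S / lam)) / sqrt ?\<tau>)" using \<tau> by (simp add: field_simps)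
  have "?N\<^sup>2 = q * (x \<bullet> t) + p \<bullet> y"
    unfolding vnorm_sq z p_def y_def q_def by (simp add: inner_diff_left inner_diff_right tt inner_commute algebra_simps)
  also have "\<dots> \<le> \<bar>q\<bar> * \<bar>x \<bullet> t\<bar> + norm p * norm y"
    by (intro add_mono norm_cauchy_schwarz) (simp add: abs_mult[symmetric])
  also have "\<dots> \<le> (?N * ((1 + sqrt (S / lam)) / sqrt ?\<tau>)) * \<bar>x \<bullet> t\<bar> + ?N / sqrt lam * norm y"
    by (intro add_mono mult_right_mono q np) auto
  also have "\<dots> = ?N * ((1 + sqrt (S / lam)) / sqrt ?\<tau> * \<bar>x \<bullet> t\<bar> + norm y / sqrt lam)" by (simp add: algebra_simps)
  finally have N1: "?N * ?N \<le> ?N * ((1 + sqrt (S / lam)) / sqrt ?\<tau> * \<bar>x \<bullet> t\<bar> + norm y / sqrt lam)" by (simp add: power2_eq_square)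
  have N: "?N \<le> (1 + sqrt (S / lam)) / sqrt ?\<tau> * \<bar>x \<bullet> t\<bar> + norm y / sqrt lam"
  proof (cases "?N = 0")
    case True
    then show ?thesis using \<tau> l form_le_trace lam2 by (simp add: S_def)
  next
    case False
    then show ?thesis using vnorm_nonneg[of z] N1 by (simp add: mult_le_cancel_left)
  qed
  have sq2: "(a + b)\<^sup>2 \<le> 2 * a\<^sup>2 + 2 * b\<^sup>2" for a b :: real
    using sum_squares_bound[of a b] by (simp add: power2_sum)
  have "?N\<^sup>2 \<le> ((1 + sqrt (S / lam)) / sqrt ?\<tau> * \<bar>x \<bullet> t\<bar> + norm y / sqrt lam)\<^sup>2"
    by (rule power_mono[OF N vnorm_nonneg])
  also have "\<dots> \<le> 2 * ((1 + sqrt (S / lam)) / sqrt ?\<tau> * \<bar>x \<bullet> t\<bar>)\<^sup>2 + 2 * (norm y / sqrt lam)\<^sup>2" by (rule sq2)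
  also have "\<dots> = energy (2 / lam) (2 * h) t x"
    using \<tau> lam2 unfolding energy_def ny[symmetric] h_def S_def[symmetric] 
    by (simp add: power_mult_distrib power_divide)
  finally show ?thesis .
qed

end

text \<open>Weights of the two components of the energy for traces in \<open>(L - 1, L]\<close>. The design matrix is
  bounded below by \<open>\<lambda>\<^sub>m\<^sub>i\<^sub>n \<ge> \<surd>L - 1.05\<close>, and along the Bloch vector by a multiple of \<open>L\<close>; the second
  bound is effective only for large \<open>L\<close>.\<close>
definition coef_perp :: "real \<Rightarrow> real" where
  "coef_perp L = (if L \<le> 30000 then 1 else 2 / (sqrt L - 1.05))"

definition coef_par :: "real \<Rightarrow> real" where
  "coef_par L = (if L \<le> 30000 then 1 else 72.04 / (L - 1 - 24.86 * sqrt L))"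

text \<open>For small \<open>L\<close> both coefficients are 1 and the energy is the squared norm. A
  unit action then contributes the variance of its reward, which \<open>var_par\<close> alone
  accounts for.\<close>

definition budget :: "real \<Rightarrow> real \<Rightarrow> real" where
  "budget L T = (if L \<le> 30000 then var_par T else coef_perp L * var_perp T + coef_par L * var_par T)"

lemma coef_pos:
  assumes "576 \<le> L" shows "0 < coef_perp L" "0 < coef_par L"
proof -
  have "0 < sqrt L - 1.05 \<and> 0 < L - 1 - 24.86 * sqrt L" if "30000 < L"
  proof -
    have y: "173 \<le> sqrt L" using that by (intro real_le_rsqrt) simp
    have "173 * sqrt L \<le> sqrt L * sqrt L" using y that by (intro mult_right_mono) auto
    moreover have "sqrt L * sqrt L = L" using that by simp
    ultimately show ?thesis using y that by simp
  qed
  then show "0 < coef_perp L" "0 < coef_par L" by (auto simp: coef_perp_def coef_par_def)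
qed

lemma budget_mono: "576 \<le> L \<Longrightarrow> 0 \<le> S \<Longrightarrow> S \<le> T \<Longrightarrow> budget L S \<le> budget L T"
  unfolding budget_def using coef_pos[of L] var_perp_mono[of S T] var_par_mono[of S T]
  by (auto intro!: add_mono mult_left_mono)

lemma var_par_total: "576 \<le> L \<Longrightarrow> var_par L - var_par 6 \<le> 4.828219 + 0.001573 * L"
  by (simp add: var_par_def min_def)

lemma var_perp_total: "576 \<le> L \<Longrightarrow> var_perp L - var_perp 6 \<le> 5.736 + 0.0451 * sqrt L"
proof -
  assume "576 \<le> L"
  moreover define r :: real where "r = sqrt 6"
  moreover have "0 \<le> r" by (simp add: r_def)
  ultimately show ?thesis unfolding var_perp_def r_def[symmetric] by (simp add: min_def)
qed

text \<open>The factor 3 comes from the median, 3.3 under the root from the energy threshold, 2 from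
  the regularization bias and 10.89 from the squared error bound.\<close>

lemma budget_early:
  assumes "576 \<le> L" "L \<le> 30000" "sqrt L - 1.05 \<le> m"
  shows "(3 * sqrt (3.3 * (budget L L - budget L 6)) + 2)\<^sup>2 \<le> 10.89 * m"
proof -
  define y where "y = sqrt L"
  have "sqrt L \<le> 173.21" using assms by (intro real_le_lsqrt) (simp_all add: power2_eq_square)
  then have y: "24 \<le> y" "y \<le> 173.21" "y\<^sup>2 = L" 
    using assms by (auto simp: y_def intro: real_le_rsqrt)
  define D where "D = budget L L - budget L 6"
  have D: "D \<le> 4.828219 + 0.001573 * y\<^sup>2" "0 \<le> D"
    using var_par_total[OF assms(1)] budget_mono[OF assms(1), of 6 L] assms y by (simp_all add: D_def budget_def)
  have e: "(2.5 + 0.078 * y)\<^sup>2 = 6.25 + 0.39 * y + 0.006084 * y\<^sup>2" by (simp add: power2_eq_square algebra_simps)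
  have "576 \<le> y\<^sup>2" using y assms by simp
  then have "3.3 * D \<le> (2.5 + 0.078 * y)\<^sup>2" unfolding e using D y(1) by simp
  then have X: "sqrt (3.3 * D) \<le> 2.5 + 0.078 * y" using y D by (intro real_le_lsqrt) auto
  \<comment> \<open>The chord of the convex function \<open>y\<^sup>2\<close> over the interval from
    24 to 173.21 makes the remaining inequality linear.\<close>
  have conv: "y\<^sup>2 \<le> 197.21 * y - 4157.04"
    using mult_nonneg_nonneg[of "y - 24" "173.21 - y"] y by (simp add: power2_eq_square algebra_simps diff_divide_distrib)
  have "(3 * sqrt (3.3 * D) + 2)\<^sup>2 = 9 * (sqrt (3.3 * D))\<^sup>2 + 12 * sqrt (3.3 * D) + 4" 
    by (simp only: power2_eq_square) (simp add: algebra_simps)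
  also have "\<dots> = 29.7 * D + 12 * sqrt (3.3 * D) + 4" using D by simp
  also have "\<dots> \<le> 29.7 * (4.828219 + 0.001573 * y\<^sup>2) + 12 * (2.5 + 0.078 * y) + 4"
    using D X by (intro add_mono mult_left_mono) auto
  also have "\<dots> \<le> 10.89 * (y - 1.05)" using conv y(1) by (simp add: field_simps)
  also have "\<dots> \<le> 10.89 * m" using assms(3) by (intro mult_left_mono) (auto simp: y_def)
  finally show ?thesis by (simp add: D_def)
qed

text \<open>Both components are worst at \<open>sqrt L = 173.2\<close>, the lower end of this
  range.\<close>

lemma budget_late:
  assumes "30000 < L"
  shows "budget L L - budget L 6 \<le> 0.3038"
proof -
  define y where "y = sqrt L"
  have "173.2 \<le> sqrt L" using assms by (intro real_le_rsqrt) (simp add: power2_eq_square)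
  then have y: "173.2 \<le> y" "y\<^sup>2 = L" using assms by (auto simp: y_def)
  have yy: "173.2 * y \<le> y\<^sup>2" unfolding power2_eq_square using y by (intro mult_right_mono) auto
  have L: "576 \<le> L" using assms by simp
  have "coef_perp L * (var_perp L - var_perp 6) \<le> 2 / (y - 1.05) * (5.736 + 0.0451 * y)"
    using assms y var_perp_total[OF L] by (simp add: coef_perp_def y_def[symmetric] divide_right_mono)
  also have "\<dots> \<le> 0.1576" using y(1) by (simp add: pos_divide_le_eq)
  finally have 1: "coef_perp L * (var_perp L - var_perp 6) \<le> 0.1576" .
  have pos: "0 < y\<^sup>2 - 1 - 24.86 * y" using yy y(1) by simp
  have "coef_par L * (var_par L - var_par 6) \<le> 72.04 / (y\<^sup>2 - 1 - 24.86 * y) * (4.828219 + 0.001573 * y\<^sup>2)"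
    using assms var_par_total[OF L] pos unfolding coef_par_def y(2) y_def[symmetric] by (simp add: divide_right_mono)
  also have "\<dots> \<le> 0.1462" using pos yy y(1) by (simp add: pos_divide_le_eq)
  finally show ?thesis using 1 assms by (simp add: budget_def algebra_simps)
qed

section \<open>From small noise energies to a small error of the estimator\<close>

context design_state
begin

lemma level_lam:
  assumes "L - 1 < T" "576 \<le> L" shows "sqrt L - 1.05 \<le> lam"
proof -
  have y: "24 \<le> sqrt L" "(sqrt L)\<^sup>2 = L" using assms by (auto intro: real_le_rsqrt)
  have "(sqrt L - 0.05)\<^sup>2 = L - 0.1 * sqrt L + 0.0025" using y(2) by (simp add: power2_eq_square algebra_simps)
  also have "\<dots> \<le> T - 1" using y(1) assms by simp
  finally have "sqrt L - 0.05 \<le> sqrt (T - 1)" by (rule real_le_rsqrt)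
  moreover have "sqrt (T - 1) - 1 \<le> lam" using ok by (auto simp: design_ok_def Let_def)
  ultimately show ?thesis by simp
qed

lemma energy_mono:
  assumes "\<alpha> \<le> \<alpha>'" "\<beta> \<le> \<beta>'" shows "energy \<alpha> \<beta> t x \<le> energy \<alpha>' \<beta>' t x"
proof -
  have "(x \<bullet> t)\<^sup>2 \<le> (norm x)\<^sup>2" using Cauchy_Schwarz_ineq2[of x t] t by (simp add: abs_le_square_iff[symmetric])
  then show ?thesis unfolding energy_def using assms by (intro add_mono mult_right_mono) auto
qed

text \<open>Up to level 30000 the isotropic bound \<open>vnorm_solution\<close> is enough. Beyond it
  the squared norm of the noise is too large, and the split bound is used; the coefficients of the
  energy are made for it.\<close>

lemma solution_error_level:
  assumes L: "L - 1 < T" "T \<le> L" "576 \<le> L"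
    and z: "st_V st *v z = x" and e: "energy (coef_perp L) (coef_par L) t x \<le> 3.3 * (budget L L - budget L 6)"
  shows "3 * vnorm (st_V st) z + 2 / sqrt lam \<le> 3.3"
proof (cases "L \<le> 30000")
  case True
  let ?D = "budget L L - budget L 6"
  have l: "0 < sqrt lam" "(sqrt lam)\<^sup>2 = lam" using lam2 by auto
  have "(norm x)\<^sup>2 \<le> 3.3 * ?D" using e True by (simp add: energy_def coef_perp_def coef_par_def)
  then have nx: "norm x \<le> sqrt (3.3 * ?D)" by (rule real_le_rsqrt)
  have "(3 * sqrt (3.3 * ?D) + 2)\<^sup>2 \<le> (3.3 * sqrt lam)\<^sup>2"
  proof -
    have "(3.3 * sqrt lam)\<^sup>2 = 10.89 * lam" 
      unfolding power_mult_distrib l(2) by (simp add: power2_eq_square)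
    then show ?thesis using budget_early[OF L(3) True level_lam[OF L(1,3)]] by (simp only:)
  qed
  then have "3 * sqrt (3.3 * ?D) + 2 \<le> 3.3 * sqrt lam"
    by (rule power2_le_imp_le) (use l in simp)
  then have "3 * norm x + 2 \<le> 3.3 * sqrt lam" using nx by simp
  then have "3 * (norm x / sqrt lam) + 2 / sqrt lam \<le> 3.3" using l(1) by (simp add: field_simps)
  then show ?thesis using vnorm_solution[OF z] by simp
next
  case False
  define y where "y = sqrt L"
  have "173.2 \<le> sqrt L" using False by (intro real_le_rsqrt) (simp add: power2_eq_square)
  then have y: "173.2 \<le> y" "y\<^sup>2 = L" using False by (auto simp: y_def)
  have yy: "173.2 * y \<le> y\<^sup>2" unfolding power2_eq_square using y by (intro mult_right_mono) auto
  have lam: "y - 1.05 \<le> lam" using level_lam[OF L(1,3)] by (simp add: y_def)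
  define S where "S = T - t \<bullet> (st_V st *v t)"
  have "sqrt T \<le> y" using L by (simp add: y_def)
  moreover have "S \<le> 24.86 * sqrt T" using ok by (simp add: S_def design_ok_def Let_def)
  ultimately have S: "S \<le> 24.86 * y" by simp
  have \<tau>: "y\<^sup>2 - 1 - 24.86 * y \<le> t \<bullet> (st_V st *v t)" using S L unfolding S_def y(2) by simp
  have pos: "0 < y\<^sup>2 - 1 - 24.86 * y" using yy y(1) by simp
  have "S \<le> 25.012 * lam" using S lam y(1) by simp
  then have "S / lam \<le> 25.012" using lam2 by (simp add: pos_divide_le_eq)
  then have "sqrt (S / lam) \<le> sqrt 25.012" by simp
  also have "sqrt 25.012 \<le> 5.0012" by (rule real_le_lsqrt) (simp_all add: power2_eq_square)
  finally have s: "sqrt (S / lam) \<le> 5.0012" .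
  have S0: "0 \<le> S" using form_le_trace by (simp add: S_def)
  have "(1 + sqrt (S / lam))\<^sup>2 \<le> (1 + 5.0012)\<^sup>2" using s S0 lam2 by (intro power_mono) auto
  \<comment> \<open>Twice 36.02 is the constant 72.04 in \<open>coef_par\<close>.\<close>
  then have h: "(1 + sqrt (S / lam))\<^sup>2 \<le> 36.02" by (simp add: power2_eq_square)
  have "(vnorm (st_V st) z)\<^sup>2 \<le> energy (2 / lam) (2 * ((1 + sqrt (S / lam))\<^sup>2 / (t \<bullet> (st_V st *v t)))) t x"
    unfolding S_def by (rule vnorm_solution_split[OF z]) (use \<tau> pos in linarith)
  also have "\<dots> \<le> energy (coef_perp L) (coef_par L) t x"
  proof (rule energy_mono)
    show "2 / lam \<le> coef_perp L"
      using lam y(1) False by (simp add: coef_perp_def y_def[symmetric] frac_le)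
    define d where "d = y\<^sup>2 - 1 - 24.86 * y"
    have "(1 + sqrt (S / lam))\<^sup>2 / (t \<bullet> (st_V st *v t)) \<le> 36.02 / d"
      using h \<tau> pos unfolding d_def by (intro frac_le) auto
    then have "2 * ((1 + sqrt (S / lam))\<^sup>2 / (t \<bullet> (st_V st *v t))) \<le> 72.04 / d" by simp
    also have "\<dots> = coef_par L" using False unfolding coef_par_def d_def y(2) y_def[symmetric] by simp
    finally show "2 * ((1 + sqrt (S / lam))\<^sup>2 / (t \<bullet> (st_V st *v t))) \<le> coef_par L" .
  qed
  also have "\<dots> \<le> 3.3 * 0.3038" using e budget_late[of L] False by simp
  also have "\<dots> \<le> 1.0013\<^sup>2" by (simp add: power2_eq_square)
  finally have "vnorm (st_V st) z \<le> 1.0013" by (rule power2_le_imp_le) simp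
  moreover have "13.12 \<le> sqrt lam" using lam y(1) by (intro real_le_rsqrt) (simp add: power2_eq_square)
  then have "2 / sqrt lam \<le> 2 / 13.12" using lam2 by (intro divide_left_mono) auto
  ultimately show ?thesis by simp
qed

text \<open>All estimators share the regularization bias, so they concentrate around
  \<open>t - 2 *\<^sub>R b\<close> rather than \<open>t\<close>. Applying the median argument around
  this centre triples only the noise, and the bias is added once.\<close>

lemma estimate_ok_of_majority:
  assumes J: "vvn_selector k J"
    and est: "st_est st = (let V = st_V st; th = (\<lambda>j. matrix_inv V *v st_sums st j) in th (J V th))"
    and L: "L - 1 < T" "T \<le> L" "576 \<le> L"
    and maj: "k + 3 \<le> 2 * card {j\<in>{1..k}. energy (coef_perp L) (coef_par L) t (noise t st j) \<le> 3.3 * (budget L L - budget L 6)}"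
  shows "estimate_ok t st"
proof -
  define th where "th = (\<lambda>j. matrix_inv (st_V st) *v st_sums st j)"
  define b where "b = matrix_inv (st_V st) *v t"
  define G where "G = {j\<in>{1..k}. energy (coef_perp L) (coef_par L) t (noise t st j) \<le> 3.3 * (budget L L - budget L 6)}"
  have "vnorm (st_V st) (th (J (st_V st) th) - (t - 2 *\<^sub>R b)) \<le> 3 * ((3.3 - 2 / sqrt lam) / 3)"
  proof (rule vvn_selector_close[OF J vnorm_triangle vnorm_minus])
    fix j assume "j \<in> G"
    then have e: "energy (coef_perp L) (coef_par L) t (noise t st j) \<le> 3.3 * (budget L L - budget L 6)" by (simp add: G_def)
    have "st_V st *v (th j - (t - 2 *\<^sub>R b)) = noise t st j"
      by (simp add: matrix_vector_mult_diff_distrib matrix_vector_mult_scaleR th_def b_def solve_design noise_def)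
    from solution_error_level[OF L this e] 
    show "vnorm (st_V st) (th j - (t - 2 *\<^sub>R b)) \<le> (3.3 - 2 / sqrt lam) / 3" by simp
  qed (use maj in \<open>auto simp: G_def\<close>)
  moreover have "vnorm (st_V st) b \<le> 1 / sqrt lam"
    using vnorm_solution[of b t] t by (simp add: b_def solve_design)
  moreover have "vnorm (st_V st) ((th (J (st_V st) th) - (t - 2 *\<^sub>R b)) + (-2) *\<^sub>R b) 
      \<le> vnorm (st_V st) (th (J (st_V st) th) - (t - 2 *\<^sub>R b)) + 2 * vnorm (st_V st) b"
    using vnorm_triangle[of "th (J (st_V st) th) - (t - 2 *\<^sub>R b)" "(-2) *\<^sub>R b"] unfolding vnorm_scaleR by simp
  moreover have "st_est st - t = (th (J (st_V st) th) - (t - 2 *\<^sub>R b)) + (-2) *\<^sub>R b"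
    using est by (simp add: Let_def th_def)
  ultimately show ?thesis by (simp add: estimate_ok_def)
qed

end

section \<open>The supermartingale of the noise energies\<close>

text \<open>The energy is the squared norm of a linear image, to which the variance identity for
  Bernoulli noise applies.\<close>

lemma energy_eq_norm_sq:
  assumes "norm t = 1" "0 \<le> \<alpha>" "0 \<le> \<beta>"
  shows "energy \<alpha> \<beta> t x = (norm (sqrt \<alpha> *\<^sub>R (x - (x \<bullet> t) *\<^sub>R t) + (sqrt \<beta> * (x \<bullet> t)) *\<^sub>R t))\<^sup>2"
proof -
  let ?y = "x - (x \<bullet> t) *\<^sub>R t"
  have tt: "t \<bullet> t = 1" using assms by (simp add: norm_eq_sqrt_inner)
  have yt: "?y \<bullet> t = 0" by (simp add: inner_diff_left tt)
  have yy: "?y \<bullet> ?y = (norm x)\<^sup>2 - (x \<bullet> t)\<^sup>2"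
    unfolding power2_norm_eq_inner
    by (simp add: inner_diff_left inner_diff_right tt inner_commute power2_eq_square)
  define y where "y = ?y"
  define a b where "a = sqrt \<alpha>" and "b = sqrt \<beta>"
  have "(norm (a *\<^sub>R y + (b * (x \<bullet> t)) *\<^sub>R t))\<^sup>2 
    = a\<^sup>2 * (y \<bullet> y) + 2 * a * (b * (x \<bullet> t)) * (y \<bullet> t) + b\<^sup>2 * (x \<bullet> t)\<^sup>2 * (t \<bullet> t)"
    unfolding power2_norm_eq_inner 
    by (simp only: inner_add_left inner_add_right inner_scaleR_left inner_scaleR_right inner_commute power2_eq_square)
       (simp add: algebra_simps)
  also have "\<dots> = energy \<alpha> \<beta> t x"
    using assms tt yt yy unfolding y_def[symmetric] by (simp add: energy_def a_def b_def)
  finally show ?thesis by (simp only: y_def a_def b_def)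
qed

lemma energy_nonneg: "norm t = 1 \<Longrightarrow> 0 \<le> \<alpha> \<Longrightarrow> 0 \<le> \<beta> \<Longrightarrow> 0 \<le> energy \<alpha> \<beta> t x"
  by (simp add: energy_eq_norm_sq)

definition rounds_of :: "nat \<Rightarrow> (nat \<times> bool \<times> nat) set" where
  "rounds_of j = {1..2} \<times> UNIV \<times> {j}"

lemma sum_rounds_of: "(\<Sum>x\<in>rounds_of j. f (fst x) (fst (snd x))) = (\<Sum>i\<in>{1..2}. f i True + f i False)"
proof -
  have "(\<Sum>x\<in>rounds_of j. f (fst x) (fst (snd x))) = (\<Sum>i\<in>{1..2}. \<Sum>y\<in>UNIV \<times> {j}. f i (fst y))"
    unfolding rounds_of_def by (subst sum.cartesian_product) (simp add: case_prod_unfold)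
  also have "\<dots> = (\<Sum>i\<in>{1..2}. \<Sum>b\<in>UNIV. f i b)"
  proof (rule sum.cong[OF refl])
    fix i
    have "(\<Sum>y\<in>UNIV \<times> {j}. f i (fst y)) = (\<Sum>b\<in>UNIV. \<Sum>l\<in>{j}. f i b)"
      by (subst sum.cartesian_product) (simp add: case_prod_unfold)
    then show "(\<Sum>y\<in>UNIV \<times> {j}. f i (fst y)) = (\<Sum>b\<in>UNIV. f i b)" by simp
  qed
  also have "\<dots> = (\<Sum>i\<in>{1..2}. f i True + f i False)" by (simp add: UNIV_bool add.commute)
  finally show ?thesis .
qed

text \<open>For distinct \<open>j\<close> the factors depend on disjoint sets of rewards, so that given the past
  their product is a supermartingale whenever each factor is one. The first two summands of
  the numerator compensate the growth of the energy up to trace \<open>L\<close>.\<close>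
definition noise_prod :: "nat \<Rightarrow> real^3 \<Rightarrow> real \<Rightarrow> 3 alg_state \<Rightarrow> real" where
  "noise_prod k t L st = (if trace (st_V st) \<le> L then \<Prod>j\<in>{1..k}. 1 + 13/33 * 
      ((budget L L - budget L (trace (st_V st)) + energy (coef_perp L) (coef_par L) t (noise t st j)) 
       / (budget L L - budget L 6)) else 0)"

text \<open>The jump reserved for the first batch already contributes 4 to
  \<open>var_par\<close>.\<close>

lemma budget_diff_pos: "576 \<le> L \<Longrightarrow> 0 < budget L L - budget L 6"
proof -
  assume L: "576 \<le> L"
  have "4 \<le> var_par L - var_par 6" using L by (simp add: var_par_def min_def)
  moreover have "0 \<le> var_perp L - var_perp 6" using var_perp_mono[of 6 L] L by simp
  ultimately have "0 < coef_par L * (var_par L - var_par 6)" "0 \<le> coef_perp L * (var_perp L - var_perp 6)"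
    "0 < var_par L - var_par 6"
    using coef_pos[OF L] by auto
  then show ?thesis by (simp add: budget_def algebra_simps)
qed

section \<open>Conditional expectations over one batch\<close>

context design_state
begin

lemma noise_step:
  assumes p: "\<And>a. p a = (1 + a \<bullet> t) / 2"
  shows "noise t (alg_step 2 k E J st X) j = noise t st j + (\<Sum>x\<in>rounds_of j. 
     ((if X x then 1 else -1) - (2 * p (alg_actions E st (fst x) (fst (snd x))) - 1)) *\<^sub>R (weight st *\<^sub>R alg_actions E st (fst x) (fst (snd x))))"
proof -
  let ?A = "alg_actions E st" and ?w = "weight st"
  have p2: "2 * p a - 1 = a \<bullet> t" for a by (simp add: p field_simps)
  have "(\<Sum>x\<in>rounds_of j. ((if X x then 1 else -1) - (2 * p (?A (fst x) (fst (snd x))) - 1)) *\<^sub>R (?w *\<^sub>R ?A (fst x) (fst (snd x))))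
    = (\<Sum>x\<in>rounds_of j. ((if X (fst x, fst (snd x), j) then 1 else -1) - (?A (fst x) (fst (snd x)) \<bullet> t)) *\<^sub>R (?w *\<^sub>R ?A (fst x) (fst (snd x))))"
    unfolding p2 by (rule sum.cong) (auto simp: rounds_of_def)
  also have "\<dots> = (\<Sum>i\<in>{1..2}. ((if X (i, True, j) then 1 else -1) - (?A i True \<bullet> t)) *\<^sub>R (?w *\<^sub>R ?A i True) 
      + ((if X (i, False, j) then 1 else -1) - (?A i False \<bullet> t)) *\<^sub>R (?w *\<^sub>R ?A i False))"
    by (rule sum_rounds_of[where f = "\<lambda>i b. ((if X (i, b, j) then 1 else -1) - (?A i b \<bullet> t)) *\<^sub>R (?w *\<^sub>R ?A i b)"])
  also have "\<dots> = ?w *\<^sub>R (\<Sum>i\<in>{1..2}. (if X (i, True, j) then 1 else -1) *\<^sub>R ?A i True + (if X (i, False, j) then 1 else -1) *\<^sub>R ?A i False) 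
      - ?w *\<^sub>R actions_sum E st (\<lambda>a. (a \<bullet> t) *\<^sub>R a)"
    unfolding actions_sum_def scaleR_diff_right[symmetric] sum_subtractf[symmetric] scaleR_sum_right
    by (rule sum.cong) (simp_all add: algebra_simps)
  finally show ?thesis
    unfolding noise_def alg_step_sel next_V_apply by (simp add: algebra_simps)
qed

text \<open>In the added sum the first factor is the variance of a reward and the second the energy
  of the unit vector \<open>a\<close>.\<close>

lemma expectation_energy_step:
  assumes p: "\<And>a. p a = (1 + a \<bullet> t) / 2" and \<alpha>: "0 \<le> \<alpha>" and \<beta>: "0 \<le> \<beta>"
  shows "measure_pmf.expectation (Pi_pmf (rounds_of j) False (\<lambda>(i, b, j). bernoulli_pmf (p (alg_actions E st i b))))
     (\<lambda>X. energy \<alpha> \<beta> t (noise t (alg_step 2 k E J st X) j))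
   = energy \<alpha> \<beta> t (noise t st j) + (weight st)\<^sup>2 * actions_sum E st (\<lambda>a. (1 - (a \<bullet> t)\<^sup>2) * (\<alpha> * (1 - (a \<bullet> t)\<^sup>2) + \<beta> * (a \<bullet> t)\<^sup>2))"
proof -
  let ?A = "\<lambda>x. alg_actions E st (fst x) (fst (snd x))" and ?w = "weight st"
  define f where "f x = sqrt \<alpha> *\<^sub>R (x - (x \<bullet> t) *\<^sub>R t) + (sqrt \<beta> * (x \<bullet> t)) *\<^sub>R t" for x
  have lin: "linear f" unfolding f_def
    by (intro linearI) (simp_all add: inner_add_left algebra_simps)
  have en: "energy \<alpha> \<beta> t x = (norm (f x))\<^sup>2" for x
    unfolding f_def using energy_eq_norm_sq[OF t \<alpha> \<beta>] .
  have q: "p (?A x) \<in> {0..1}" if "x \<in> rounds_of j" for x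
  proof -
    have "norm (?A x) = 1" using that by (intro norm_action) (auto simp: rounds_of_def)
    then show ?thesis using Cauchy_Schwarz_ineq2[of "?A x" t] t by (auto simp: p abs_le_iff)
  qed
  have fin: "finite (rounds_of j)" by (simp add: rounds_of_def)
  have "measure_pmf.expectation (Pi_pmf (rounds_of j) False (\<lambda>(i, b, j). bernoulli_pmf (p (alg_actions E st i b))))
     (\<lambda>X. energy \<alpha> \<beta> t (noise t (alg_step 2 k E J st X) j))
   = measure_pmf.expectation (Pi_pmf (rounds_of j) False (\<lambda>x. bernoulli_pmf (p (?A x))))
     (\<lambda>X. (norm (f (noise t st j) + (\<Sum>x\<in>rounds_of j. ((if X x then 1 else -1) - (2 * p (?A x) - 1)) *\<^sub>R f (?w *\<^sub>R ?A x))))\<^sup>2)"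
    unfolding en noise_step[OF p] linear_add[OF lin] linear_sum[OF lin] linear_scale[OF lin] case_prod_unfold by simp
  also have "\<dots> = (norm (f (noise t st j)))\<^sup>2 + (\<Sum>x\<in>rounds_of j. (1 - (2 * p (?A x) - 1)\<^sup>2) * (norm (f (?w *\<^sub>R ?A x)))\<^sup>2)"
    by (rule expectation_sq_norm_bernoulli_noise[OF fin q])
  also have "(\<Sum>x\<in>rounds_of j. (1 - (2 * p (?A x) - 1)\<^sup>2) * (norm (f (?w *\<^sub>R ?A x)))\<^sup>2) 
     = (\<Sum>x\<in>rounds_of j. ?w\<^sup>2 * ((1 - (?A x \<bullet> t)\<^sup>2) * (\<alpha> * (1 - (?A x \<bullet> t)\<^sup>2) + \<beta> * (?A x \<bullet> t)\<^sup>2)))"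
  proof (rule sum.cong[OF refl])
    fix x assume x: "x \<in> rounds_of j"
    have "norm (?A x) = 1" using x by (intro norm_action) (auto simp: rounds_of_def)
    then have e: "(norm (f (?A x)))\<^sup>2 = \<alpha> * (1 - (?A x \<bullet> t)\<^sup>2) + \<beta> * (?A x \<bullet> t)\<^sup>2"
      unfolding en[symmetric] energy_def by simp
    have "2 * p (?A x) - 1 = ?A x \<bullet> t" by (simp add: p field_simps)
    then show "(1 - (2 * p (?A x) - 1)\<^sup>2) * (norm (f (?w *\<^sub>R ?A x)))\<^sup>2 
       = ?w\<^sup>2 * ((1 - (?A x \<bullet> t)\<^sup>2) * (\<alpha> * (1 - (?A x \<bullet> t)\<^sup>2) + \<beta> * (?A x \<bullet> t)\<^sup>2))"
      unfolding linear_scale[OF lin] norm_scaleR power_mult_distrib e by simp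
  qed
  also have "\<dots> = ?w\<^sup>2 * actions_sum E st (\<lambda>a. (1 - (a \<bullet> t)\<^sup>2) * (\<alpha> * (1 - (a \<bullet> t)\<^sup>2) + \<beta> * (a \<bullet> t)\<^sup>2))"
    unfolding actions_sum_def sum_distrib_left[symmetric]
    by (subst sum_rounds_of[where f = "\<lambda>i b. (1 - (alg_actions E st i b \<bullet> t)\<^sup>2) * (\<alpha> * (1 - (alg_actions E st i b \<bullet> t)\<^sup>2) + \<beta> * (alg_actions E st i b \<bullet> t)\<^sup>2)"]) simp
  finally show ?thesis unfolding en .
qed

lemma budget_step:
  assumes est: "estimate_ok t st" and L: "576 \<le> L"
  shows "(weight st)\<^sup>2 * actions_sum E st (\<lambda>a. (1 - (a \<bullet> t)\<^sup>2) * (coef_perp L * (1 - (a \<bullet> t)\<^sup>2) + coef_par L * (a \<bullet> t)\<^sup>2))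
    \<le> budget L T' - budget L T"
proof (cases "L \<le> 30000")
  case True
  then show ?thesis using variance_par_step[OF est] by (simp add: coef_perp_def coef_par_def budget_def)
next
  case False
  let ?v = "\<lambda>a. 1 - (a \<bullet> t)\<^sup>2"
  note c = coef_pos[OF L]
  have "actions_sum E st (\<lambda>a. ?v a * (coef_perp L * ?v a + coef_par L * (a \<bullet> t)\<^sup>2)) 
     \<le> actions_sum E st (\<lambda>a. coef_perp L * (?v a)\<^sup>2 + coef_par L * ?v a)"
  proof (rule actions_sum_mono)
    fix i :: nat and b assume "i \<in> {1..2}"
    then have x: "(alg_actions E st i b \<bullet> t)\<^sup>2 \<le> 1"
      using inner_sq_le_1[of _ t] norm_action t by force
    have "coef_par L * (?v (alg_actions E st i b) * (alg_actions E st i b \<bullet> t)\<^sup>2) \<le> coef_par L * ?v (alg_actions E st i b)"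
      using x c by (intro mult_left_mono mult_left_le) auto
    then show "?v (alg_actions E st i b) * (coef_perp L * ?v (alg_actions E st i b) + coef_par L * (alg_actions E st i b \<bullet> t)\<^sup>2)
      \<le> coef_perp L * (?v (alg_actions E st i b))\<^sup>2 + coef_par L * ?v (alg_actions E st i b)"
      by (simp add: power2_eq_square algebra_simps)
  qed
  also have "\<dots> = coef_perp L * actions_sum E st (\<lambda>a. (?v a)\<^sup>2) + coef_par L * actions_sum E st ?v"
    by (simp add: actions_sum_two algebra_simps)
  finally have "(weight st)\<^sup>2 * actions_sum E st (\<lambda>a. ?v a * (coef_perp L * ?v a + coef_par L * (a \<bullet> t)\<^sup>2))
    \<le> coef_perp L * ((weight st)\<^sup>2 * actions_sum E st (\<lambda>a. (?v a)\<^sup>2)) + coef_par L * ((weight st)\<^sup>2 * actions_sum E st ?v)"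
    by (auto dest: mult_left_mono[of _ _ "(weight st)\<^sup>2"] simp: algebra_simps)
  also have "\<dots> \<le> coef_perp L * (var_perp T' - var_perp T) + coef_par L * (var_par T' - var_par T)"
    using c by (intro add_mono mult_left_mono variance_perp_step[OF est] variance_par_step[OF est]) auto
  finally show ?thesis using False by (simp add: budget_def algebra_simps)
qed

lemma noise_factor_nonneg:
  assumes "576 \<le> L" "T \<le> L"
  shows "0 \<le> (budget L L - budget L T + energy (coef_perp L) (coef_par L) t x) / (budget L L - budget L 6)"
  using budget_diff_pos[OF assms(1)] budget_mono[OF assms(1), of T L] T_ge(1) assms(2) 
    energy_nonneg[OF t less_imp_le less_imp_le, OF coef_pos[OF assms(1)]] by auto

lemma noise_prod_nonneg: "576 \<le> L \<Longrightarrow> 0 \<le> noise_prod k t L st"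
  unfolding noise_prod_def
  by (cases "T \<le> L") (simp_all only: if_True if_False, intro prod_nonneg add_nonneg_nonneg mult_nonneg_nonneg noise_factor_nonneg, simp_all)

text \<open>The factors depend on disjoint blocks of rewards, so the expectation of the product is
  the product of expectations. Each factor is affine in its energy, whose mean growth is paid for by
  the decrease of the remaining budget.\<close>

lemma noise_prod_supermartingale:
  assumes est: "estimate_ok t st" and L: "576 \<le> L" and p: "\<And>a. p a = (1 + a \<bullet> t) / 2"
  shows "measure_pmf.expectation (batch_rewards p k E st) (\<lambda>X. noise_prod k t L (alg_step 2 k E J st X)) \<le> noise_prod k t L st"
proof (cases "T' \<le> L")
  \<comment> \<open>The next trace is already known; if it leaves the level, the product becomes
    0.\<close>
  case False
  then show ?thesis using noise_prod_nonneg[OF L] by (simp add: noise_prod_def[of _ _ _ "alg_step _ _ _ _ _ _"] alg_step_sel)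
next
  case True
  let ?D = "budget L L - budget L 6" and ?en = "energy (coef_perp L) (coef_par L) t"
  let ?q = "\<lambda>(i, b, j). bernoulli_pmf (p (alg_actions E st i b))"
  define f where "f j X = 1 + 13/33 * ((budget L L - budget L T' + ?en (noise t (alg_step 2 k E J st X) j)) / ?D)" for j X
  have D: "0 < ?D" by (rule budget_diff_pos[OF L])
  have U: "{1..CARD(3) - 1} \<times> UNIV \<times> {1..k} = (\<Union>j\<in>{1..k}. rounds_of j)"
    by (auto simp: rounds_of_def)
  have fin: "finite (rounds_of j)" for j by (simp add: rounds_of_def)
  have "measure_pmf.expectation (batch_rewards p k E st) (\<lambda>X. noise_prod k t L (alg_step 2 k E J st X)) 
     = measure_pmf.expectation (Pi_pmf (\<Union>j\<in>{1..k}. rounds_of j) False ?q) (\<lambda>X. \<Prod>j\<in>{1..k}. f j X)"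
    using True unfolding batch_rewards_def U noise_prod_def alg_step_sel f_def by simp
  also have "\<dots> = (\<Prod>j\<in>{1..k}. measure_pmf.expectation (Pi_pmf (rounds_of j) False ?q) (f j))"
  proof (rule expectation_Pi_pmf_blocks)
    show "disjoint_family_on rounds_of {1..k}" by (auto simp: disjoint_family_on_def rounds_of_def)
    fix j and x y :: "nat \<times> bool \<times> nat \<Rightarrow> bool" 
    assume "\<And>i. i \<in> rounds_of j \<Longrightarrow> x i = y i"
    then have "noise t (alg_step 2 k E J st x) j = noise t (alg_step 2 k E J st y) j"
      unfolding noise_step[OF p] by (intro arg_cong2[where f = "(+)"] refl sum.cong) auto
    then show "f j x = f j y" by (simp add: f_def)
  qed (simp_all add: fin)
  also have "\<dots> \<le> (\<Prod>j\<in>{1..k}. 1 + 13/33 * ((budget L L - budget L T + ?en (noise t st j)) / ?D))"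
  proof (rule prod_mono, rule conjI)
    fix j
    let ?M = "measure_pmf (Pi_pmf (rounds_of j) False ?q)"
    have "0 \<le> ?en (noise t (alg_step 2 k E J st X) j)" for X
      by (rule energy_nonneg[OF t less_imp_le less_imp_le, OF coef_pos[OF L]])
    moreover have "0 \<le> budget L L - budget L T'" using budget_mono[OF L, of T' L] True T_ge(1) T_le_T' by simp
    ultimately show "0 \<le> measure_pmf.expectation (Pi_pmf (rounds_of j) False ?q) (f j)"
      using D unfolding f_def by (intro integral_nonneg_AE AE_I2 add_nonneg_nonneg mult_nonneg_nonneg divide_nonneg_pos) auto
    have i: "integrable ?M g" for g :: "_ \<Rightarrow> real"
      by (rule integrable_measure_pmf_finite[OF finite_set_Pi_pmf[OF fin]])
    have "measure_pmf.expectation (Pi_pmf (rounds_of j) False ?q) (f j) = 1 + 13/33 * ((budget L L - budget L T' 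
        + measure_pmf.expectation (Pi_pmf (rounds_of j) False ?q) (\<lambda>X. ?en (noise t (alg_step 2 k E J st X) j))) / ?D)"
      unfolding f_def using i by (simp add: Bochner_Integration.integral_add[OF i i])
    also have "\<dots> \<le> 1 + 13/33 * ((budget L L - budget L T + ?en (noise t st j)) / ?D)"
      using budget_step[OF est L] D coef_pos[OF L]
      by (intro add_left_mono mult_left_mono divide_right_mono) (simp_all add: expectation_energy_step[OF p])
    finally show "measure_pmf.expectation (Pi_pmf (rounds_of j) False ?q) (f j) \<le> \<dots>" .
  qed
  also have "\<dots> = noise_prod k t L st" using True T_le_T' by (simp add: noise_prod_def)
  finally show ?thesis .
qed

end

section \<open>The run of the algorithm\<close>

lemma norm_sq_residual:
  fixes a x :: "'a::real_inner"
  assumes "norm a = 1"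
  shows "(norm (x - (a \<bullet> x) *\<^sub>R a))\<^sup>2 = (norm x)\<^sup>2 - (a \<bullet> x)\<^sup>2"
proof -
  have "a \<bullet> a = 1" using assms by (simp add: norm_eq_sqrt_inner)
  then show ?thesis unfolding power2_norm_eq_inner 
    by (simp add: inner_diff_left inner_diff_right inner_commute power2_eq_square)
qed

text \<open>The explicit Bloch vector of the state with amplitudes \<open>z\<close> and
  \<open>w\<close>; it has length 1 because four times the product of the squared moduli plus the
  square of their difference is the square of their sum.\<close>

lemma bloch_vector_exists:
  assumes "norm (psi :: complex^2) = 1"
  obtains t :: "real^3" where "norm t = 1" "\<And>a. qubit_reward psi a = (1 + a \<bullet> t) / 2"
proof
  define z w where "z = psi $ 1" and "w = psi $ 2"
  define t :: "real^3" where "t = vector [2 * Re (cnj z * w), 2 * Im (cnj z * w), (cmod z)\<^sup>2 - (cmod w)\<^sup>2]"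
  have zw: "(cmod z)\<^sup>2 + (cmod w)\<^sup>2 = 1"
    using assms by (simp add: norm_vec_def L2_set_def sum_2 z_def w_def)
  have "t \<bullet> t = (2 * Re (cnj z * w))\<^sup>2 + (2 * Im (cnj z * w))\<^sup>2 + ((cmod z)\<^sup>2 - (cmod w)\<^sup>2)\<^sup>2"
    by (simp add: inner_vec_def sum_3 t_def power2_eq_square)
  also have "\<dots> = 4 * (cmod (cnj z * w))\<^sup>2 + ((cmod z)\<^sup>2 - (cmod w)\<^sup>2)\<^sup>2"
    by (simp only: cmod_power2 power_mult_distrib) simp
  also have "\<dots> = ((cmod z)\<^sup>2 + (cmod w)\<^sup>2)\<^sup>2"
    by (simp add: norm_mult power_mult_distrib power2_sum power2_diff)
  finally have "t \<bullet> t = 1" by (simp only: zw) simp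
  then show "norm t = 1" by (simp add: norm_eq_sqrt_inner)
  fix a :: "real^3"
  have "qubit_reward psi a = ((cmod z)\<^sup>2 + (cmod w)\<^sup>2 + (a$1 * (2 * Re (cnj z * w)) + a$2 * (2 * Im (cnj z * w)) 
      + a$3 * ((cmod z)\<^sup>2 - (cmod w)\<^sup>2))) / 2"
    unfolding qubit_reward_def expval_def bloch_proj_def cmod_power2 z_def w_def
    by (simp add: sum_2 matrix_vector_mult_def pauli_x_def pauli_y_def pauli_z_def mat_def power2_eq_square)
       (simp add: algebra_simps add_divide_distrib diff_divide_distrib)
  also have "\<dots> = (1 + a \<bullet> t) / 2"
    unfolding zw by (simp add: inner_vec_def sum_3 t_def)
  finally show "qubit_reward psi a = (1 + a \<bullet> t) / 2" .
qed

lemma norm_alg_actions_le: "norm (alg_actions E st i b) \<le> 1"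
proof -
  have "norm (x /\<^sub>R norm x) \<le> 1" for x :: "real^'n" by (cases "x = 0") auto
  then show ?thesis by (cases st) (auto simp: alg_actions_def Let_def)
qed

context design_state
begin

text \<open>While the trace is below 10000 there have been few batches and the trivial bound 1
  suffices. Later \<open>actions_sin_sq\<close> bounds \<open>1 - a\<^sup>2\<close> for
  \<open>a\<close> the inner product with \<open>t\<close>; this controls \<open>1 - a\<close> once
  \<open>a\<close> is known to be nonnegative.\<close>

lemma action_regret_le:
  assumes est: "estimate_ok t st" and i: "i \<in> {1..2}"
  shows "(1 - alg_actions E st i b \<bullet> t) / 2 \<le> 1000000 / (real (fst st) + 1)"
proof (cases "T < 10000")
  case True
  have "sqrt T \<le> 100" using True by (intro real_le_lsqrt) auto
  moreover have "real (fst st) / 8000 \<le> sqrt T" using ok by (simp add: design_ok_def Let_def)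
  ultimately have "real (fst st) + 1 \<le> 1000000" by simp
  then have "1 \<le> 1000000 / (real (fst st) + 1)" by (simp add: pos_le_divide_eq)
  moreover have "\<bar>alg_actions E st i b \<bullet> t\<bar> \<le> 1"
    using Cauchy_Schwarz_ineq2[of "alg_actions E st i b" t] norm_alg_actions_le[of E st i b] t by simp
  then have "(1 - alg_actions E st i b \<bullet> t) / 2 \<le> 1" by (simp add: abs_le_iff)
  ultimately show ?thesis by (meson order_trans)
next
  case False
  then have T: "576 \<le> T" "10000 \<le> T" by auto
  have y: "100 \<le> sqrt T" using T(2) by (intro real_le_rsqrt) simp
  have lam: "sqrt T \<le> 1.0445 * lam" "95 \<le> lam" using sqrt_T_le_lam[OF T(1)] y by auto
  have e: "(norm (st_est st - t))\<^sup>2 \<le> 10.89 / lam" by (rule norm_sq_error[OF est T(1)])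
  have e4: "(norm (st_est st - t))\<^sup>2 \<le> (1/2)\<^sup>2"
    using order_trans[OF e, of "(1/2)\<^sup>2"] lam(2) by (simp add: power2_eq_square pos_divide_le_eq)
  then have e2: "norm (st_est st - t) \<le> 1/2" by (rule power2_le_imp_le) simp
  let ?x = "st_est st"
  have tt: "t \<bullet> t = 1" using t by (simp add: norm_eq_sqrt_inner)
  have "\<bar>?x \<bullet> t - 1\<bar> \<le> 1/2" using Cauchy_Schwarz_ineq2[of "?x - t" t] t e2 by (simp add: inner_diff_left tt)
  then have xt: "1/2 \<le> ?x \<bullet> t" by linarith
  then have x0: "?x \<noteq> 0" by auto
  then have nx: "norm ?x > 0" by simp
  have c1: "norm c = 1" using x0 by simp
  define r where "r = c \<bullet> t"
  have rpos: "0 < r" using xt nx by (simp add: r_def)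
  have "(norm (t - r *\<^sub>R c))\<^sup>2 = 1 - r\<^sup>2"
    unfolding r_def norm_sq_residual[OF c1] by (simp add: t)
  then have "1 - r\<^sup>2 \<le> (1/2)\<^sup>2"
    using power_mono[OF projection_residual_le[of t ?x, folded r_def] norm_ge_zero, of 2] e4 by linarith
  then have "(1/2)\<^sup>2 \<le> r\<^sup>2" by (simp add: power2_eq_square)
  \<comment> \<open>The estimate is within 1/2 of \<open>t\<close>, so its direction has inner
    product at least 1/2 with \<open>t\<close>; a tilt of at most 1/2 cannot make that of an action
    negative.\<close>
  then have r: "1/2 \<le> r" using rpos by (intro power2_le_imp_le[of "1/2" r]) auto
  have "2 \<le> sqrt lam" using lam(2) by (intro real_le_rsqrt) simp
  then have mu2: "\<mu> \<le> 1/2" using lam2 by (intro divide_left_mono) auto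
  have vt: "\<bar>E (st_V st) i \<bullet> t\<bar> \<le> 1"
    using Cauchy_Schwarz_ineq2[of "E (st_V st) i" t] norm_selected[OF i] t by simp
  have "\<bar>\<mu> * (E (st_V st) i \<bullet> t)\<bar> \<le> 1/2 * 1"
    unfolding abs_mult using mu2 vt mu(1) by (intro mult_mono) auto
  then have "0 \<le> r + \<mu> * (E (st_V st) i \<bullet> t)" "0 \<le> r - \<mu> * (E (st_V st) i \<bullet> t)"
    using r unfolding abs_le_iff by linarith+
  then have pos: "0 \<le> (c + \<mu> *\<^sub>R E (st_V st) i) \<bullet> t" "0 \<le> (c - \<mu> *\<^sub>R E (st_V st) i) \<bullet> t"
    unfolding inner_add_left inner_diff_left inner_scaleR_left r_def by auto
  have A0: "0 \<le> alg_actions E st i b \<bullet> t"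
    using pos unfolding alg_actions_tilted by (cases b) (simp_all only: alg_actions_tilted inner_scaleR_left, simp_all)
  define a where "a = alg_actions E st i b \<bullet> t"
  have "a \<le> 1" using Cauchy_Schwarz_ineq2[of "alg_actions E st i b" t] norm_alg_actions_le[of E st i b] t 
    by (simp add: a_def abs_le_iff)
  then have "a * a \<le> a * 1" using A0 by (intro mult_left_mono) (auto simp: a_def)
  then have "(1 - a) / 2 \<le> (1 - a\<^sup>2) / 2" by (simp add: power2_eq_square)
  also have "1 - a\<^sup>2 \<le> 2 * (10.89 / lam + 1 / lam)"
    unfolding a_def by (rule actions_sin_sq(3)[OF t e i])
  also have "2 * (10.89 / lam + 1 / lam) / 2 = 11.89 / lam" by (simp add: field_simps)
  also have "\<dots> \<le> 1000000 / (real (fst st) + 1)"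
  proof -
    have "fst st \<noteq> 0" using weight_zero(2) T by auto
    then have "1 \<le> real (fst st)" by simp
    moreover have "real (fst st) / 8000 \<le> sqrt T" using ok by (simp add: design_ok_def Let_def)
    ultimately have "real (fst st) + 1 \<le> 16712 * lam" using lam(1) by simp
    then show ?thesis using lam(2) by (simp add: divide_simps)
  qed
  finally show ?thesis by (simp add: a_def)
qed

end

lemma expectation_mono_finite:
  fixes f g :: "'a \<Rightarrow> real"
  assumes "finite (set_pmf M)" "\<And>x. x \<in> set_pmf M \<Longrightarrow> f x \<le> g x"
  shows "measure_pmf.expectation M f \<le> measure_pmf.expectation M g"
  using assms by (intro integral_mono_AE integrable_measure_pmf_finite) (auto simp: AE_measure_pmf_iff)

section \<open>Trajectories of the run and the probability of failure\<close>

locale vvn_run =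
  fixes E :: "real^3^3 \<Rightarrow> nat \<Rightarrow> real^3" and J :: "real^3^3 \<Rightarrow> (nat \<Rightarrow> real^3) \<Rightarrow> nat" and k :: nat 
    and t :: "real^3" and p :: "real^3 \<Rightarrow> real" and th0 :: "real^3"
  assumes sel: "eig_selector E" and Jsel: "vvn_selector k J" and t: "norm t = 1"
    and p: "\<And>a. p a = (1 + a \<bullet> t) / 2"
begin

abbreviation "run \<equiv> alg_run p 2 k E J th0"

lemma finite_run: "finite (set_pmf (run n))"
proof (induction n)
  case (Suc n)
  have "finite (set_pmf (batch_rewards p k E st))" for st
    unfolding batch_rewards_def by (intro finite_set_Pi_pmf) auto
  then show ?case using Suc by simp
qed simp

lemma integrable_run: "integrable (measure_pmf (run n)) (f :: _ \<Rightarrow> real)"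
  by (rule integrable_measure_pmf_finite[OF finite_run])

lemma expectation_run_Suc:
  fixes f :: "_ \<Rightarrow> real"
  shows "measure_pmf.expectation (run (Suc n)) f = measure_pmf.expectation (run n) 
    (\<lambda>l. measure_pmf.expectation (batch_rewards p k E (last l)) (\<lambda>X. f (l @ [alg_step 2 k E J (last l) X])))"
  unfolding alg_run.simps
proof (subst expectation_bind_finite[OF finite_run])
  show "finite (set_pmf (map_pmf (\<lambda>X. l @ [alg_step 2 k E J (last l) X]) (batch_rewards p k E (last l))))" for l
    unfolding batch_rewards_def by (auto intro!: finite_set_Pi_pmf)
qed simp

lemma design_ok_init: "design_ok t (alg_init 2 th0)"
proof -
  have s: "transpose (2 *\<^sub>R mat 1 :: real^3^3) = 2 *\<^sub>R mat 1" by (simp add: transpose_scalar transpose_mat)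
  have a: "(2 *\<^sub>R mat 1 :: real^3^3) *v x = 2 *\<^sub>R x" for x 
    by (simp add: scaleR_matrix_vector_assoc[symmetric])
  have "2 \<le> lam_min (2 *\<^sub>R mat 1 :: real^3^3)"
    by (rule lam_min_greatest[OF sel s]) (simp add: a power2_norm_eq_inner)
  moreover have "trace (2 *\<^sub>R mat 1 :: real^3^3) = 6" 
    unfolding trace_scaleR by (simp add: trace_def mat_def)
  moreover have "sqrt 5 \<le> 3" "sqrt 6 \<le> 4" by (auto intro: real_le_lsqrt)
  moreover have "200 \<le> 1243 * sqrt (6::real)"
  proof -
    have "1 \<le> sqrt (6::real)" by simp
    then show ?thesis by linarith
  qed
  moreover have "t \<bullet> t = 1" using t by (simp add: norm_eq_sqrt_inner)
  ultimately show ?thesis by (simp add: design_ok_def alg_init_def s a)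
qed

text \<open>This describes estimates produced by a batch; the initial one is arbitrary.\<close>

definition estimate_eq :: "3 alg_state \<Rightarrow> bool" where
  "estimate_eq st \<longleftrightarrow> st_est st = (let V = st_V st; th = (\<lambda>j. matrix_inv V *v st_sums st j) in th (J V th))"

lemma run_support:
  assumes "l \<in> set_pmf (run n)"
  shows "length l = Suc n \<and> (\<forall>i\<le>n. fst (l ! i) = i \<and> (0 < i \<longrightarrow> estimate_eq (l ! i)) \<and>
      ((\<forall>i'<i. estimate_ok t (l ! i')) \<longrightarrow> design_ok t (l ! i)))"
  using assms
proof (induction n arbitrary: l)
  case 0
  then show ?case using design_ok_init by (simp add: alg_init_def)
next
  case (Suc n)
  then obtain l0 X where l0: "l0 \<in> set_pmf (run n)" and l: "l = l0 @ [alg_step 2 k E J (last l0) X]" by auto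
  note IH = Suc.IH[OF l0]
  have len: "length l0 = Suc n" using IH by simp
  then have last: "last l0 = l0 ! n" by (subst last_conv_nth) auto
  have old: "l ! i = l0 ! i" if "i \<le> n" for i using that len by (simp add: l nth_append)
  have new: "l ! Suc n = alg_step 2 k E J (l0 ! n) X" using len last by (simp add: l nth_append)
  show ?case
  proof (intro conjI allI impI)
    show "length l = Suc (Suc n)" using len by (simp add: l)
    fix i assume i: "i \<le> Suc n"
    show "fst (l ! i) = i"
      using i IH old new alg_step_sel(1) by (cases "i = Suc n") auto
    show "estimate_eq (l ! i)" if "0 < i"
    proof (cases "i = Suc n")
      case True
      show ?thesis unfolding True new estimate_eq_def alg_step_sel(2) alg_step_sel(4) Let_def by (rule refl)
    qed (use i IH old that in auto)
    show "design_ok t (l ! i)" if g: "\<forall>i'<i. estimate_ok t (l ! i')"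
    proof (cases "i = Suc n")
      case True
      then have g': "\<forall>i'\<le>n. estimate_ok t (l0 ! i')" using g old by force
      then interpret design_state E "l0 ! n" t
        using IH by unfold_locales (auto intro: sel t)
      show ?thesis unfolding True new using g' by (intro design_ok_step) auto
    next
      case False
      then show ?thesis using g i IH old by auto
    qed
  qed
qed

lemma run_last:
  assumes "l \<in> set_pmf (run n)" 
  shows "last l = l ! n" "butlast l @ [l ! n] = l" "fst (last l) = n" "0 < n \<Longrightarrow> estimate_eq (last l)"
    and "\<forall>st\<in>set (butlast l). estimate_ok t st \<Longrightarrow> design_ok t (last l)"
proof -
  note s = run_support[OF assms]
  have ne: "l \<noteq> []" using s by auto
  show last: "last l = l ! n" using s ne by (simp add: last_conv_nth)
  show "butlast l @ [l ! n] = l" using ne last[symmetric] by simp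
  show "fst (last l) = n" "0 < n \<Longrightarrow> estimate_eq (last l)" using s last by auto
  assume *: "\<forall>st\<in>set (butlast l). estimate_ok t st"
  have "estimate_ok t (l ! i)" if "i < n" for i
  proof -
    have "i < length (butlast l)" "butlast l ! i = l ! i" using that s by (auto simp: nth_butlast)
    then show ?thesis using * nth_mem by metis
  qed
  then show "design_ok t (last l)" using s last by auto
qed

text \<open>The current state is left out, so \<open>past_ok\<close> of a run extended by one batch
  is \<open>all_ok\<close> of the run before it and is decided before the new rewards.\<close>

definition past_ok :: "3 alg_state list \<Rightarrow> bool" where "past_ok l \<longleftrightarrow> (\<forall>st\<in>set (butlast l). estimate_ok t st)"
definition all_ok :: "3 alg_state list \<Rightarrow> bool" where "all_ok l \<longleftrightarrow> (\<forall>st\<in>set l. estimate_ok t st)"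

lemma design_state_last: "l \<in> set_pmf (run n) \<Longrightarrow> past_ok l \<Longrightarrow> design_state E (last l) t"
  using run_last(5) by unfold_locales (auto intro: sel t simp: past_ok_def)

text \<open>The indicator stops the process at the first failure, so the supermartingale step is
  applied only where its hypothesis holds. Initially the noise is 0 and the whole budget remains, so
  each factor is \<open>1 + 13/33\<close>.\<close>

lemma expectation_noise_prod:
  assumes L: "576 \<le> L"
  shows "measure_pmf.expectation (run n) (\<lambda>l. of_bool (past_ok l) * noise_prod k t L (last l)) \<le> (46/33) ^ k"
proof (induction n)
  case 0
  interpret design_state E "alg_init 2 th0" t using design_ok_init by unfold_locales (auto intro: sel t)
  have T6: "T = 6" using weight_zero(2) by (simp add: alg_init_def)
  have n0: "noise t (alg_init 2 th0) j = 0" for j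
    by (simp add: noise_def alg_init_def scaleR_matrix_vector_assoc[symmetric])
  have "noise_prod k t L (alg_init 2 th0) = (46/33) ^ k"
    using budget_diff_pos[OF L] L unfolding noise_prod_def T6 n0 by (simp add: energy_def)
  then show ?case by (simp add: past_ok_def)
next
  case (Suc n)
  have "measure_pmf.expectation (run (Suc n)) (\<lambda>l. of_bool (past_ok l) * noise_prod k t L (last l))
     = measure_pmf.expectation (run n) (\<lambda>l. of_bool (all_ok l) * 
         measure_pmf.expectation (batch_rewards p k E (last l)) (\<lambda>X. noise_prod k t L (alg_step 2 k E J (last l) X)))"
    unfolding expectation_run_Suc by (simp add: past_ok_def all_ok_def)
  also have "\<dots> \<le> measure_pmf.expectation (run n) (\<lambda>l. of_bool (past_ok l) * noise_prod k t L (last l))"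
  proof (rule expectation_mono_finite[OF finite_run])
    fix l assume l: "l \<in> set_pmf (run n)"
    show "of_bool (all_ok l) * measure_pmf.expectation (batch_rewards p k E (last l)) (\<lambda>X. noise_prod k t L (alg_step 2 k E J (last l) X))
      \<le> of_bool (past_ok l) * noise_prod k t L (last l)"
    proof (cases "past_ok l")
      case True
      interpret design_state E "last l" t by (rule design_state_last[OF l True])
      have "l \<noteq> []" using run_support[OF l] by auto
      then have "estimate_ok t (last l)" if "all_ok l" using that by (simp add: all_ok_def)
      then show ?thesis using True noise_prod_supermartingale[OF _ L p] noise_prod_nonneg[OF L] by (cases "all_ok l") auto
    next
      case False
      then have "\<not> all_ok l" by (auto simp: past_ok_def all_ok_def dest: in_set_butlastD)
      then show ?thesis using False by simp
    qed
  qed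
  also note Suc.IH
  finally show ?case .
qed

text \<open>A failure means that the majority condition is violated at the level \<open>L\<close>
  obtained by rounding up the trace. At least \<open>k / 2 - 1\<close> factors are then at least
  2.3, because \<open>13/33 * 3.3 = 1.3\<close>, and the others are at least 1.\<close>

lemma noise_prod_large:
  assumes l: "l \<in> set_pmf (run n)" and ok: "past_ok l" and bad: "\<not> estimate_ok t (last l)"
  obtains L where "L \<in> {576..(n+4)\<^sup>2 + 1}" "sqrt 2.3 ^ k / 2.3 \<le> noise_prod k t (real L) (last l)"
proof -
  interpret design_state E "last l" t by (rule design_state_last[OF l ok])
  have T: "576 \<le> T" using bad by (auto simp: estimate_ok_def)
  define L where "L = nat \<lceil>T\<rceil>"
  have L: "real L - 1 < T" "T \<le> real L" "576 \<le> real L" using T unfolding L_def by linarith+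
  have "0 < n" using weight_zero(2) T run_last(3)[OF l] by (cases "n = 0") auto
  then have eq: "estimate_eq (last l)" by (rule run_last(4)[OF l])
  have "sqrt T \<le> 4 + real n" using design_ok_step ok run_last(3,5)[OF l] by (auto simp: design_ok_def Let_def past_ok_def)
  then have "T \<le> (4 + real n)\<^sup>2" by (rule sqrt_le_D)
  then have "real L < real ((n+4)\<^sup>2 + 2)" using L by (simp add: add.commute)
  then have "L < (n+4)\<^sup>2 + 2" by (simp only: of_nat_less_iff)
  then have LI: "L \<in> {576..(n+4)\<^sup>2 + 1}" using L(3) by simp
  let ?D = "budget L L - budget L 6" and ?en = "\<lambda>j. energy (coef_perp L) (coef_par L) t (noise t (last l) j)"
  define G B where "G = {j\<in>{1..k}. ?en j \<le> 3.3 * ?D}" and "B = {j\<in>{1..k}. \<not> ?en j \<le> 3.3 * ?D}"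
  have "\<not> k + 3 \<le> 2 * card G"
    using estimate_ok_of_majority[OF Jsel eq[unfolded estimate_eq_def] L] bad unfolding G_def by blast
  moreover have "card G + card B = k"
  proof -
    have "card G + card B = card (G \<union> B)" by (rule card_Un_disjoint[symmetric]) (auto simp: G_def B_def)
    also have "G \<union> B = {1..k}" by (auto simp: G_def B_def)
    finally show ?thesis by simp
  qed
  ultimately have cB: "k \<le> 2 * (card B + 1)" by arith
  have D: "0 < ?D" by (rule budget_diff_pos[OF L(3)])
  have Q: "0 \<le> budget L L - budget L T" using budget_mono[OF L(3), of T L] T L by simp
  have "sqrt 2.3 ^ k \<le> sqrt 2.3 ^ (2 * (card B + 1))"
    by (rule power_increasing[OF cB]) simp
  also have "\<dots> = 2.3 ^ card B * 2.3" unfolding power_mult by simp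
  finally have "sqrt 2.3 ^ k / 2.3 \<le> 2.3 ^ card B" by simp
  also have "\<dots> = (\<Prod>j\<in>{1..k}. if j \<in> B then 2.3 else 1)"
  proof -
    have "{1..k} \<inter> {j. j \<in> B} = B" by (auto simp: B_def)
    then show ?thesis by (subst prod.If_cases) auto
  qed
  also have "\<dots> \<le> (\<Prod>j\<in>{1..k}. 1 + 13/33 * ((budget L L - budget L T + ?en j) / ?D))"
  proof (rule prod_mono, rule conjI)
    fix j assume "j \<in> {1..k}"
    show "(if j \<in> B then 2.3 else 1) \<le> 1 + 13/33 * ((budget L L - budget L T + ?en j) / ?D)"
    proof (cases "j \<in> B")
      case True
      then have "3.3 * ?D \<le> budget L L - budget L T + ?en j" using Q by (simp add: B_def)
      then have "3.3 \<le> (budget L L - budget L T + ?en j) / ?D" using D by (simp add: pos_le_divide_eq)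
      moreover have "2.3 \<le> 1 + 13/33 * x" if "3.3 \<le> x" for x :: real using that by simp
      ultimately show ?thesis using True by (simp only: if_True)
    next
      case False
      moreover have "1 \<le> 1 + 13/33 * x" if "0 \<le> x" for x :: real using that by simp
      ultimately show ?thesis using noise_factor_nonneg[OF L(3,2)] by (simp only: if_False)
    qed
  qed simp
  also have "\<dots> = noise_prod k t L (last l)" using L(2) by (simp add: noise_prod_def)
  finally show ?thesis using that[OF LI] by simp
qed

text \<open>A factor of the noise product is at least 2.3 if its energy exceeds the threshold, which
  happens for about half of the indices when the estimate fails; its initial value is 46/33.\<close>
definition rate :: real where "rate = (46/33) / sqrt 2.3"

text \<open>Markov's inequality for each level and a union bound over the levels reachable by batch
  \<open>n\<close>.\<close>

lemma prob_first_failure: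
  "measure_pmf.expectation (run n) (\<lambda>l. of_bool (past_ok l \<and> \<not> estimate_ok t (last l))) \<le> (real n + 4)\<^sup>2 * (2.3 * rate ^ k)"
proof -
  let ?I = "{576..(n+4)\<^sup>2 + 1}"
  have pos: "0 < sqrt 2.3 ^ k / (2.3::real)" by simp
  have "measure_pmf.expectation (run n) (\<lambda>l. of_bool (past_ok l \<and> \<not> estimate_ok t (last l)))
    \<le> measure_pmf.expectation (run n) (\<lambda>l. \<Sum>L\<in>?I. of_bool (past_ok l) * noise_prod k t (real L) (last l) / (sqrt 2.3 ^ k / 2.3))"
  proof (rule expectation_mono_finite[OF finite_run])
    fix l assume l: "l \<in> set_pmf (run n)"
    have nn: "0 \<le> of_bool (past_ok l) * noise_prod k t (real L) (last l) / (sqrt 2.3 ^ k / 2.3)" if "L \<in> ?I" for L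
      using design_state.noise_prod_nonneg[OF design_state_last[OF l]] that pos by (cases "past_ok l") auto
    show "of_bool (past_ok l \<and> \<not> estimate_ok t (last l)) \<le> (\<Sum>L\<in>?I. of_bool (past_ok l) * noise_prod k t (real L) (last l) / (sqrt 2.3 ^ k / 2.3))"
    proof (cases "past_ok l \<and> \<not> estimate_ok t (last l)")
      case True
      then obtain L where L: "L \<in> ?I" "sqrt 2.3 ^ k / 2.3 \<le> noise_prod k t (real L) (last l)"
        using noise_prod_large[OF l] by blast
      have "1 \<le> noise_prod k t (real L) (last l) / (sqrt 2.3 ^ k / 2.3)" using L(2) pos by (simp only: pos_le_divide_eq mult_1)
      also have "\<dots> = of_bool (past_ok l) * noise_prod k t (real L) (last l) / (sqrt 2.3 ^ k / 2.3)" using True by simp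
      also have "\<dots> \<le> (\<Sum>L\<in>?I. of_bool (past_ok l) * noise_prod k t (real L) (last l) / (sqrt 2.3 ^ k / 2.3))"
        by (rule member_le_sum[OF L(1)]) (use nn in auto)
      finally show ?thesis using True by simp
    next
      case False
      have "0 \<le> (\<Sum>L\<in>?I. of_bool (past_ok l) * noise_prod k t (real L) (last l) / (sqrt 2.3 ^ k / 2.3))"
        by (rule sum_nonneg[OF nn])
      moreover have "of_bool (past_ok l \<and> \<not> estimate_ok t (last l)) = (0::real)" using False by simp
      ultimately show ?thesis by linarith
    qed
  qed
  also have "\<dots> = (\<Sum>L\<in>?I. measure_pmf.expectation (run n) (\<lambda>l. of_bool (past_ok l) * noise_prod k t (real L) (last l)) / (sqrt 2.3 ^ k / 2.3))"
    by (subst Bochner_Integration.integral_sum) (auto intro!: integrable_run)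
  also have "\<dots> \<le> (\<Sum>L\<in>?I. (46/33) ^ k / (sqrt 2.3 ^ k / 2.3))"
    by (intro sum_mono divide_right_mono expectation_noise_prod) auto
  also have "\<dots> = real (card ?I) * (2.3 * rate ^ k)" by (simp add: rate_def power_divide)
  also have "\<dots> \<le> (real n + 4)\<^sup>2 * (2.3 * rate ^ k)"
  proof (rule mult_right_mono)
    have "card ?I \<le> (n+4)\<^sup>2" by simp
    then have "real (card ?I) \<le> real ((n+4)\<^sup>2)" by (rule of_nat_mono)
    then show "real (card ?I) \<le> (real n + 4)\<^sup>2" by simp
  qed (simp add: rate_def)
  finally show ?thesis .
qed

lemma prob_failure:
  "measure_pmf.expectation (run n) (\<lambda>l. of_bool (\<not> all_ok l)) \<le> (real n + 1) * (real n + 4)\<^sup>2 * (2.3 * rate ^ k)"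
proof (induction n)
  case 0
  have "estimate_ok t (alg_init 2 th0)"
    using design_ok_init by (auto simp: estimate_ok_def design_ok_def Let_def alg_init_def)
  then show ?case by (simp add: all_ok_def rate_def)
next
  case (Suc n)
  have "measure_pmf.expectation (run (Suc n)) (\<lambda>l. of_bool (\<not> all_ok l)) 
    \<le> measure_pmf.expectation (run (Suc n)) (\<lambda>l. of_bool (\<not> past_ok l) + of_bool (past_ok l \<and> \<not> estimate_ok t (last l)) :: real)"
  proof (rule expectation_mono_finite[OF finite_run])
    fix l assume l: "l \<in> set_pmf (run (Suc n))"
    have "all_ok l \<longleftrightarrow> past_ok l \<and> estimate_ok t (last l)"
      unfolding all_ok_def past_ok_def by (subst run_last(2)[OF l, symmetric]) (auto simp: run_last(1)[OF l])
    then show "of_bool (\<not> all_ok l) \<le> (of_bool (\<not> past_ok l) + of_bool (past_ok l \<and> \<not> estimate_ok t (last l)) :: real)"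
      by auto
  qed
  also have "\<dots> = measure_pmf.expectation (run (Suc n)) (\<lambda>l. of_bool (\<not> past_ok l) :: real) 
     + measure_pmf.expectation (run (Suc n)) (\<lambda>l. of_bool (past_ok l \<and> \<not> estimate_ok t (last l)) :: real)"
    by (rule Bochner_Integration.integral_add) (rule integrable_run)+
  also have "measure_pmf.expectation (run (Suc n)) (\<lambda>l. of_bool (\<not> past_ok l) :: real) 
      = measure_pmf.expectation (run n) (\<lambda>l. of_bool (\<not> all_ok l))"
    unfolding expectation_run_Suc by (simp add: past_ok_def all_ok_def)
  also have "\<dots> + measure_pmf.expectation (run (Suc n)) (\<lambda>l. of_bool (past_ok l \<and> \<not> estimate_ok t (last l)))
    \<le> (real n + 1) * (real n + 4)\<^sup>2 * (2.3 * rate ^ k) + (real (Suc n) + 4)\<^sup>2 * (2.3 * rate ^ k)"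
    by (rule add_mono[OF Suc.IH prob_first_failure])
  also have "\<dots> \<le> (real n + 1) * (real (Suc n) + 4)\<^sup>2 * (2.3 * rate ^ k) + (real (Suc n) + 4)\<^sup>2 * (2.3 * rate ^ k)"
    by (intro add_right_mono mult_right_mono mult_left_mono power_mono) (auto simp: rate_def)
  also have "\<dots> = (real (Suc n) + 1) * (real (Suc n) + 4)\<^sup>2 * (2.3 * rate ^ k)" by (simp add: algebra_simps)
  finally show ?case .
qed

text \<open>The square of \<open>rate\<close> is \<open>920/1089\<close>, and the sixth power of its
  inverse exceeds 2.72. With \<open>k\<close> at least \<open>48 * ln N\<close> this makes
  \<open>rate ^ k\<close> at most \<open>1 / N ^ 4\<close>.\<close>

lemma rate_le: "rate \<le> exp (- 1 / 12)"
proof (rule power2_le_imp_le)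
  have "exp (1/6::real) ^ 6 = exp 1" by (simp flip: exp_of_nat_mult)
  also have "\<dots> \<le> (1089/920) ^ 6" using e_less_272 by (simp add: power_divide)
  finally have "exp (1/6::real) \<le> 1089/920" by (rule power_le_imp_le_base[of _ 5, simplified]) simp
  then have "1 / (1089/920) \<le> 1 / exp (1/6::real)" by (intro divide_left_mono) auto
  also have "1 / exp (1/6::real) = (exp (- 1 / 12))\<^sup>2" by (simp add: exp_minus inverse_eq_divide power2_eq_square flip: exp_add)
  finally show "rate\<^sup>2 \<le> (exp (- 1 / 12))\<^sup>2" by (simp add: rate_def power_divide power2_eq_square)
qed simp

lemma expected_error:
  assumes N: "2 \<le> N" and k: "48 * ln (real N) \<le> real k" and s: "s < N" and i: "i \<in> {1..2}"
  shows "measure_pmf.expectation (run N) (\<lambda>l. 1 - p (alg_actions E (l ! s) i b)) \<le> 2000000 / (real s + 1)"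
proof -
  have "measure_pmf.expectation (run N) (\<lambda>l. 1 - p (alg_actions E (l ! s) i b)) 
    \<le> measure_pmf.expectation (run N) (\<lambda>l. 1000000 / (real s + 1) + of_bool (\<not> all_ok l))"
  proof (rule expectation_mono_finite[OF finite_run])
    fix l assume l: "l \<in> set_pmf (run N)"
    note sup = run_support[OF l]
    have e: "1 - p (alg_actions E (l ! s) i b) = (1 - alg_actions E (l ! s) i b \<bullet> t) / 2" by (simp add: p field_simps)
    show "1 - p (alg_actions E (l ! s) i b) \<le> 1000000 / (real s + 1) + of_bool (\<not> all_ok l)"
    proof (cases "all_ok l")
      case True
      have est: "estimate_ok t (l ! i')" if "i' \<le> N" for i'
        using True sup that unfolding all_ok_def by (metis le_imp_less_Suc nth_mem)
      interpret design_state E "l ! s" t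
        using sup s est by unfold_locales (auto intro: sel t)
      have "fst (l ! s) = s" using sup s by auto
      then show ?thesis using action_regret_le[OF est[OF less_imp_le[OF s]] i, of b] s True unfolding e by simp
    next
      case False
      have "\<bar>alg_actions E (l ! s) i b \<bullet> t\<bar> \<le> 1"
        using Cauchy_Schwarz_ineq2[of "alg_actions E (l ! s) i b" t] norm_alg_actions_le[of E "l ! s" i b] t by simp
      then have "(1 - alg_actions E (l ! s) i b \<bullet> t) / 2 \<le> 1" by (simp add: abs_le_iff)
      moreover have "0 \<le> 1000000 / (real s + 1)" "of_bool (\<not> all_ok l) = (1::real)" using False by simp_all
      ultimately show ?thesis unfolding e by linarith
    qed
  qed
  also have "\<dots> = 1000000 / (real s + 1) + measure_pmf.expectation (run N) (\<lambda>l. of_bool (\<not> all_ok l))"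
    by (subst Bochner_Integration.integral_add) (auto intro: integrable_run)
  \<comment> \<open>The polynomial factor of \<open>prob_failure\<close> is at most
    \<open>18 * N ^ 3\<close>, so one power of \<open>N\<close> is left, enough for every batch
    \<open>s < N\<close>.\<close>
  also have "measure_pmf.expectation (run N) (\<lambda>l. of_bool (\<not> all_ok l)) \<le> 42 / real N"
  proof -
    have N0: "0 < real N" using N by simp
    have "rate ^ k \<le> exp (- 1 / 12) ^ k" using rate_le by (intro power_mono) (simp_all add: rate_def)
    also have "\<dots> = exp (- real k / 12)" by (simp flip: exp_of_nat_mult)
    also have "\<dots> \<le> exp (- (4 * ln (real N)))" using k by simp
    also have "\<dots> = 1 / real N ^ 4" 
      using N0 exp_of_nat_mult[of 4 "ln (real N)"] by (simp add: exp_minus inverse_eq_divide)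
    finally have r: "rate ^ k \<le> 1 / real N ^ 4" .
    have "(real N + 4)\<^sup>2 \<le> (3 * real N)\<^sup>2" using N by (intro power_mono) auto
    then have B: "(real N + 1) * (real N + 4)\<^sup>2 \<le> (2 * real N) * (3 * real N)\<^sup>2"
      using N by (intro mult_mono) simp_all
    have "(real N + 1) * (real N + 4)\<^sup>2 * (2.3 * rate ^ k) \<le> ((2 * real N) * (3 * real N)\<^sup>2) * (2.3 * rate ^ k)"
      by (rule mult_right_mono[OF B]) (simp add: rate_def)
    also have "\<dots> \<le> ((2 * real N) * (3 * real N)\<^sup>2) * (2.3 * (1 / real N ^ 4))"
      by (rule mult_left_mono) (use r in simp_all)
    also have "\<dots> = 41.4 / real N" using N0 by (simp add: power2_eq_square power4_eq_xxxx)
    also have "\<dots> \<le> 42 / real N" using N0 by (intro divide_right_mono) auto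
    finally show ?thesis using prob_failure[of N] by linarith
  qed
  also have "42 / real N \<le> 1000000 / (real s + 1)"
    using s by (intro frac_le) auto
  finally show ?thesis by simp
qed

end

section \<open>Harmonic sums and the passage from batches to rounds\<close>

lemma sum_inverse_le_ln: "1 \<le> n \<Longrightarrow> (\<Sum>j=1..n. 1 / real j) \<le> 1 + ln (real n)"
proof (induction n rule: nat_induct_at_least)
  case (Suc n)
  have "ln (real n / real (Suc n)) \<le> real n / real (Suc n) - 1" using Suc by (intro ln_le_minus_one) simp
  also have "\<dots> = - (1 / real (Suc n))" by (simp add: field_simps)
  finally have "1 / real (Suc n) \<le> ln (real (Suc n)) - ln (real n)" using Suc by (simp add: ln_div)
  then show ?case using Suc by simp
qed simp

theorem mainTheorem1:
  "\<exists>C1 C2 C3 :: real. C1 \<ge> 0 \<and> C2 \<ge> 0 \<and> C3 \<ge> 0 \<and>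
    (\<forall>Tt :: nat. Tt \<ge> 2 \<longrightarrow>
      (let k = nat \<lceil>24 * ln (real Tt ^ 2)\<rceil>; T = 4 * k * Tt in
       \<forall>(psi :: complex^2) (E :: real^3^3 \<Rightarrow> nat \<Rightarrow> real^3) J (th0 :: real^3).
         norm psi = 1 \<longrightarrow> eig_selector E \<longrightarrow> vvn_selector k J \<longrightarrow> norm th0 = 1 \<longrightarrow>
         (let p = qubit_reward psi; P = alg_run p 2 k E J th0 Tt in
          measure_pmf.expectation P (\<lambda>l. \<Sum>t=1..T. 1 - p (round_action E k l t))
            \<le> C1 * ln (real T) + C2 * (ln (real T))^2 \<and>
          (\<forall>t\<in>{1..T}. \<forall>i\<in>{1..2}. \<forall>b.
             measure_pmf.expectation P (\<lambda>l. 1 - p (alg_actions E (l ! ((t - 1) div (4 * k))) i b))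
               \<le> C3 * ln (real T) / real t))))"
\<comment> \<open>One value serves for all three constants: \<open>2000000 * 4 * k\<close> with
  \<open>k\<close> at most \<open>49 * ln T\<close> is below
  \<open>400000000 * ln T\<close>.\<close>
proof (intro exI[of _ "400000000::real"] conjI allI impI)
  fix Tt :: nat assume N: "2 \<le> Tt"
  define k where "k = nat \<lceil>24 * ln (real Tt ^ 2)\<rceil>"
  define T where "T = 4 * k * Tt"
  have l2: "0 < ln (real Tt)" using N by simp
  have le: "24 * ln (real Tt ^ 2) = 48 * ln (real Tt)" using N by (simp add: ln_realpow)
  have k: "48 * ln (real Tt) \<le> real k" "real k \<le> 48 * ln (real Tt) + 1" and kpos: "0 < k"
    using l2 unfolding k_def le by linarith+
  have T8: "8 \<le> T" 
  proof -
    have "4 * 1 * 2 \<le> 4 * k * Tt" using kpos N by (intro mult_le_mono) auto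
    then show ?thesis by (simp add: T_def)
  qed
  have "Tt * 1 \<le> Tt * (4 * k)" using kpos by (intro mult_le_mono2) auto
  then have TtT: "Tt \<le> T" by (simp add: T_def mult.commute)
  have lnT: "1 \<le> ln (real T)"
  proof -
    have "exp 1 \<le> real T" using e_less_272 T8 by simp
    then show ?thesis using T8 by (subst ln_ge_iff) auto
  qed
  have "ln (real Tt) \<le> ln (real T)" using TtT N by simp
  then have kT: "real k \<le> 49 * ln (real T)" using k(2) lnT by linarith
  show "let k = nat \<lceil>24 * ln (real Tt ^ 2)\<rceil>; T = 4 * k * Tt in
       \<forall>(psi :: complex^2) (E :: real^3^3 \<Rightarrow> nat \<Rightarrow> real^3) J (th0 :: real^3).
         norm psi = 1 \<longrightarrow> eig_selector E \<longrightarrow> vvn_selector k J \<longrightarrow> norm th0 = 1 \<longrightarrow>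
         (let p = qubit_reward psi; P = alg_run p 2 k E J th0 Tt in
          measure_pmf.expectation P (\<lambda>l. \<Sum>t=1..T. 1 - p (round_action E k l t))
            \<le> 400000000 * ln (real T) + 400000000 * (ln (real T))^2 \<and>
          (\<forall>t\<in>{1..T}. \<forall>i\<in>{1..2}. \<forall>b.
             measure_pmf.expectation P (\<lambda>l. 1 - p (alg_actions E (l ! ((t - 1) div (4 * k))) i b))
               \<le> 400000000 * ln (real T) / real t))"
    unfolding k_def[symmetric] Let_def T_def[symmetric]
  proof (intro allI impI)
    fix psi :: "complex^2" and E :: "real^3^3 \<Rightarrow> nat \<Rightarrow> real^3" and J :: "real^3^3 \<Rightarrow> (nat \<Rightarrow> real^3) \<Rightarrow> nat" and th0 :: "real^3"
    assume psi: "norm psi = 1" and E: "eig_selector E" and J: "vvn_selector k J"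
    let ?p = "qubit_reward psi"
    let ?P = "alg_run ?p 2 k E J th0 Tt"
    obtain \<theta> :: "real^3" where \<theta>: "norm \<theta> = 1" "\<And>a. ?p a = (1 + a \<bullet> \<theta>) / 2"
      using bloch_vector_exists[OF psi] by blast
    interpret vvn_run E J k \<theta> ?p th0 using E J \<theta> by unfold_locales auto
    have err: "measure_pmf.expectation ?P (\<lambda>l. 1 - ?p (alg_actions E (l ! ((t - 1) div (4 * k))) i b)) \<le> 400000000 * ln (real T) / real t"
      if t: "t \<in> {1..T}" and i: "i \<in> {1..2}" for t i b
    proof -
      let ?s = "(t - 1) div (4 * k)"
      have "t - 1 < T" using t by (simp only: atLeastAtMost_iff) linarith
      then have "t - 1 < Tt * (4 * k)" by (simp add: T_def mult.commute mult.left_commute)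
      then have s: "?s < Tt" using kpos by (simp add: div_less_iff_less_mult)
      have "t - 1 < (?s + 1) * (4 * k)" using kpos by (simp add: dividend_less_div_times)
      then have "t \<le> (?s + 1) * (4 * k)" using t by simp
      \<comment> \<open>The batch with zero-based index \<open>?s\<close> ends with round
        \<open>(?s + 1) * (4 * k)\<close>, so an error of order \<open>1 / (?s + 1)\<close> is of
        order \<open>k / t\<close>.\<close>
      then have "real t \<le> real ((?s + 1) * (4 * k))" by (rule of_nat_mono)
      also have "\<dots> = (real ?s + 1) * (4 * real k)" by (simp only: of_nat_mult of_nat_add of_nat_1 of_nat_numeral)
      finally have ts: "real t \<le> (real ?s + 1) * (4 * real k)" .
      have "measure_pmf.expectation ?P (\<lambda>l. 1 - ?p (alg_actions E (l ! ?s) i b)) \<le> 2000000 / (real ?s + 1)"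
        by (rule expected_error[OF N k(1) s i])
      also have "\<dots> \<le> 2000000 * (4 * real k) / real t"
        using ts t by (simp add: field_simps)
      also have "\<dots> \<le> 400000000 * ln (real T) / real t"
        using kT lnT t by (intro divide_right_mono) auto
      finally show ?thesis .
    qed
    have reg: "measure_pmf.expectation ?P (\<lambda>l. 1 - ?p (round_action E k l t)) \<le> 400000000 * ln (real T) * (1 / real t)"
      if t: "t \<in> {1..T}" for t
    proof -
      have "(t - 1) mod (4 * k) < 2 * (2 * k)" using kpos by (simp add: mult.assoc[symmetric])
      then have "(t - 1) mod (4 * k) div (2 * k) < 2" using kpos by (simp add: div_less_iff_less_mult)
      then have "(t - 1) mod (4 * k) div (2 * k) + 1 \<in> {1..2}" by simp
      from err[OF t this] show ?thesis by (simp add: round_action_def Let_def)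
    qed
    have "measure_pmf.expectation ?P (\<lambda>l. \<Sum>t=1..T. 1 - ?p (round_action E k l t)) 
       = (\<Sum>t=1..T. measure_pmf.expectation ?P (\<lambda>l. 1 - ?p (round_action E k l t)))"
      by (rule Bochner_Integration.integral_sum) (rule integrable_run)
    also have "\<dots> \<le> (\<Sum>t=1..T. 400000000 * ln (real T) * (1 / real t))" by (rule sum_mono) (rule reg)
    also have "\<dots> = 400000000 * ln (real T) * (\<Sum>t=1..T. 1 / real t)" by (rule sum_distrib_left[symmetric])
    \<comment> \<open>The harmonic sum contributes the second logarithm of the regret bound.\<close>
    also have "\<dots> \<le> 400000000 * ln (real T) * (1 + ln (real T))"
      using lnT T8 by (intro mult_left_mono sum_inverse_le_ln) auto
    also have "\<dots> = 400000000 * ln (real T) + 400000000 * (ln (real T))\<^sup>2"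
      by (simp add: power2_eq_square algebra_simps)
    finally show "measure_pmf.expectation ?P (\<lambda>l. \<Sum>t=1..T. 1 - ?p (round_action E k l t)) 
        \<le> 400000000 * ln (real T) + 400000000 * (ln (real T))\<^sup>2 \<and>
      (\<forall>t\<in>{1..T}. \<forall>i\<in>{1..2}. \<forall>b. measure_pmf.expectation ?P 
          (\<lambda>l. 1 - ?p (alg_actions E (l ! ((t - 1) div (4 * k))) i b)) \<le> 400000000 * ln (real T) / real t)"
      using err by blast
  qed
qed simp_all

end
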